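(* Suppose $p>2$. Given monic polynomials $P_1(u),\ldots,P_n(u)\in\mathbb K[u]$ with $P_1(u)=P_1(-u+1)$, there exists a tuple $\mu(u)=(\mu_1(u),\ldots,\mu_n(u))$ of series in $1+u^{-1}\mathbb K[[u^{-1}]]$ and a finite-dimensional (irreducible highest weight) representation $V(\mu(u),p)$ of $Y(\mathfrak{o}_{2n})$ such that $$\frac{\mu_i(u)}{\mu_{i+1}(u)}=\frac{P_{i+1}(u+1)}{P_{i+1}(u)},\quad i=1,\ldots,n-1,\qquad\text{and}\qquad\frac{\mu_1(-u)}{\mu_1(u)}=\frac{P_1(u+1)}{P_1(u)}.$$
   Context: $\mathbb K$ is an algebraically closed field of characteristic $p$, $N=2n$; rows and columns of $N\times N$ matrices are indexed by $I_N=\{-n,\ldots,-1,1,\ldots,n\}$. $A'$ is the matrix with $(A')_{ij}=a_{-j,-i}$. $P=\sum E_{ij}\otimes E_{ji}$, $R(u)=1-P/u$, $R'(u)=1-P'/u$ where $P'$ is $P$ with $A\mapsto A'$ applied in the first tensor factor. $Y(\mathfrak{o}_{2n})$ is the unital associative $\mathbb K$-algebra generated by $s_{ij}^{(r)}$ ($r\ge1$, $i,j\in I_N$) with $\mathcal S(u)=[s_{ij}(u)]$, $s_{ij}(u)=\delta_{ij}+\sum_{r\ge1}s_{ij}^{(r)}u^{-r}$, and relations $R(u-v)\mathcal S_1(u)R'(-u-v)\mathcal S_2(v)=\mathcal S_2(v)R'(-u-v)\mathcal S_1(u)R(u-v)$ and $\mathcal S'(-u)=\mathcal S(u)+\frac{\mathcal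 S(u)-\mathcal S(-u)}{2u}$. A highest weight representation with highest weight $\mu(u)$ is one generated by a nonzero vector $\xi$ with $s_{ij}(u)\xi=0$ for $i<j$ and $s_{ii}(u)\xi=\mu_i(u)\xi$ for $1\le i\le n$. $V(\mu(u),p)$ denotes the irreducible highest weight representation with highest weight $\mu(u)$ (simple quotient of the Verma module, i.e. of the quotient of $Y(\mathfrak{o}_{2n})$ by the left ideal generated by the coefficients of $s_{ij}(u)$, $i<j$, and $s_{ii}(u)-\mu_i(u)$, $1\le i\le n$). *)

theory Defs
  imports
    "HOL-Library.Poly_Mapping"
    "HOL-Computational_Algebra.Formal_Laurent_Series"
    "HOL-Algebra.QuotRing"
    "HOL-Algebra.Module"
begin

section \<open>Free associative algebras\<close>

text \<open>The free algebra on \<^typ>\<open>'g\<close> over \<^typ>\<open>'k\<close> is the monoid algebra of the free monoid of words,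
  i.e. finitely supported functions on words with the convolution product of
  \<^theory>\<open>HOL-Library.Poly_Mapping\<close>. The wrapper type only serves to make words an additively
  written (noncommutative) monoid.\<close>

datatype 'g word = Word (letters: "'g list")

instantiation word :: (type) monoid_add
begin

definition zero_word :: "'a word" where
  "zero_word = Word []"

definition plus_word :: "'a word \<Rightarrow> 'a word \<Rightarrow> 'a word" where
  "plus_word v w = Word (letters v @ letters w)"

instance
  by standard (simp_all add: zero_word_def plus_word_def)

end

type_synonym ('k, 'g) free_alg = "'g word \<Rightarrow>\<^sub>0 'k"

definition scal :: "'k \<Rightarrow> ('k::ring_1, 'g) free_alg" where
  "scal c = Poly_Mapping.single 0 c"

definition letter :: "'g \<Rightarrow> ('k::ring_1, 'g) free_alg" where
  "letter g = Poly_Mapping.single (Word [g]) 1"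

definition free_alg_ring :: "'g set \<Rightarrow> ('k::ring_1, 'g) free_alg ring" where
  "free_alg_ring G =
    \<lparr>carrier = {f. \<forall>w\<in>Poly_Mapping.keys f. set (letters w) \<subseteq> G},
     mult = (*), one = 1, zero = 0, add = (+)\<rparr>"


section \<open>The twisted Yangian of the orthogonal Lie algebra\<close>

definition idx :: "nat \<Rightarrow> int set" where
  "idx n = {- int n..int n} - {0}"

text \<open>The generator \<open>s\<^sub>i\<^sub>j\<^sup>(\<^sup>r\<^sup>)\<close> is the triple \<open>(r, i, j)\<close>.\<close>

type_synonym gen = "nat \<times> int \<times> int"

definition gens :: "nat \<Rightarrow> gen set" where
  "gens n = {1..} \<times> idx n \<times> idx n"

text \<open>Power series in \<open>u\<^sup>-\<^sup>1\<close> are \<open>fps\<close> with \<^term>\<open>fps_X\<close> standing for \<open>u\<^sup>-\<^sup>1\<close>.\<close>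

definition s_ser :: "int \<Rightarrow> int \<Rightarrow> ('k::ring_1, gen) free_alg fps" where
  "s_ser i j = Abs_fps (\<lambda>r. if r = 0 then (if i = j then 1 else 0) else letter (r, i, j))"

text \<open>Power series in \<open>u\<^sup>-\<^sup>1\<close> and \<open>v\<^sup>-\<^sup>1\<close> are \<open>fps fps\<close>: the inner variable is \<open>u\<^sup>-\<^sup>1\<close>, the outer one
  is \<open>v\<^sup>-\<^sup>1\<close>. The next two functions view a series in one variable (written in \<open>u\<close>, respectively
  in \<open>v\<close>) as a series in both.\<close>

definition in_u :: "'r::zero fps \<Rightarrow> 'r fps fps" where
  "in_u f = fps_const f"

definition in_v :: "'r::zero fps \<Rightarrow> 'r fps fps" where
  "in_v f = Abs_fps (\<lambda>t. fps_const (fps_nth f t))"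

type_synonym 'r imat = "int \<Rightarrow> int \<Rightarrow> 'r"
type_synonym 'r imat2 = "int \<times> int \<Rightarrow> int \<times> int \<Rightarrow> 'r"

definition id_mat :: "'r::zero_neq_one imat" where
  "id_mat i j = (if i = j then 1 else 0)"

definition E_mat :: "int \<Rightarrow> int \<Rightarrow> 'r::zero_neq_one imat" where
  "E_mat a b i j = (if i = a \<and> j = b then 1 else 0)"

definition prime_mat :: "'r imat \<Rightarrow> 'r imat" where
  "prime_mat A i j = A (- j) (- i)"

definition tens :: "'r::times imat \<Rightarrow> 'r imat \<Rightarrow> 'r imat2" where
  "tens A B a b = A (fst a) (fst b) * B (snd a) (snd b)"

definition mmul :: "nat \<Rightarrow> 'r::semiring_0 imat2 \<Rightarrow> 'r imat2 \<Rightarrow> 'r imat2" where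
  "mmul n A B a c = (\<Sum>b\<in>idx n \<times> idx n. A a b * B b c)"

definition P_mat :: "nat \<Rightarrow> 'r::ring_1 imat2" where
  "P_mat n a b = (\<Sum>i\<in>idx n. \<Sum>j\<in>idx n. tens (E_mat i j) (E_mat j i) a b)"

definition P'_mat :: "nat \<Rightarrow> 'r::ring_1 imat2" where
  "P'_mat n a b = (\<Sum>i\<in>idx n. \<Sum>j\<in>idx n. tens (prime_mat (E_mat i j)) (E_mat j i) a b)"

text \<open>With \<open>x = u\<^sup>-\<^sup>1\<close> and \<open>y = v\<^sup>-\<^sup>1\<close> one has \<open>1/(u - v) = xy/(y - x)\<close> and \<open>1/(u + v) = xy/(x + y)\<close>.
  The following are \<open>(y - x) R(u - v)\<close> and \<open>(x + y) R'(- u - v)\<close>. Each of these two factors occurs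
  exactly once on either side of the reflection equation, so clearing the central non-zero-divisors
  \<open>y - x\<close> and \<open>x + y\<close> does not change the relation.\<close>

definition R_cleared :: "nat \<Rightarrow> 'r::ring_1 fps fps imat2" where
  "R_cleared n a b =
     (in_v fps_X - in_u fps_X) * tens id_mat id_mat a b - in_u fps_X * in_v fps_X * P_mat n a b"

definition R'_cleared :: "nat \<Rightarrow> 'r::ring_1 fps fps imat2" where
  "R'_cleared n a b =
     (in_u fps_X + in_v fps_X) * tens id_mat id_mat a b + in_u fps_X * in_v fps_X * P'_mat n a b"

definition S1 :: "('k::ring_1, gen) free_alg fps fps imat2" where
  "S1 = tens (\<lambda>i j. in_u (s_ser i j)) id_mat"

definition S2 :: "('k::ring_1, gen) free_alg fps fps imat2" where
  "S2 = tens id_mat (\<lambda>i j. in_v (s_ser i j))"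

definition reflection_rel :: "nat \<Rightarrow> ('k::ring_1, gen) free_alg fps fps imat2" where
  "reflection_rel n a b =
     mmul n (mmul n (mmul n (R_cleared n) S1) (R'_cleared n)) S2 a b
   - mmul n (mmul n (mmul n S2 (R'_cleared n)) S1) (R_cleared n) a b"

definition at_neg :: "'r::ring_1 fps \<Rightarrow> 'r fps" where
  "at_neg f = f oo (- fps_X)"

text \<open>\<open>S'(-u) - S(u) - (S(u) - S(-u)) / (2u)\<close>.\<close>

definition symmetry_rel :: "('k::field, gen) free_alg fps imat" where
  "symmetry_rel i j =
     prime_mat (\<lambda>k l. at_neg (s_ser k l)) i j - s_ser i j
   - fps_const (scal (1 / 2)) * fps_X * (s_ser i j - at_neg (s_ser i j))"

definition relators :: "nat \<Rightarrow> ('k::field, gen) free_alg set" where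
  "relators n =
     {reflection_rel n a b $ t $ r | a b t r. a \<in> idx n \<times> idx n \<and> b \<in> idx n \<times> idx n}
   \<union> {symmetry_rel i j $ r | i j r. i \<in> idx n \<and> j \<in> idx n}"

definition rel_ideal :: "nat \<Rightarrow> ('k::field, gen) free_alg set" where
  "rel_ideal n = Idl\<^bsub>free_alg_ring (gens n)\<^esub> (relators n)"

text \<open>The elements of the twisted Yangian are cosets; it is a \<open>'k\<close>-algebra through the central
  elements \<open>yscal n c\<close>.\<close>

type_synonym 'k yelt = "('k, gen) free_alg set"

definition twisted_Yangian :: "nat \<Rightarrow> ('k::field) yelt ring" where
  "twisted_Yangian n = free_alg_ring (gens n) Quot rel_ideal n"

definition yclass :: "nat \<Rightarrow> ('k::field, gen) free_alg \<Rightarrow> 'k yelt" where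
  "yclass n f = rel_ideal n +>\<^bsub>free_alg_ring (gens n)\<^esub> f"

definition yscal :: "nat \<Rightarrow> 'k::field \<Rightarrow> 'k yelt" where
  "yscal n c = yclass n (scal c)"

definition ygen :: "nat \<Rightarrow> int \<Rightarrow> int \<Rightarrow> nat \<Rightarrow> ('k::field) yelt" where
  "ygen n i j r = yclass n (s_ser i j $ r)"


section \<open>Left modules over a noncommutative ring\<close>

text \<open>The library locale \<^locale>\<open>module\<close> requires a commutative ring; the library's
  \<^locale>\<open>submodule\<close> does not. The ring multiplication and unit fields of a module record are
  irrelevant.\<close>

locale left_module = R?: ring R + M?: abelian_group M for R (structure) and M (structure) +
  assumes smult_closed: "a \<in> carrier R \<Longrightarrow> x \<in> carrier M \<Longrightarrow> a \<odot>\<^bsub>M\<^esub> x \<in> carrier M"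
    and smult_l_distr: "a \<in> carrier R \<Longrightarrow> b \<in> carrier R \<Longrightarrow> x \<in> carrier M \<Longrightarrow>
      (a \<oplus>\<^bsub>R\<^esub> b) \<odot>\<^bsub>M\<^esub> x = a \<odot>\<^bsub>M\<^esub> x \<oplus>\<^bsub>M\<^esub> b \<odot>\<^bsub>M\<^esub> x"
    and smult_r_distr: "a \<in> carrier R \<Longrightarrow> x \<in> carrier M \<Longrightarrow> y \<in> carrier M \<Longrightarrow>
      a \<odot>\<^bsub>M\<^esub> (x \<oplus>\<^bsub>M\<^esub> y) = a \<odot>\<^bsub>M\<^esub> x \<oplus>\<^bsub>M\<^esub> a \<odot>\<^bsub>M\<^esub> y"
    and smult_assoc: "a \<in> carrier R \<Longrightarrow> b \<in> carrier R \<Longrightarrow> x \<in> carrier M \<Longrightarrow>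
      (a \<otimes>\<^bsub>R\<^esub> b) \<odot>\<^bsub>M\<^esub> x = a \<odot>\<^bsub>M\<^esub> (b \<odot>\<^bsub>M\<^esub> x)"
    and smult_one: "x \<in> carrier M \<Longrightarrow> \<one>\<^bsub>R\<^esub> \<odot>\<^bsub>M\<^esub> x = x"

definition regular_module :: "'r ring \<Rightarrow> ('r, 'r) module" where
  "regular_module R =
    \<lparr>carrier = carrier R, mult = undefined, one = undefined, zero = \<zero>\<^bsub>R\<^esub>,
     add = add R, smult = mult R\<rparr>"

definition quot_module :: "('r, 'm) module \<Rightarrow> 'm set \<Rightarrow> ('r, 'm set) module" where
  "quot_module M N =
    \<lparr>carrier = a_rcosets\<^bsub>M\<^esub> N, mult = undefined, one = undefined, zero = N, add = set_add M,
     smult = (\<lambda>a C. \<Union>x\<in>C. N +>\<^bsub>M\<^esub> (a \<odot>\<^bsub>M\<^esub> x))\<rparr>"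

definition gen_submodule :: "'r ring \<Rightarrow> ('r, 'm) module \<Rightarrow> 'm set \<Rightarrow> 'm set" where
  "gen_submodule R M X = \<Inter>{H. submodule H R M \<and> X \<subseteq> H}"

definition irreducible_module :: "'r ring \<Rightarrow> ('r, 'm) module \<Rightarrow> bool" where
  "irreducible_module R M \<longleftrightarrow> carrier M \<noteq> {\<zero>\<^bsub>M\<^esub>} \<and>
     (\<forall>H. submodule H R M \<longrightarrow> H = {\<zero>\<^bsub>M\<^esub>} \<or> H = carrier M)"


section \<open>Highest weight representations\<close>

text \<open>A weight is a family of series \<open>\<mu> i\<close> in \<open>u\<^sup>-\<^sup>1\<close>, of which only those with \<open>1 \<le> i \<le> n\<close> matter.\<close>

definition verma_relators :: "nat \<Rightarrow> (nat \<Rightarrow> 'k::field fps) \<Rightarrow> 'k yelt set" where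
  "verma_relators n \<mu> =
     {ygen n i j r | i j r. i \<in> idx n \<and> j \<in> idx n \<and> i < j}
   \<union> {yclass n (s_ser (int i) (int i) $ r - scal (\<mu> i $ r)) | i r. i \<in> {1..n}}"

definition verma :: "nat \<Rightarrow> (nat \<Rightarrow> 'k::field fps) \<Rightarrow> ('k yelt, 'k yelt set) module" where
  "verma n \<mu> = quot_module (regular_module (twisted_Yangian n))
     (gen_submodule (twisted_Yangian n) (regular_module (twisted_Yangian n)) (verma_relators n \<mu>))"

definition highest_weight_rep ::
    "nat \<Rightarrow> (nat \<Rightarrow> 'k::field fps) \<Rightarrow> ('k yelt, 'm) module \<Rightarrow> bool" where
  "highest_weight_rep n \<mu> V \<longleftrightarrow> left_module (twisted_Yangian n) V \<and>
     (\<exists>\<xi>\<in>carrier V. \<xi> \<noteq> \<zero>\<^bsub>V\<^esub> \<and>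
        gen_submodule (twisted_Yangian n) V {\<xi>} = carrier V \<and>
        (\<forall>i\<in>idx n. \<forall>j\<in>idx n. i < j \<longrightarrow> (\<forall>r. ygen n i j r \<odot>\<^bsub>V\<^esub> \<xi> = \<zero>\<^bsub>V\<^esub>)) \<and>
        (\<forall>i\<in>{1..n}. \<forall>r. ygen n (int i) (int i) r \<odot>\<^bsub>V\<^esub> \<xi> = yscal n (\<mu> i $ r) \<odot>\<^bsub>V\<^esub> \<xi>))"

text \<open>\<open>V\<close> is (an instance of) \<open>V(\<mu>(u), p)\<close>. This is a predicate because in positive characteristic
  the Verma module need not have a unique simple quotient.\<close>

definition simple_verma_quotient ::
    "nat \<Rightarrow> (nat \<Rightarrow> 'k::field fps) \<Rightarrow> ('k yelt, 'k yelt set set) module \<Rightarrow> bool" where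
  "simple_verma_quotient n \<mu> V \<longleftrightarrow>
     (\<exists>N. submodule N (twisted_Yangian n) (verma n \<mu>) \<and> V = quot_module (verma n \<mu>) N) \<and>
     irreducible_module (twisted_Yangian n) V"

definition finite_dimensional :: "nat \<Rightarrow> ('k::field yelt, 'm) module \<Rightarrow> bool" where
  "finite_dimensional n V \<longleftrightarrow> (\<exists>B. finite B \<and> B \<subseteq> carrier V \<and>
     (\<forall>v\<in>carrier V. \<exists>c :: 'm \<Rightarrow> 'k. v = (\<Oplus>\<^bsub>V\<^esub>b\<in>B. yscal n (c b) \<odot>\<^bsub>V\<^esub> b)))"


section \<open>Polynomials as Laurent series\<close>

text \<open>A polynomial in \<open>u\<close> as an element of \<open>K((u\<^sup>-\<^sup>1))\<close>, where \<open>fls_X\<close> is \<open>u\<^sup>-\<^sup>1\<close>, so \<open>u\<close> is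
  \<^term>\<open>fls_X_inv\<close>.\<close>

definition poly_in_u :: "'k::field poly \<Rightarrow> 'k fls" where
  "poly_in_u q = poly (map_poly fls_const q) fls_X_inv"

end

(* The trivial solution S(u) = 1 of the reflection equation can be dressed, S(u) -> T(u) S(u) T'(-u),
   by any solution T of the RTT relation whose entries commute with those of S; the dressed matrix
   again satisfies the reflection equation and the symmetry relation. Take
   T(u) = (1 - a/u) + E/u with E the generators of gl(2n) in an exterior power of the vector
   representation; no normalisation is needed since T has constant term 1. If E_ii acts on the
   highest vector as 1 for i <= kappa and as 0 otherwise, with kappa >= 0, then mu_i(u) is multiplied by
   (1 - (a - [i <= kappa])/u) (1 + (a - 1)/u). For kappa >= 1 this changes only the quotient
   mu_kappa/mu_(kappa+1), by (u + 1 - a)/(u - a); for kappa = 0 it changes only mu_1(-u)/mu_1(u), by the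
   quotient for the polynomial (u - a)(u + a - 1). Since p > 2, the roots of P_1 pair up as a, 1 - a.
   All exterior powers live in one fermionic Fock space, where the highest vector generates a
   finite-dimensional submodule; a maximal submodule of the Verma module above the kernel, given by
   Zorn's lemma, yields the simple quotient. *)

theory Submission
  imports Defs "HOL-Library.Countable" "HOL-Library.Function_Algebras"
begin


text \<open>The matrix T is the shifted evaluation (1 - a/u)(1 + E/(u - a)) with its denominator
  cleared. Rescaling T(u) by f(u) rescales T(u) S(u) T'(-u) by f(u) f(-u), an even series; the
  symmetry relation does not tolerate an arbitrary scalar factor, but it does tolerate an even one.
  In characteristic p different maximal submodules of a Verma module may give different quotients,
  and finite dimension is known only for the module generated by the vacuum. Hence the maximal
  submodule cannot be arbitrary: it has to contain everything that annihilates the vacuum. All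
  matrix identities are proved over an arbitrary noncommutative ring in which u^-1, v^-1 and a are
  just central elements, so one lemma serves at u, v, -u and -v. The highest vector enters these
  identities only through the left ideal of operators killing it. A root 1/2 of P_1 is its own
  partner; it occurs with even multiplicity because the cofactor of u - 1/2 is antisymmetric under u
  -> 1 - u. This and the term 1/(2u) are the two places where 2 must be nonzero.\<close>

definition central :: "'r::ring_1 \<Rightarrow> bool" where
  "central c \<longleftrightarrow> (\<forall>z. z * c = c * z)"

lemma centralD: "central c \<Longrightarrow> z * c = c * z"
  by (simp add: central_def)

lemma central_left_commute: "central c \<Longrightarrow> z * (c * w) = c * (z * w)"
  by (metis central_def mult.assoc)

lemma central_uminus: "central c \<Longrightarrow> central (- c)"
  by (simp add: central_def)

lemma central_mult: "central c \<Longrightarrow> central d \<Longrightarrow> central (c * d)"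
  by (metis central_def mult.assoc)

lemma central_diff: "central c \<Longrightarrow> central d \<Longrightarrow> central (c - d)"
  by (simp add: central_def algebra_simps)

lemma central_add: "central c \<Longrightarrow> central d \<Longrightarrow> central (c + d)"
  by (simp add: central_def algebra_simps)

lemma central_1: "central 1"
  by (simp add: central_def)

lemma central_0: "central 0"
  by (simp add: central_def)

lemma central_fps_const: "central c \<Longrightarrow> central (fps_const c)"
  unfolding central_def by (simp add: fps_eq_iff)

lemma fps_X_commute: "z * fps_X = fps_X * (z :: 'r::ring_1 fps)"
  by (rule fps_ext) simp

lemma central_fps_X: "central (fps_X :: 'r::ring_1 fps)"
  by (simp add: central_def fps_X_commute)

section \<open>The substitution u -> -u and series in two variables\<close>

lemma at_neg_nth [simp]: "at_neg (f :: 'r::ring_1 fps) $ k = (-1) ^ k * f $ k"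
proof -
  have X: "(- fps_X :: 'r fps) ^ i $ k = (if i = k then (-1) ^ k else 0)" for i
  proof (induction i arbitrary: k)
    case 0 then show ?case by auto
  next
    case (Suc i) then show ?case by (cases k) simp_all
  qed
  have "at_neg f $ k = (\<Sum>i=0..k. if i = k then f $ i * (-1) ^ k else 0)"
    unfolding at_neg_def fps_compose_def X fps_nth_Abs_fps by (intro sum.cong) auto
  also have "\<dots> = f $ k * (-1) ^ k" by simp
  also have "\<dots> = (-1) ^ k * f $ k" by (cases "even k") auto
  finally show ?thesis .
qed

lemma at_neg_add: "at_neg (f + g) = at_neg f + at_neg (g :: 'r::ring_1 fps)"
  by (simp add: fps_eq_iff algebra_simps)

lemma at_neg_diff: "at_neg (f - g) = at_neg f - at_neg (g :: 'r::ring_1 fps)"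
  by (simp add: fps_eq_iff algebra_simps)

lemma at_neg_0 [simp]: "at_neg (0 :: 'r::ring_1 fps) = 0"
  by (simp add: fps_eq_iff)

lemma at_neg_1 [simp]: "at_neg (1 :: 'r::ring_1 fps) = 1"
  by (simp add: fps_eq_iff)

lemma at_neg_X [simp]: "at_neg (fps_X :: 'r::ring_1 fps) = - fps_X"
  by (simp add: fps_eq_iff fps_X_def)

lemma at_neg_const [simp]: "at_neg (fps_const c :: 'r::ring_1 fps) = fps_const c"
  by (simp add: fps_eq_iff)

text \<open>Signs commute with every coefficient, so u -> -u is multiplicative even over a
  noncommutative ring.\<close>

lemma at_neg_mult: "at_neg (f * g) = at_neg f * at_neg (g :: 'r::ring_1 fps)"
proof (rule fps_ext)
  fix k
  have s: "(-1) ^ k * (f $ i * g $ (k - i)) = (-1) ^ i * f $ i * ((-1) ^ (k - i) * g $ (k - i))"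
    if "i \<le> k" for i
  proof -
    have "(-1 :: 'r) ^ k = (-1) ^ i * (-1) ^ (k - i)" using that by (simp flip: power_add)
    moreover have "(-1) ^ (k - i) * f $ i = f $ i * (-1) ^ (k - i)" by (cases "even (k-i)") auto
    ultimately show ?thesis by (simp add: mult.assoc) (simp flip: mult.assoc)
  qed
  show "at_neg (f * g) $ k = (at_neg f * at_neg g) $ k"
    unfolding at_neg_nth fps_mult_nth sum_distrib_left by (intro sum.cong) (auto simp: s)
qed

lemma in_u_add: "in_u (f + g) = in_u f + in_u (g :: 'r::ring_1 fps)"
  by (simp add: in_u_def)
lemma in_u_mult: "in_u (f * g) = in_u f * in_u (g :: 'r::ring_1 fps)"
  by (simp add: in_u_def)
lemma in_u_0: "in_u (0 :: 'r::ring_1 fps) = 0"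
  by (simp add: in_u_def)
lemma in_u_1: "in_u (1 :: 'r::ring_1 fps) = 1"
  by (simp add: in_u_def)
lemma in_v_add: "in_v (f + g) = in_v f + in_v (g :: 'r::ring_1 fps)"
  by (simp add: in_v_def fps_eq_iff)
lemma in_v_0: "in_v (0 :: 'r::ring_1 fps) = 0"
  by (simp add: in_v_def fps_eq_iff)
lemma in_v_1: "in_v (1 :: 'r::ring_1 fps) = 1"
  by (simp add: in_v_def fps_eq_iff)
lemma in_v_mult: "in_v (f * g) = in_v f * in_v (g :: 'r::ring_1 fps)"
  by (auto simp: in_v_def fps_eq_iff fps_mult_nth fps_sum_nth intro!: sum.cong)

lemma central_in_u: "central f \<Longrightarrow> central (in_u (f :: 'r::ring_1 fps))"
  by (simp add: in_u_def central_fps_const)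

lemma central_in_v_X: "central (in_v (fps_X :: 'r::ring_1 fps))"
proof -
  have "in_v (fps_X :: 'r fps) = fps_X"
    by (simp add: in_v_def fps_eq_iff fps_X_def)
  then show ?thesis by (simp add: central_fps_X)
qed

section \<open>Dressing solutions of the reflection equation\<close>

text \<open>Matrices are functions on all pairs of integers, while products sum over
  \<open>idx n\<close> only. Truncation turns identities that hold at genuine indices into
  equalities of functions, which can then be rewritten inside products.\<close>

definition supp_mat :: "nat \<Rightarrow> 'r::ring_1 imat2 \<Rightarrow> 'r imat2" where
  "supp_mat n A a b = (if a \<in> idx n \<times> idx n \<and> b \<in> idx n \<times> idx n then A a b else 0)"

lemma finite_idx [simp]: "finite (idx n)"
  by (simp add: idx_def)

lemma idx_uminus [simp]: "- i \<in> idx n \<longleftrightarrow> i \<in> idx n"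
  by (auto simp: idx_def)

lemma sum_idx_uminus: "(\<Sum>i\<in>idx n. f (- i)) = (\<Sum>i\<in>idx n. f i)"
  by (rule sum.reindex_bij_witness[of _ uminus uminus]) auto

lemma mmul_assoc: "mmul n (mmul n A B) C = mmul n A (mmul n B (C :: 'r::ring_1 imat2))"
proof (intro ext)
  fix a c
  have "mmul n (mmul n A B) C a c =
      (\<Sum>b\<in>idx n \<times> idx n. \<Sum>d\<in>idx n \<times> idx n. A a d * B d b * C b c)"
    by (simp add: mmul_def sum_distrib_right)
  also have "\<dots> = (\<Sum>d\<in>idx n \<times> idx n. \<Sum>b\<in>idx n \<times> idx n. A a d * B d b * C b c)"
    by (rule sum.swap)
  also have "\<dots> = mmul n A (mmul n B C) a c"
    by (simp add: mmul_def sum_distrib_left mult.assoc)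
  finally show "mmul n (mmul n A B) C a c = mmul n A (mmul n B C) a c" .
qed

lemma supp_mmul: "supp_mat n (mmul n A B) = mmul n (supp_mat n A) (supp_mat n B)"
  proof (intro ext)
  fix a b
  show "supp_mat n (mmul n A B) a b = mmul n (supp_mat n A) (supp_mat n B) a b"
    by (cases "a \<in> idx n \<times> idx n"; cases "b \<in> idx n \<times> idx n")
       (simp_all add: supp_mat_def mmul_def)
qed

lemma supp_mat_ext:
  assumes "\<And>i j k l. i \<in> idx n \<Longrightarrow> j \<in> idx n \<Longrightarrow> k \<in> idx n \<Longrightarrow> l \<in> idx n \<Longrightarrow>
     A (i, k) (j, l) = B (i, k) (j, l)"
  shows "supp_mat n A = supp_mat n B"
  using assms by (auto simp: supp_mat_def fun_eq_iff)

definition leg1 :: "nat \<Rightarrow> 'r::ring_1 imat \<Rightarrow> 'r imat2" where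
  "leg1 n A = supp_mat n (tens A id_mat)"

definition leg2 :: "nat \<Rightarrow> 'r::ring_1 imat \<Rightarrow> 'r imat2" where
  "leg2 n A = supp_mat n (tens id_mat A)"

lemma sum_idx_pair: "(\<Sum>b\<in>idx n \<times> idx n. f b) = (\<Sum>i\<in>idx n. \<Sum>k\<in>idx n. f (i, k))"
  by (simp add: sum.cartesian_product)

lemma sum_delta_mult_right:
  "(\<Sum>r\<in>idx n. f r * (if r = k then 1 else 0)) = (if k \<in> idx n then f k else (0 :: 'r::ring_1))"
proof -
  have "(\<Sum>r\<in>idx n. f r * (if r = k then 1 else 0)) = (\<Sum>r\<in>idx n. if r = k then f r else 0)"
    by (intro sum.cong) auto
  then show ?thesis by (simp add: sum.delta)
qed

lemma sum_delta_mult_left: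
  "(\<Sum>r\<in>idx n. (if k = r then 1 else 0) * f r) = (if k \<in> idx n then f k else (0 :: 'r::ring_1))"
proof -
  have "(\<Sum>r\<in>idx n. (if k = r then 1 else 0) * f r) = (\<Sum>r\<in>idx n. if r = k then f r else 0)"
    by (intro sum.cong) auto
  then show ?thesis by (simp add: sum.delta)
qed

lemma mmul_supp_eqI:
  assumes "\<And>i j k l. i \<in> idx n \<Longrightarrow> j \<in> idx n \<Longrightarrow> k \<in> idx n \<Longrightarrow> l \<in> idx n \<Longrightarrow>
    (\<Sum>m\<in>idx n. \<Sum>r\<in>idx n. A (i, k) (m, r) * B (m, r) (j, l)) = C (i, k) (j, l)"
  shows "mmul n (supp_mat n A) (supp_mat n B) = supp_mat n C"
  unfolding supp_mmul[symmetric]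
  by (rule supp_mat_ext) (simp add: mmul_def sum_idx_pair assms)

lemma leg1_mmul:
  "mmul n (leg1 n A) (supp_mat n X) = supp_mat n (\<lambda>a c. \<Sum>m\<in>idx n. A (fst a) m * X (m, snd a) c)"
  unfolding leg1_def
  by (rule mmul_supp_eqI)
     (simp add: tens_def id_mat_def mult.assoc sum_distrib_left[symmetric] sum_delta_mult_left)

lemma leg2_mmul:
  "mmul n (leg2 n A) (supp_mat n X) = supp_mat n (\<lambda>a c. \<Sum>m\<in>idx n. A (snd a) m * X (fst a, m) c)"
  unfolding leg2_def
  by (rule mmul_supp_eqI, subst sum.swap)
     (simp add: tens_def id_mat_def if_distrib[of "\<lambda>x. x * _"] mult.assoc sum_distrib_left[symmetric]
       sum.delta cong: if_cong)

lemma mmul_leg1: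
  "mmul n (supp_mat n X) (leg1 n A) = supp_mat n (\<lambda>a c. \<Sum>m\<in>idx n. X a (m, snd c) * A m (fst c))"
  unfolding leg1_def
  by (rule mmul_supp_eqI)
     (simp add: tens_def id_mat_def mult.assoc[symmetric] sum_delta_mult_right)

lemma mmul_leg2:
  "mmul n (supp_mat n X) (leg2 n A) = supp_mat n (\<lambda>a c. \<Sum>m\<in>idx n. X a (fst c, m) * A m (snd c))"
  unfolding leg2_def
  by (rule mmul_supp_eqI, subst sum.swap)
     (simp add: tens_def id_mat_def if_distrib[of "\<lambda>x. x * _"] if_distrib[of "\<lambda>x. _ * x"] mult.assoc sum_distrib_left[symmetric]
       sum.delta cong: if_cong)


section \<open>Evaluation matrices and the RTT relation\<close>

definition ev :: "'r::ring_1 \<Rightarrow> 'r imat \<Rightarrow> 'r \<Rightarrow> 'r imat" where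
  "ev a E z i j = (if i = j then 1 - a * z else 0) + z * E i j"

definition gl_rel :: "'r::ring_1 imat \<Rightarrow> bool" where
  "gl_rel E \<longleftrightarrow> (\<forall>i j k l. E i j * E k l - E k l * E i j =
     (if k = j then E i l else 0) - (if i = l then E k j else 0))"

text \<open>The diagonal scalars are central, so only the commutator of the two entries of
  \<open>E\<close> survives.\<close>

lemma ev_commutator:
  fixes E :: "'r::ring_1 imat"
  assumes "central x" "central y" "central a" "gl_rel E"
  shows "ev a E x i j * ev a E y k l - ev a E y k l * ev a E x i j =
    x * y * ((if k = j then E i l else 0) - (if i = l then E k j else 0))"
proof -
  have gen: "(p + x * A) * (q + y * B) - (q + y * B) * (p + x * A) = x * y * (A * B - B * A)"
    if "central p" "central q" for p q A B :: 'r
  proof -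
    have 1: "x * A * q = q * (x * A)" "y * B * p = p * (y * B)" "q * p = p * q"
      using that centralD by blast+
    have 2: "x * A * (y * B) = x * y * (A * B)"
      using centralD[OF assms(2), of A] by (metis mult.assoc)
    have 3: "y * B * (x * A) = x * y * (B * A)"
      using centralD[OF assms(1), of B] centralD[OF assms(1), of y] by (metis mult.assoc)
    show ?thesis by (simp add: distrib_left distrib_right right_diff_distrib 1 2 3)
  qed
  have "central (if i = j then 1 - a * z else 0)" if "central z" for i j :: int and z
    using that assms(3) by (simp add: central_0 central_1 central_diff central_mult)
  from gen[OF this[OF assms(1)] this[OF assms(2)], of i j "E i j" k l "E k l"] show ?thesis
    using assms(4) unfolding ev_def gl_rel_def by metis
qed

text \<open>The terms quadratic in \<open>E\<close> cancel, and in the mixed terms the shift drops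
  out because (1 - a x) y - (1 - a y) x = y - x. What remains is the bracket of
  \<open>ev_commutator\<close> with another central prefactor.\<close>

lemma ev_exchange:
  fixes E :: "'r::ring_1 imat"
  assumes "central x" "central y" "central a"
  shows "ev a E x k j * ev a E y i l - ev a E y k j * ev a E x i l =
    (y - x) * ((if k = j then E i l else 0) - (if i = l then E k j else 0))"
proof -
  have gen: "(d * p + x * A) * (d' * q + y * B) - (d * q + y * A) * (d' * p + x * B) =
      (p * y - q * x) * (d * B - d' * A)"
    if "central p" "central q" "central d" "central d'" for p q d d' A B :: 'r
  proof -
    have 1: "d * p * (d' * q) = d * q * (d' * p)"
      using that by (metis central_def mult.assoc)
    have 2: "x * A * (y * B) = y * A * (x * B)"
      using assms(1,2) by (metis central_def mult.assoc)
    have 3: "d * p * (y * B) = p * y * (d * B)" "d * q * (x * B) = q * x * (d * B)"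
      using that assms(1,2) by (metis central_def mult.assoc)+
    have 4: "x * A * (d' * q) = q * x * (d' * A)" "y * A * (d' * p) = p * y * (d' * A)"
      using that assms(1,2) by (metis central_def mult.assoc)+
    show ?thesis by (simp only: distrib_left distrib_right 1 2 3 4) (simp add: algebra_simps)
  qed
  have d: "(if b then c else 0) = (if b then 1 else 0) * (c :: 'r)" for b c by simp
  have p: "central (1 - a * z)" if "central z" for z
    using that assms(3) by (simp add: central_1 central_diff central_mult)
  have py: "(1 - a * x) * y - (1 - a * y) * x = y - x"
    using assms(1,2) by (simp add: left_diff_distrib mult.assoc centralD[of x y])
  have e: "(if k = j then E i l else 0) - (if i = l then E k j else 0)
      = (if k = j then 1 else 0) * E i l - (if i = l then 1 else 0) * E k j"
    by simp
  show ?thesis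
    unfolding ev_def e d[of _ "1 - _ * _"]
    by (subst gen) (auto simp: p assms py central_0 central_1)
qed

text \<open>With x = u^-1 and y = v^-1 one has u - v = (y - x)/(x y), so this is the defining
  relation of the Yangian of gl with denominators cleared. Both sides are x y (y - x) times the same
  bracket.\<close>

lemma ev_RTT:
  fixes E :: "'r::ring_1 imat"
  assumes "central x" "central y" "central a" "gl_rel E"
  shows "(y - x) * (ev a E x i j * ev a E y k l - ev a E y k l * ev a E x i j) =
     x * y * (ev a E x k j * ev a E y i l - ev a E y k j * ev a E x i l)"
  unfolding ev_commutator[OF assms] ev_exchange[OF assms(1-3)]
  using assms(1,2) by (metis central_def mult.assoc central_diff)

text \<open>The version with opposite order of the factors on the right. Transposition reverses
  products, so this is the form needed whenever the second leg carries a transposed matrix.\<close>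

lemma ev_RTT':
  fixes E :: "'r::ring_1 imat"
  assumes "central x" "central y" "central a" "gl_rel E"
  shows "(y - x) * (ev a E x i j * ev a E y k l - ev a E y k l * ev a E x i j) =
     x * y * (ev a E y i l * ev a E x k j - ev a E x i l * ev a E y k j)"
proof -
  have e: "ev a E y i l * ev a E x k j - ev a E x i l * ev a E y k j =
      (y - x) * ((if k = j then E i l else 0) - (if i = l then E k j else 0))"
    using ev_exchange[OF assms(2,1,3), of E i l k j] by (auto simp: algebra_simps)
  show ?thesis unfolding ev_commutator[OF assms] e
    using assms(1,2) by (metis central_def mult.assoc central_diff)
qed

section \<open>The reflection equation in matrix entries\<close>

definition Rxy :: "'r::ring_1 \<Rightarrow> 'r \<Rightarrow> 'r imat2" where
  "Rxy x y = (\<lambda>(i, k) (j, l). (y - x) * (if i = j \<and> k = l then 1 else 0)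
     - x * y * (if i = l \<and> k = j then 1 else 0))"

text \<open>R' is taken at -u - v, which turns its minus sign into a plus. P' is supported where
  both index pairs are antipodal, so it has rank one.\<close>

definition Rxy' :: "'r::ring_1 \<Rightarrow> 'r \<Rightarrow> 'r imat2" where
  "Rxy' x y = (\<lambda>(i, k) (j, l). (x + y) * (if i = j \<and> k = l then 1 else 0)
     + x * y * (if k = - i \<and> l = - j then 1 else 0))"

text \<open>\<open>A\<close> and \<open>B\<close> are separate because S(u) and S(v) are images of
  one series under two embeddings. Products are nested to the right, the form in which words are
  rewritten in \<open>reflection_chain\<close>.\<close>

definition refl_eq :: "nat \<Rightarrow> 'r::ring_1 \<Rightarrow> 'r \<Rightarrow> 'r imat \<Rightarrow> 'r imat \<Rightarrow> bool" where
  "refl_eq n x y A B \<longleftrightarrow>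
     mmul n (supp_mat n (Rxy x y)) (mmul n (leg1 n A) (mmul n (supp_mat n (Rxy' x y)) (leg2 n B))) =
     mmul n (leg2 n B) (mmul n (supp_mat n (Rxy' x y)) (mmul n (leg1 n A) (supp_mat n (Rxy x y))))"

definition imul :: "nat \<Rightarrow> 'r::ring_1 imat \<Rightarrow> 'r imat \<Rightarrow> 'r imat" where
  "imul n A B i j = (\<Sum>k\<in>idx n. A i k * B k j)"

lemma leg1_imul: "leg1 n (imul n A B) = mmul n (leg1 n A) (leg1 n B)"
  unfolding leg1_def[of n B] leg1_mmul unfolding leg1_def
  by (rule supp_mat_ext) (auto simp: tens_def id_mat_def imul_def)

lemma leg2_imul: "leg2 n (imul n A B) = mmul n (leg2 n A) (leg2 n B)"
  unfolding leg2_def[of n B] leg2_mmul unfolding leg2_def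
  by (rule supp_mat_ext) (auto simp: tens_def id_mat_def imul_def)

lemma leg1_leg2: "mmul n (leg1 n A) (leg2 n B) = supp_mat n (\<lambda>(i, k) (j, l). A i j * B k l)"
  unfolding leg2_def leg1_mmul
  by (rule supp_mat_ext) (simp add: tens_def id_mat_def mult.assoc[symmetric] if_distrib[of "\<lambda>x. x * _"] 
     if_distrib[of "\<lambda>x. _ * x"] sum.delta sum.delta' cong: if_cong)

lemma leg2_leg1: "mmul n (leg2 n B) (leg1 n A) = supp_mat n (\<lambda>(i, k) (j, l). B k l * A i j)"
  unfolding leg1_def leg2_mmul
  by (rule supp_mat_ext) (simp add: tens_def id_mat_def mult.assoc[symmetric] if_distrib[of "\<lambda>x. x * _"] 
     if_distrib[of "\<lambda>x. _ * x"] sum.delta sum.delta' cong: if_cong)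

lemma legs_commute:
  assumes "\<And>i j k l. i \<in> idx n \<Longrightarrow> j \<in> idx n \<Longrightarrow> k \<in> idx n \<Longrightarrow> l \<in> idx n \<Longrightarrow> A i j * B k l = B k l * A i j"
  shows "mmul n (leg1 n A) (leg2 n B) = mmul n (leg2 n B) (leg1 n A)"
  unfolding leg1_leg2 leg2_leg1 by (rule supp_mat_ext) (simp add: assms)

lemma sum_delta2:
  assumes "i \<in> idx n" "k \<in> idx n"
  shows "(\<Sum>m\<in>idx n. \<Sum>r\<in>idx n. if m = i then if r = k then c else 0 else 0) = (c :: 'r::ring_1)"
proof -
  have "(\<Sum>m\<in>idx n. \<Sum>r\<in>idx n. if m = i then if r = k then c else 0 else 0) =
     (\<Sum>m\<in>idx n. if m = i then \<Sum>r\<in>idx n. if r = k then c else 0 else 0)"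
    by (intro sum.cong) auto
  then show ?thesis using assms by simp
qed

lemma Rxy_mmul:
  "mmul n (supp_mat n (Rxy x y)) (supp_mat n X) =
    supp_mat n (\<lambda>(i, k) c. (y - x) * X (i, k) c - x * y * X (k, i) c)"
proof (rule mmul_supp_eqI)
  fix i j k l assume "i \<in> idx n" "j \<in> idx n" "k \<in> idx n" "l \<in> idx n"
  moreover have "Rxy x y (i, k) (m, r) * X (m, r) (j, l) =
     (if m = i then if r = k then (y - x) * X (i, k) (j, l) else 0 else 0)
     - (if m = k then if r = i then x * y * X (k, i) (j, l) else 0 else 0)" for m r
    by (auto simp: Rxy_def algebra_simps)
  ultimately show "(\<Sum>m\<in>idx n. \<Sum>r\<in>idx n. Rxy x y (i, k) (m, r) * X (m, r) (j, l)) =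
    (case (i, k) of (i, k) \<Rightarrow> \<lambda>c. (y - x) * X (i, k) c - x * y * X (k, i) c) (j, l)"
    by (simp add: sum_subtractf sum_delta2)
qed

lemma mmul_Rxy:
  assumes "central x" "central y"
  shows "mmul n (supp_mat n X) (supp_mat n (Rxy x y)) =
    supp_mat n (\<lambda>a (j, l). (y - x) * X a (j, l) - x * y * X a (l, j))"
proof (rule mmul_supp_eqI)
  fix i j k l assume "i \<in> idx n" "j \<in> idx n" "k \<in> idx n" "l \<in> idx n"
  moreover have "X (i, k) (m, r) * Rxy x y (m, r) (j, l) =
     (if m = j then if r = l then (y - x) * X (i, k) (j, l) else 0 else 0)
     - (if m = l then if r = j then x * y * X (i, k) (l, j) else 0 else 0)" for m r
    using assms by (auto simp: Rxy_def algebra_simps centralD central_mult)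
  ultimately show "(\<Sum>m\<in>idx n. \<Sum>r\<in>idx n. X (i, k) (m, r) * Rxy x y (m, r) (j, l)) =
    (case (j, l) of (j, l) \<Rightarrow> (y - x) * X (i, k) (j, l) - x * y * X (i, k) (l, j))"
    by (simp add: sum_subtractf sum_delta2)
qed

text \<open>Because P' has rank one, no sum is left over in its term: the indices \<open>k\<close>
  and \<open>j\<close> are fed directly into \<open>A\<close> and \<open>B\<close>.\<close>

lemma leg1_Rxy'_leg2:
  assumes "central x" "central y"
  shows "mmul n (leg1 n A) (mmul n (supp_mat n (Rxy' x y)) (leg2 n B)) =
    supp_mat n (\<lambda>(i, k) (j, l). (x + y) * (A i j * B k l) + x * y * (A i (- k) * B (- j) l))"
proof -
  have 1: "(\<Sum>m\<in>idx n. Rxy' x y (i, k) (j, m) * B m l) =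
     (if i = j then (x + y) * B k l else 0) + (if k = - i then x * y * B (- j) l else 0)"
    if "i \<in> idx n" "k \<in> idx n" "j \<in> idx n" for i j k l
  proof -
    have "Rxy' x y (i, k) (j, m) * B m l =
       (if m = k then if i = j then (x + y) * B k l else 0 else 0)
       + (if m = - j then if k = - i then x * y * B (- j) l else 0 else 0)" for m
      by (auto simp: Rxy'_def algebra_simps)
    then show ?thesis using that by (simp add: sum.distrib)
  qed
  have 2: "(\<Sum>m\<in>idx n. A i m * ((if m = j then (x + y) * B k l else 0) + (if k = - m then x * y * B (- j) l else 0)))
     = (x + y) * (A i j * B k l) + x * y * (A i (- k) * B (- j) l)"
    if "i \<in> idx n" "k \<in> idx n" "j \<in> idx n" for i j k l
  proof -
    have "A i m * ((if m = j then (x + y) * B k l else 0) + (if k = - m then x * y * B (- j) l else 0)) =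
       (if m = j then (x + y) * (A i j * B k l) else 0) + (if m = - k then x * y * (A i (- k) * B (- j) l) else 0)" for m
      using central_left_commute[OF central_add[OF assms], of "A i j"] central_left_commute[OF central_mult[OF assms], of "A i (-k)"]
      by (auto simp: distrib_left)
    then show ?thesis using that by (simp add: sum.distrib)
  qed
  show ?thesis
    unfolding mmul_leg2 leg1_mmul by (rule supp_mat_ext) (simp add: 1 2)
qed

lemma leg2_Rxy'_leg1:
  assumes "central x" "central y"
  shows "mmul n (leg2 n B) (mmul n (supp_mat n (Rxy' x y)) (leg1 n A)) =
    supp_mat n (\<lambda>(i, k) (j, l). (x + y) * (B k l * A i j) + x * y * (B k (- i) * A (- l) j))"
proof -
  have 1: "(\<Sum>m\<in>idx n. Rxy' x y (i, k) (m, l) * A m j) =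
     (if k = l then (x + y) * A i j else 0) + (if k = - i then x * y * A (- l) j else 0)"
    if "i \<in> idx n" "k \<in> idx n" "l \<in> idx n" for i j k l
  proof -
    have "Rxy' x y (i, k) (m, l) * A m j =
       (if m = i then if k = l then (x + y) * A i j else 0 else 0)
       + (if m = - l then if k = - i then x * y * A (- l) j else 0 else 0)" for m
      by (auto simp: Rxy'_def algebra_simps)
    then show ?thesis using that by (simp add: sum.distrib)
  qed
  have 2: "(\<Sum>m\<in>idx n. B k m * ((if m = l then (x + y) * A i j else 0) + (if m = - i then x * y * A (- l) j else 0)))
     = (x + y) * (B k l * A i j) + x * y * (B k (- i) * A (- l) j)"
    if "i \<in> idx n" "k \<in> idx n" "l \<in> idx n" for i j k l
  proof -
    have "B k m * ((if m = l then (x + y) * A i j else 0) + (if m = - i then x * y * A (- l) j else 0)) =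
       (if m = l then (x + y) * (B k l * A i j) else 0) + (if m = - i then x * y * (B k (- i) * A (- l) j) else 0)" for m
      using central_left_commute[OF central_add[OF assms], of "B k l"] central_left_commute[OF central_mult[OF assms], of "B k (-i)"]
      by (auto simp: distrib_left)
    then show ?thesis using that by (simp add: sum.distrib)
  qed
  show ?thesis
    unfolding mmul_leg1 leg2_mmul by (rule supp_mat_ext) (simp add: 1 2)
qed


section \<open>Dressing preserves the reflection equation\<close>

definition dress :: "nat \<Rightarrow> 'r::ring_1 \<Rightarrow> 'r imat \<Rightarrow> 'r \<Rightarrow> 'r imat \<Rightarrow> 'r imat" where
  "dress n a E x A = imul n (imul n (ev a E x) A) (prime_mat (ev a E (- x)))"

lemma ev_commute:
  assumes "central x" "central a" "\<And>k l. A * E k l = E k l * A"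
  shows "A * ev a E x i j = ev a E x i j * A"
proof -
  have "central (1 - a * x)" using assms by (simp add: central_1 central_diff central_mult)
  then have "A * (1 - a * x) = (1 - a * x) * A" by (rule centralD)
  moreover have "A * (x * E i j) = x * E i j * A"
    using assms(1,3) by (metis central_def mult.assoc)
  ultimately show ?thesis by (simp add: ev_def distrib_left distrib_right)
qed

lemma RTT_legs:
  assumes "central x" "central y"
    and "\<And>i j k l. (y - x) * (A i j * B k l - B k l * A i j) = x * y * (A k j * B i l - B k j * A i l)"
  shows "mmul n (supp_mat n (Rxy x y)) (mmul n (leg1 n A) (leg2 n B)) =
    mmul n (leg2 n B) (mmul n (leg1 n A) (supp_mat n (Rxy x y)))"
proof -
  have eq: "(y - x) * (A i j * B k l) - x * y * (A k j * B i l) = 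
        (y - x) * (B k l * A i j) - x * y * (B k j * A i l)" for i j k l
    using assms(3)[of i j k l] by (simp add: right_diff_distrib) (simp add: algebra_simps)
  show ?thesis
    unfolding mmul_assoc[symmetric] unfolding leg2_leg1 mmul_Rxy[OF assms(1,2)] mmul_assoc leg1_leg2 Rxy_mmul
    by (rule supp_mat_ext) (simp add: eq)
qed

text \<open>Transposing one leg of the RTT relation turns R into R'; the hypothesis is the RTT
  relation in that transposed form.\<close>

lemma RTR_legs:
  assumes "central x" "central y"
    and "\<And>i j k l. (x + y) * (A i j * B k l - B k l * A i j) = x * y * (B k (- i) * A (- l) j - A i (- k) * B (- j) l)"
  shows "mmul n (leg1 n A) (mmul n (supp_mat n (Rxy' x y)) (leg2 n B)) =
    mmul n (leg2 n B) (mmul n (supp_mat n (Rxy' x y)) (leg1 n A))"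
  unfolding leg1_Rxy'_leg2[OF assms(1,2)] leg2_Rxy'_leg1[OF assms(1,2)]
proof (rule supp_mat_ext)
  fix i j k l
  show "(case (i, k) of (i, k) \<Rightarrow> \<lambda>(j, l). (x + y) * (A i j * B k l) + x * y * (A i (- k) * B (- j) l)) (j, l) =
       (case (i, k) of (i, k) \<Rightarrow> \<lambda>(j, l). (x + y) * (B k l * A i j) + x * y * (B k (- i) * A (- l) j)) (j, l)"
    using assms(3)[of i j k l] by (simp add: right_diff_distrib) (simp add: algebra_simps)
qed

text \<open>The dressing argument as a computation with words in a semigroup. \<open>T2\<close> is
  pulled to the left through \<open>R'\<close> and \<open>U1\<close>, then \<open>R\<close> travels
  to the right through the RTT relation, the inner reflection equation and the transposed RTT
  relation, and finally \<open>T2'\<close> is pulled to the left.\<close>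

lemma reflection_chain:
  assumes assoc: "\<And>a b c. f (f a b) c = f a (f b c)"
    and RTT: "f R (f T1 T2) = f T2 (f T1 R)"
    and RTT': "f R (f T1' T2') = f T2' (f T1' R)"
    and TRT: "f T1' (f R' T2) = f T2 (f R' T1')"
    and TRT': "f T1 (f R' T2') = f T2' (f R' T1)"
    and comm: "f U1 T2 = f T2 U1" "f T1' U2 = f U2 T1'" "f T1 U2 = f U2 T1" "f U1 T2' = f T2' U1"
    and RE: "f R (f U1 (f R' U2)) = f U2 (f R' (f U1 R))"
  shows "f R (f (f T1 (f U1 T1')) (f R' (f T2 (f U2 T2')))) =
    f (f T2 (f U2 T2')) (f R' (f (f T1 (f U1 T1')) R))"
proof -
  \<comment> \<open>Right-nested words need every exchange rule in front of an arbitrary tail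
    \<open>z\<close>.\<close>
  have e: "f R (f T1 (f T2 z)) = f T2 (f T1 (f R z))"
    "f T1' (f R' (f T2 z)) = f T2 (f R' (f T1' z))"
    "f T2' (f R' (f T1 z)) = f T1 (f R' (f T2' z))"
    "f U1 (f T2 z) = f T2 (f U1 z)" "f T1' (f U2 z) = f U2 (f T1' z)"
    "f U2 (f T1 z) = f T1 (f U2 z)" "f T2' (f U1 z) = f U1 (f T2' z)"
    "f R (f U1 (f R' (f U2 z))) = f U2 (f R' (f U1 (f R z)))" for z
    using assms by metis+
  have "f R (f (f T1 (f U1 T1')) (f R' (f T2 (f U2 T2')))) =
      f R (f T1 (f U1 (f T2 (f R' (f T1' (f U2 T2'))))))"
    by (simp only: assoc e(2))
  also have "\<dots> = f R (f T1 (f T2 (f U1 (f R' (f U2 (f T1' T2'))))))"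
    by (simp only: e(4,5))
  also have "\<dots> = f T2 (f T1 (f U2 (f R' (f U1 (f R (f T1' T2'))))))"
    by (simp only: e(1,8))
  also have "\<dots> = f T2 (f T1 (f U2 (f R' (f U1 (f T2' (f T1' R))))))"
    by (simp only: RTT')
  also have "\<dots> = f T2 (f U2 (f T2' (f R' (f T1 (f U1 (f T1' R))))))"
    by (simp only: e(3,6,7))
  finally show ?thesis by (simp only: assoc)
qed

theorem refl_eq_dress:
  fixes E :: "'r::ring_1 imat"
  assumes c: "central x" "central y" "central a" and gl: "gl_rel E"
    and RE: "refl_eq n x y A B"
    and A: "\<And>i j k l. A i j * E k l = E k l * A i j"
    and B: "\<And>i j k l. B i j * E k l = E k l * B i j"
  shows "refl_eq n x y (dress n a E x A) (dress n a E y B)"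
proof -
  note cm = central_uminus[OF c(1)] central_uminus[OF c(2)]
  define T1 where "T1 = ev a E x"
  define T2 where "T2 = ev a E y"
  define T1' where "T1' = prime_mat (ev a E (- x))"
  define T2' where "T2' = prime_mat (ev a E (- y))"
  have 1: "mmul n (supp_mat n (Rxy x y)) (mmul n (leg1 n T1) (leg2 n T2)) =
    mmul n (leg2 n T2) (mmul n (leg1 n T1) (supp_mat n (Rxy x y)))"
    unfolding T1_def T2_def by (intro RTT_legs c ev_RTT gl)
  \<comment> \<open>RTT at (-u, -v) with both legs transposed: y - x changes sign, x y does not, and
    the transposition absorbs the sign.\<close>
  have 2: "mmul n (supp_mat n (Rxy x y)) (mmul n (leg1 n T1') (leg2 n T2')) =
    mmul n (leg2 n T2') (mmul n (leg1 n T1') (supp_mat n (Rxy x y)))"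
  proof (intro RTT_legs c)
    fix i j k l
    show "(y - x) * (T1' i j * T2' k l - T2' k l * T1' i j) = x * y * (T1' k j * T2' i l - T2' k j * T1' i l)"
      using ev_RTT'[OF cm c(3) gl, of "-j" "-i" "-l" "-k"]
      by (simp add: T1'_def T2'_def prime_mat_def algebra_simps)
  qed
  \<comment> \<open>Only one variable is negated here and in the next claim, so up to sign y - x
    becomes x + y; this is where R'(-u - v) comes from.\<close>
  have 3: "mmul n (leg1 n T1') (mmul n (supp_mat n (Rxy' x y)) (leg2 n T2)) =
    mmul n (leg2 n T2) (mmul n (supp_mat n (Rxy' x y)) (leg1 n T1'))"
  proof (intro RTR_legs c)
    fix i j k l
    show "(x + y) * (T1' i j * T2 k l - T2 k l * T1' i j) = x * y * (T2 k (- i) * T1' (- l) j - T1' i (- k) * T2 (- j) l)"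
      using ev_RTT[OF cm(1) c(2,3) gl, of "-j" "-i" k l]
      by (simp add: T1'_def T2_def prime_mat_def algebra_simps)
  qed
  have 4: "mmul n (leg1 n T1) (mmul n (supp_mat n (Rxy' x y)) (leg2 n T2')) =
    mmul n (leg2 n T2') (mmul n (supp_mat n (Rxy' x y)) (leg1 n T1))"
  proof (intro RTR_legs c)
    fix i j k l
    show "(x + y) * (T1 i j * T2' k l - T2' k l * T1 i j) = x * y * (T2' k (- i) * T1 (- l) j - T1 i (- k) * T2' (- j) l)"
      using ev_RTT'[OF c(1) cm(2) c(3) gl, of i j "-l" "-k"]
      by (simp add: T1_def T2'_def prime_mat_def algebra_simps)
  qed
  have cA: "A i j * ev a E z k l = ev a E z k l * A i j" if "central z" for i j k l z
    using ev_commute[OF that c(3), of "A i j" E] A by blast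
  have cB: "B i j * ev a E z k l = ev a E z k l * B i j" if "central z" for i j k l z
    using ev_commute[OF that c(3), of "B i j" E] B by blast
  have 5: "mmul n (leg1 n A) (leg2 n T2) = mmul n (leg2 n T2) (leg1 n A)"
    "mmul n (leg1 n A) (leg2 n T2') = mmul n (leg2 n T2') (leg1 n A)"
    "mmul n (leg1 n T1) (leg2 n B) = mmul n (leg2 n B) (leg1 n T1)"
    "mmul n (leg1 n T1') (leg2 n B) = mmul n (leg2 n B) (leg1 n T1')"
    unfolding T1_def T2_def T1'_def T2'_def
    by (rule legs_commute; simp add: prime_mat_def cA cB c cm)+
  have D: "leg1 n (dress n a E x A) = mmul n (leg1 n T1) (mmul n (leg1 n A) (leg1 n T1'))"
    "leg2 n (dress n a E y B) = mmul n (leg2 n T2) (mmul n (leg2 n B) (leg2 n T2'))"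
    by (simp_all add: dress_def leg1_imul leg2_imul mmul_assoc T1_def T2_def T1'_def T2'_def)
  show ?thesis
    unfolding refl_eq_def D
    by (rule reflection_chain[where f = "mmul n :: 'r imat2 \<Rightarrow> 'r imat2 \<Rightarrow> 'r imat2"]) (fact mmul_assoc 1 2 3 4 5 RE[unfolded refl_eq_def])+
qed

text \<open>The entry of \<open>A\<close> is moved to the far right, so that it becomes the factor
  acting first on a vector.\<close>

lemma dress_nth:
  assumes "central x" "central a" "\<And>i j k l. A i j * E k l = E k l * A i j"
  shows "dress n a E x A i j =
    (\<Sum>k\<in>idx n. \<Sum>l\<in>idx n. ev a E x i k * ev a E (- x) (- j) (- l) * A k l)"
proof -
  have c: "A i j * ev a E (- x) k l = ev a E (- x) k l * A i j" for i j k l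
    using ev_commute[OF central_uminus[OF assms(1)] assms(2), of "A i j" E] assms(3) by blast
  have "dress n a E x A i j =
     (\<Sum>l\<in>idx n. \<Sum>k\<in>idx n. ev a E x i k * A k l * ev a E (- x) (- j) (- l))"
    by (simp add: dress_def imul_def prime_mat_def sum_distrib_right)
  also have "\<dots> = (\<Sum>l\<in>idx n. \<Sum>k\<in>idx n. ev a E x i k * ev a E (- x) (- j) (- l) * A k l)"
    by (simp add: c mult.assoc)
  also have "\<dots> = (\<Sum>k\<in>idx n. \<Sum>l\<in>idx n. ev a E x i k * ev a E (- x) (- j) (- l) * A k l)"
    by (rule sum.swap)
  finally show ?thesis .
qed

section \<open>Dressing preserves the symmetry relation\<close>

definition symm_rel :: "nat \<Rightarrow> 'r::ring_1 \<Rightarrow> 'r imat \<Rightarrow> 'r imat \<Rightarrow> bool" where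
  "symm_rel n \<alpha> A B \<longleftrightarrow> (\<forall>i\<in>idx n. \<forall>j\<in>idx n. B (- j) (- i) = A i j + \<alpha> * (A i j - B i j))"

lemma sum_idx_swap_uminus:
  "(\<Sum>k\<in>idx n. \<Sum>l\<in>idx n. f k l) = (\<Sum>k\<in>idx n. \<Sum>l\<in>idx n. f (- l) (- k))"
proof -
  have "(\<Sum>k\<in>idx n. \<Sum>l\<in>idx n. f k l) = (\<Sum>l\<in>idx n. \<Sum>k\<in>idx n. f (- l) k)"
    by (simp add: sum_idx_uminus[of "\<lambda>k. \<Sum>l\<in>idx n. f k l", symmetric])
  also have "\<dots> = (\<Sum>l\<in>idx n. \<Sum>k\<in>idx n. f (- l) (- k))"
    by (simp add: sum_idx_uminus)
  also have "\<dots> = (\<Sum>k\<in>idx n. \<Sum>l\<in>idx n. f (- l) (- k))"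
    by (rule sum.swap)
  finally show ?thesis .
qed

text \<open>T(u) is commuted past T(-u). The RTT relation at v = -u has denominator u - v = 2u,
  whence the coefficient \<open>\<alpha>\<close>; writing \<open>x = \<alpha> + \<alpha>\<close>
  replaces a division by 2 in the ring. The substitution (k, l) -> (-l, -k) turns the exchange terms
  into sums over the transposed \<open>\<sigma>\<close>.\<close>

lemma ev_swap_sum:
  fixes E :: "'r::ring_1 imat" and n :: nat and i j :: int
  assumes c: "central \<alpha>" "central a" and gl: "gl_rel E" and x: "x = \<alpha> + \<alpha>"
  defines "F \<equiv> \<lambda>p q \<sigma>. \<Sum>k\<in>idx n. \<Sum>l\<in>idx n. ev a E p (- j) (- l) * ev a E q i k * \<sigma> k l"
  shows "(\<Sum>k\<in>idx n. \<Sum>l\<in>idx n. ev a E x i k * ev a E (- x) (- j) (- l) * \<sigma> k l) =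
    F (- x) x \<sigma> + \<alpha> * (F x (- x) (\<lambda>k l. \<sigma> (- l) (- k)) - F (- x) x (\<lambda>k l. \<sigma> (- l) (- k)))"
proof -
  have cx: "central x" "central (- x)" using central_add[OF c(1) c(1)] central_uminus[of x] by (simp_all add: x)
  have e: "ev a E x i k * ev a E (- x) (- j) (- l) = ev a E (- x) (- j) (- l) * ev a E x i k
      + \<alpha> * (ev a E x (- j) k * ev a E (- x) i (- l) - ev a E (- x) (- j) k * ev a E x i (- l))" for k l
  proof -
    define Z where "Z = (if - j = k then E i (- l) else 0) - (if i = - l then E (- j) k else 0)"
    have 1: "ev a E x i k * ev a E (- x) (- j) (- l) - ev a E (- x) (- j) (- l) * ev a E x i k = x * (- x) * Z"
      unfolding Z_def by (rule ev_commutator[OF cx c(2) gl])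
    have 2: "ev a E x (- j) k * ev a E (- x) i (- l) - ev a E (- x) (- j) k * ev a E x i (- l) = (- x - x) * Z"
      unfolding Z_def by (rule ev_exchange[OF cx c(2)])
    \<comment> \<open>The commutator and the exchange term are multiples of the same
      \<open>Z\<close>; this identity matches their prefactors.\<close>
    have "\<alpha> * (- x - x) = x * (- x)" unfolding x by (simp add: algebra_simps)
    then have 3: "\<alpha> * (ev a E x (- j) k * ev a E (- x) i (- l) - ev a E (- x) (- j) k * ev a E x i (- l)) = x * (- x) * Z"
      unfolding 2 by (simp only: mult.assoc[symmetric])
    show ?thesis unfolding 3 1[symmetric] by simp
  qed
  have "(\<Sum>k\<in>idx n. \<Sum>l\<in>idx n. ev a E x i k * ev a E (- x) (- j) (- l) * \<sigma> k l) =
     F (- x) x \<sigma> + \<alpha> * ((\<Sum>k\<in>idx n. \<Sum>l\<in>idx n. ev a E x (- j) k * ev a E (- x) i (- l) * \<sigma> k l)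
      - (\<Sum>k\<in>idx n. \<Sum>l\<in>idx n. ev a E (- x) (- j) k * ev a E x i (- l) * \<sigma> k l))"
    unfolding F_def
    by (simp add: e distrib_right left_diff_distrib sum.distrib sum_subtractf sum_distrib_left mult.assoc right_diff_distrib)
  then show ?thesis unfolding F_def
    by (simp add: sum_idx_swap_uminus[of "\<lambda>k l. ev a E _ (- j) k * ev a E _ i (- l) * \<sigma> k l"])
qed

text \<open>Here \<open>B\<close> stands for \<open>A\<close> at -u and \<open>\<alpha>\<close> for
  1/(2u). Exchanging T(u) and T(-u) creates a 1/(2u) term of exactly the shape that the symmetry
  relation asks for. The inner relation is needed at u and at -u, which is why \<open>AB\<close>
  comes with its mirror image \<open>BA\<close>.\<close>

theorem symm_rel_dress:
  fixes E :: "'r::ring_1 imat"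
  assumes c: "central \<alpha>" "central a" and gl: "gl_rel E" and x: "x = \<alpha> + \<alpha>"
    and A: "\<And>i j k l. A i j * E k l = E k l * A i j"
    and B: "\<And>i j k l. B i j * E k l = E k l * B i j"
    and AB: "symm_rel n \<alpha> A B" and BA: "symm_rel n (- \<alpha>) B A"
  shows "symm_rel n \<alpha> (dress n a E x A) (dress n a E (- x) B)"
  unfolding symm_rel_def
proof (intro ballI)
  fix i j assume ij: "i \<in> idx n" "j \<in> idx n"
  have cx: "central x" "central (- x)" using central_add[OF c(1) c(1)] central_uminus[of x] by (simp_all add: x)
  define F where "F = (\<lambda>p q \<sigma>. \<Sum>k\<in>idx n. \<Sum>l\<in>idx n. ev a E p (- j) (- l) * ev a E q i k * \<sigma> k l)"
  \<comment> \<open>\<open>F\<close> is linear in its last argument and \<open>\<beta>\<close> is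
    central, so the inner relation passes through the sums.\<close>
  have lin: "F p q (\<lambda>k l. \<sigma> (- l) (- k)) = F p q \<tau> + \<beta> * (F p q \<tau> - F p q \<sigma>)"
    if "symm_rel n \<beta> \<tau> \<sigma>" "central \<beta>" for p q \<sigma> \<tau> \<beta>
  proof -
    have s: "z * \<sigma> (- l) (- k) = z * \<tau> k l + \<beta> * (z * \<tau> k l - z * \<sigma> k l)"
      if "k \<in> idx n" "l \<in> idx n" for z k l
      using \<open>symm_rel n \<beta> \<tau> \<sigma>\<close> that central_left_commute[OF \<open>central \<beta>\<close>, of z]
      unfolding symm_rel_def by (simp add: distrib_left right_diff_distrib)
    have "F p q (\<lambda>k l. \<sigma> (- l) (- k)) = (\<Sum>k\<in>idx n. \<Sum>l\<in>idx n.
       ev a E p (- j) (- l) * ev a E q i k * \<tau> k l + \<beta> * (ev a E p (- j) (- l) * ev a E q i k * \<tau> k l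
          - ev a E p (- j) (- l) * ev a E q i k * \<sigma> k l))"
      unfolding F_def by (intro sum.cong refl s)
    then show ?thesis
      unfolding F_def by (simp add: sum.distrib sum_subtractf sum_distrib_left right_diff_distrib)
  qed
  have D: "dress n a E x A i j = F (- x) x A + \<alpha> * (F x (- x) (\<lambda>k l. A (- l) (- k)) - F (- x) x (\<lambda>k l. A (- l) (- k)))"
    unfolding dress_nth[OF cx(1) c(2) A] F_def by (rule ev_swap_sum[OF c gl x])
  have D': "dress n a E (- x) B i j = F x (- x) B + (- \<alpha>) * (F (- x) x (\<lambda>k l. B (- l) (- k)) - F x (- x) (\<lambda>k l. B (- l) (- k)))"
    unfolding dress_nth[OF cx(2) c(2) B] F_def
    using ev_swap_sum[OF central_uminus[OF c(1)] c(2) gl, of "- x"] x by simp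
  have "dress n a E (- x) B (- j) (- i) = F (- x) x (\<lambda>k l. B (- l) (- k))"
    unfolding dress_nth[OF cx(2) c(2) B] F_def by (subst sum_idx_swap_uminus) simp
  then show "dress n a E (- x) B (- j) (- i) =
      dress n a E x A i j + \<alpha> * (dress n a E x A i j - dress n a E (- x) B i j)"
    unfolding D D' lin[OF AB c(1)] lin[OF BA central_uminus[OF c(1)]]
    by (simp add: algebra_simps)
qed

section \<open>Highest weights modulo a left ideal\<close>

definition left_ideal :: "'r::ring_1 set \<Rightarrow> bool" where
  "left_ideal J \<longleftrightarrow> 0 \<in> J \<and> (\<forall>a\<in>J. \<forall>b\<in>J. a + b \<in> J) \<and> (\<forall>r. \<forall>a\<in>J. r * a \<in> J)"

lemma left_ideal_sum: "left_ideal J \<Longrightarrow> (\<And>i. i \<in> I \<Longrightarrow> f i \<in> J) \<Longrightarrow> sum f I \<in> J"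
  by (induction I rule: infinite_finite_induct) (auto simp: left_ideal_def)

lemma left_ideal_diff: "left_ideal J \<Longrightarrow> a \<in> J \<Longrightarrow> b \<in> J \<Longrightarrow> a - b \<in> J"
  unfolding left_ideal_def by (metis add_uminus_conv_diff mult_minus1)

text \<open>A highest vector without the vector: \<open>J\<close> stands for the elements killing
  it, and having the eigenvalue \<open>\<mu> i\<close> becomes a congruence modulo
  \<open>J\<close>.\<close>

definition hw_mod :: "nat \<Rightarrow> 'r::ring_1 set \<Rightarrow> 'r imat \<Rightarrow> (int \<Rightarrow> 'r) \<Rightarrow> bool" where
  "hw_mod n J A \<mu> \<longleftrightarrow> (\<forall>i\<in>idx n. \<forall>j\<in>idx n. i < j \<longrightarrow> A i j \<in> J) \<and>
     (\<forall>i\<in>{1..int n}. A i i - \<mu> i \<in> J)"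

text \<open>A term T_ik(u) T_(-j,-l)(-u) A_kl lies in \<open>J\<close> if k < l; if l < j, after
  moving the middle factor to the end; and if i < k, after moving the first factor to the end. For i
  <= j only k = l = i = j escapes, and there the three eigenvalues multiply. The value
  \<open>e (- i)\<close> comes from the transposed factor.\<close>

theorem hw_mod_dress:
  fixes E :: "'r::ring_1 imat"
  assumes J: "left_ideal J" and c: "central x" "central a" and gl: "gl_rel E"
    and A: "\<And>i j k l. A i j * E k l = E k l * A i j"
    and hA: "hw_mod n J A \<mu>" and \<mu>: "\<And>i. central (\<mu> i)"
    and E: "\<And>i j. i < j \<Longrightarrow> E i j \<in> J" "\<And>i. E i i - e i \<in> J" and e: "\<And>i. central (e i)"
  shows "hw_mod n J (dress n a E x A) (\<lambda>i. (1 - a * x + x * e i) * (1 + a * x - x * e (- i)) * \<mu> i)"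
proof -
  note cm = central_uminus[OF c(1)]
  have Jm: "r * z \<in> J" if "z \<in> J" for r z using J that by (simp add: left_ideal_def)
  have Ja: "y + z \<in> J" if "y \<in> J" "z \<in> J" for y z using J that by (simp add: left_ideal_def)
  have cA: "A i j * ev a E z k l = ev a E z k l * A i j" if "central z" for i j k l z
    using ev_commute[OF that c(2), of "A i j" E] A by blast
  have evJ: "ev a E z i j \<in> J" if "i < j" for i j z
    using that by (simp add: ev_def Jm E)
  define X where "X i j k l = ev a E x i k * ev a E (- x) (- j) (- l) * A k l" for i j k l
  have X_lt: "X i j k l \<in> J" if "k < l" "k \<in> idx n" "l \<in> idx n" for i j k l
    using hA that by (auto simp: X_def hw_mod_def intro!: Jm)
  have X_lt': "X i j k l \<in> J" if "l < j" for i j k l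
  proof -
    have "X i j k l = ev a E x i k * A k l * ev a E (- x) (- j) (- l)"
      by (simp add: X_def mult.assoc cA[OF cm])
    then show ?thesis using evJ[of "-j" "-l"] that by (auto intro!: Jm)
  qed
  have X_lt'': "X i j k l \<in> J" if "i < k" "- j = k \<Longrightarrow> i < - l" "i = - l \<Longrightarrow> - j < k" for i j k l
  proof -
    \<comment> \<open>The price of moving the first factor past the second; the side conditions say
      that both entries of \<open>E\<close> in \<open>Z\<close> are raising.\<close>
    define Z where "Z = (if - j = k then E i (- l) else 0) - (if i = - l then E (- j) k else 0)"
    have "ev a E x i k * ev a E (- x) (- j) (- l) - ev a E (- x) (- j) (- l) * ev a E x i k = x * (- x) * Z"
      unfolding Z_def by (rule ev_commutator[OF c(1) cm c(2) gl])
    then have "ev a E x i k * ev a E (- x) (- j) (- l) = ev a E (- x) (- j) (- l) * ev a E x i k + x * (- x) * Z"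
      by (simp add: algebra_simps)
    then have "X i j k l = ev a E (- x) (- j) (- l) * (ev a E x i k * A k l) + x * (- x) * (Z * A k l)"
      by (simp add: X_def distrib_right left_diff_distrib mult.assoc)
    also have "ev a E x i k * A k l = A k l * ev a E x i k" by (simp add: cA[OF c(1)])
    also have "Z * A k l = A k l * Z" by (simp add: Z_def A left_diff_distrib right_diff_distrib)
    finally have X: "X i j k l = ev a E (- x) (- j) (- l) * (A k l * ev a E x i k) + x * (- x) * (A k l * Z)" .
    have "Z \<in> J" unfolding Z_def
      by (rule left_ideal_diff[OF J]) (use that E J in \<open>auto simp: left_ideal_def\<close>)
    then show ?thesis unfolding X using evJ[OF that(1)] by (intro Ja Jm)
  qed
  have D: "dress n a E x A i j = (\<Sum>k\<in>idx n. \<Sum>l\<in>idx n. X i j k l)" for i j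
    unfolding X_def by (rule dress_nth[OF c A])
  have off: "dress n a E x A i j \<in> J" if "i \<in> idx n" "j \<in> idx n" "i < j" for i j
    unfolding D
  proof (intro left_ideal_sum[OF J])
    fix k l assume kl: "k \<in> idx n" "l \<in> idx n"
    show "X i j k l \<in> J"
    proof (cases "k < l \<or> l < j")
      case True then show ?thesis using X_lt X_lt' kl by blast
    next
      case False then show ?thesis using that by (intro X_lt'') auto
    qed
  qed
  have diag: "dress n a E x A i i - (1 - a * x + x * e i) * (1 + a * x - x * e (- i)) * \<mu> i \<in> J"
    if i: "i \<in> {1..int n}" for i
  proof -
    have ii: "i \<in> idx n" using i by (auto simp: idx_def)
    define \<tau> where "\<tau> = 1 - a * x + x * e i"
    define \<tau>' where "\<tau>' = 1 + a * x - x * e (- i)"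
    have c\<tau>: "central \<tau>" "central \<tau>'" unfolding \<tau>_def \<tau>'_def
      by (intro central_add central_diff central_mult c e central_1)+
    have J1: "ev a E x i i - \<tau> \<in> J"
    proof -
      have "ev a E x i i - \<tau> = x * (E i i - e i)" by (simp add: ev_def \<tau>_def algebra_simps)
      then show ?thesis using E(2) by (simp add: Jm)
    qed
    have J2: "ev a E (- x) (- i) (- i) - \<tau>' \<in> J"
    proof -
      have "ev a E (- x) (- i) (- i) - \<tau>' = (- x) * (E (- i) (- i) - e (- i))" by (simp add: ev_def \<tau>'_def algebra_simps)
      then show ?thesis using E(2) by (simp only: Jm)
    qed
    have J3: "A i i - \<mu> i \<in> J" using hA i by (simp add: hw_mod_def)
    \<comment> \<open>A telescoping sum in which every difference from an eigenvalue stands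
      rightmost; the eigenvalues are central and can be moved out of the way.\<close>
    have "X i i i i - \<tau> * \<tau>' * \<mu> i = ev a E x i i * ev a E (- x) (- i) (- i) * (A i i - \<mu> i)
        + \<mu> i * (ev a E x i i * (ev a E (- x) (- i) (- i) - \<tau>') + \<tau>' * (ev a E x i i - \<tau>))"
      using centralD[OF c\<tau>(2), of "ev a E x i i"] centralD[OF c\<tau>(2), of \<tau>]
        centralD[OF \<mu>[of i], of "\<tau> * \<tau>'"] centralD[OF \<mu>[of i], of "ev a E x i i * ev a E (- x) (- i) (- i)"]
      unfolding X_def by (simp only: right_diff_distrib distrib_left) (simp add: mult.assoc)
    also have "\<dots> \<in> J" using J1 J2 J3 by (intro Ja Jm)
    finally have Xii: "X i i i i - \<tau> * \<tau>' * \<mu> i \<in> J" .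
    have "(\<Sum>k\<in>idx n. \<Sum>l\<in>idx n. X i i k l - (if k = i then if l = i then \<tau> * \<tau>' * \<mu> i else 0 else 0)) \<in> J"
    proof (intro left_ideal_sum[OF J])
      fix k l assume kl: "k \<in> idx n" "l \<in> idx n"
      show "X i i k l - (if k = i then if l = i then \<tau> * \<tau>' * \<mu> i else 0 else 0) \<in> J"
      proof (cases "k = i \<and> l = i")
        case True then show ?thesis using Xii by simp
      next
        case False
        have "X i i k l \<in> J"
        proof (cases "k < l \<or> l < i")
          case True then show ?thesis using X_lt X_lt' kl by blast
        next
          \<comment> \<open>Now k >= l >= i >= 1, so neither k = -i nor l = -i can occur; this is
            where positivity of \<open>i\<close> enters.\<close>
          case F: False then show ?thesis using i False by (intro X_lt'') auto
        qed
        then show ?thesis using False by auto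
      qed
    qed
    then show ?thesis unfolding D \<tau>_def[symmetric] \<tau>'_def[symmetric]
      by (simp only: sum_subtractf sum_delta2[OF ii ii])
  qed
  show ?thesis using off diag by (simp add: hw_mod_def)
qed


section \<open>Operators on the fermionic Fock space\<close>

text \<open>Vectors are arbitrary functions on sets of occupied modes, infinite sets included;
  finiteness is imposed only later, on a subspace. One equation encodes linearity. Having operators
  as a type of class \<open>ring_1\<close> makes the preceding matrix theorems applicable as they
  stand.\<close>

typedef (overloaded) 'k fock_op = "{f :: (nat set \<Rightarrow> 'k::comm_ring_1) \<Rightarrow> nat set \<Rightarrow> 'k.
    \<forall>c u v. f (\<lambda>A. c * u A + v A) = (\<lambda>A. c * f u A + f v A)}"
  morphisms app fock_op
  by (rule exI[of _ "\<lambda>u. u"]) simp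

setup_lifting type_definition_fock_op

instantiation fock_op :: (comm_ring_1) ring_1
begin

lift_definition zero_fock_op :: "'a fock_op" is "\<lambda>u A. 0" by simp
lift_definition one_fock_op :: "'a fock_op" is "\<lambda>u. u" by simp
lift_definition plus_fock_op :: "'a fock_op \<Rightarrow> 'a fock_op \<Rightarrow> 'a fock_op" is "\<lambda>f g u A. f u A + g u A"
  by (simp add: algebra_simps)
lift_definition minus_fock_op :: "'a fock_op \<Rightarrow> 'a fock_op \<Rightarrow> 'a fock_op" is "\<lambda>f g u A. f u A - g u A"
  by (simp add: algebra_simps)
lift_definition uminus_fock_op :: "'a fock_op \<Rightarrow> 'a fock_op" is "\<lambda>f u A. - f u A"
  by (simp add: algebra_simps)
lift_definition times_fock_op :: "'a fock_op \<Rightarrow> 'a fock_op \<Rightarrow> 'a fock_op" is "\<lambda>f g u. f (g u)"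
  by simp

instance
proof
  fix a b c :: "'a fock_op"
  have add: "f (\<lambda>A. u A + v A) = (\<lambda>A. f u A + f v A)"
    if "\<forall>c u v. f (\<lambda>A. c * u A + v A) = (\<lambda>A. c * f u A + f v A)"
    for f :: "(nat set \<Rightarrow> 'a) \<Rightarrow> nat set \<Rightarrow> 'a" and u v
    using that[rule_format, of 1 u v] by simp
  show "a * (b + c) = a * b + a * c"
    by transfer (simp add: fun_eq_iff add)
  show "(0 :: 'a fock_op) \<noteq> 1"
    by transfer (metis zero_neq_one)
qed (transfer; simp add: fun_eq_iff algebra_simps)+

end

lift_definition fock_scal :: "'k::comm_ring_1 \<Rightarrow> 'k fock_op" is "\<lambda>c u A. c * u A"
  by (simp add: algebra_simps)

lemma app_0: "app 0 u = (\<lambda>A. 0)" by transfer simp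
lemma app_1: "app 1 u = u" by transfer simp
lemma app_add: "app (F + G) u = (\<lambda>A. app F u A + app G u A)" by transfer simp
lemma app_diff: "app (F - G) u = (\<lambda>A. app F u A - app G u A)" by transfer simp
lemma app_uminus: "app (- F) u = (\<lambda>A. - app F u A)" by transfer simp
lemma app_mult: "app (F * G) u = app F (app G u)" by transfer simp
lemma app_scal: "app (fock_scal c) u = (\<lambda>A. c * u A)" by transfer simp
lemma app_lin: "app F (\<lambda>A. c * u A + v A) = (\<lambda>A. c * app F u A + app F v A)"
  using app[of F] by simp
lemma app_zero: "app F (\<lambda>A. 0) = (\<lambda>A. 0)"
  using app_lin[of F 0 "\<lambda>A. 0" "\<lambda>A. 0"] app_lin[of F 1 "\<lambda>A. 0" "\<lambda>A. 0"] by (auto simp: fun_eq_iff)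

lemma app_sum: "app (\<Sum>i\<in>I. F i) u = (\<lambda>A. \<Sum>i\<in>I. app (F i) u A)"
  by (induction I rule: infinite_finite_induct) (auto simp: app_0 app_add)

lemma fock_op_eqI: "(\<And>u A. app F u A = app G u A) \<Longrightarrow> F = G"
  by transfer (simp add: fun_eq_iff)

lemma central_fock_scal: "central (fock_scal c)"
  unfolding central_def
proof (intro allI fock_op_eqI)
  fix F :: "'a fock_op" and u A
  show "app (F * fock_scal c) u A = app (fock_scal c * F) u A"
    using app_lin[of F c u "\<lambda>A. 0"] by (simp add: app_mult app_scal app_zero)
qed

lemma fock_scal_add: "fock_scal (c + d) = fock_scal c + fock_scal d"
  by transfer (simp add: fun_eq_iff algebra_simps)
lemma fock_scal_mult: "fock_scal (c * d) = fock_scal c * fock_scal d"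
  by transfer (simp add: fun_eq_iff algebra_simps)
lemma fock_scal_1 [simp]: "fock_scal 1 = 1"
  by transfer (simp add: fun_eq_iff)
lemma fock_scal_0 [simp]: "fock_scal 0 = 0"
  by transfer (simp add: fun_eq_iff)

section \<open>Creation and annihilation operators\<close>

definition fsign :: "nat \<Rightarrow> nat set \<Rightarrow> 'k::comm_ring_1" where
  "fsign x A = (-1) ^ card {z \<in> A. z < x}"

lemma fsign_square [simp]: "fsign x A * fsign x A = 1" "fsign x A * (fsign x A * c) = c"
proof -
  show "fsign x A * fsign x A = 1"
    by (simp add: fsign_def flip: power_add)
  then show "fsign x A * (fsign x A * c) = c" by (metis mult.assoc mult_1)
qed

lemma fsign_insert: 
  assumes "y \<notin> A"
  shows "fsign x (insert y A) = (if y < x then - fsign x A else fsign x A)"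
proof -
  have "{z \<in> insert y A. z < x} = (if y < x then insert y {z \<in> A. z < x} else {z \<in> A. z < x})"
    by auto
  then show ?thesis using assms by (simp add: fsign_def)
qed

lemma fsign_remove: 
  assumes "y \<in> A"
  shows "fsign x (A - {y}) = (if y < x then - fsign x A else fsign x A)"
proof -
  have "fsign x A = (if y < x then - fsign x (A - {y}) else fsign x (A - {y}) :: 'a::comm_ring_1)"
    using fsign_insert[of y "A - {y}" x] assms by (simp add: insert_absorb)
  then show ?thesis by (cases "y < x") simp_all
qed

text \<open>The operator acts on coefficients: the value at \<open>A\<close> is read off from the
  configuration before the particle was added. \<open>fsign\<close> is the Jordan-Wigner sign; it
  counts only occupied modes below \<open>x\<close>, hence makes sense for infinite
  \<open>A\<close>.\<close>

lift_definition creator :: "nat \<Rightarrow> 'k::comm_ring_1 fock_op" is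
  "\<lambda>x u A. if x \<in> A then fsign x A * u (A - {x}) else 0"
  by (simp add: fun_eq_iff algebra_simps)

lift_definition annihilator :: "nat \<Rightarrow> 'k::comm_ring_1 fock_op" is
  "\<lambda>x u A. if x \<notin> A then fsign x A * u (insert x A) else 0"
  by (simp add: fun_eq_iff algebra_simps)

lemma app_creator: "app (creator x) u A = (if x \<in> A then fsign x A * u (A - {x}) else 0)"
  by transfer simp

lemma app_annihilator: "app (annihilator x) u A = (if x \<notin> A then fsign x A * u (insert x A) else 0)"
  by transfer simp

lemma insert_Diff_swap: "x \<noteq> y \<Longrightarrow> insert x A - {y} = insert x (A - {y})"
  by auto

lemma creator_annihilator:
  "annihilator x * creator y = (if x = y then 1 else 0) - creator y * annihilator x"
proof (rule fock_op_eqI)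
  fix u :: "nat set \<Rightarrow> 'a" and A
  show "app (annihilator x * creator y) u A =
      app ((if x = y then 1 else 0) - creator y * annihilator x) u A"
  proof (cases "x = y")
    case True
    then show ?thesis
      by (cases "y \<in> A")
         (auto simp: app_mult app_creator app_annihilator app_diff app_1 fsign_insert fsign_remove insert_absorb)
  next
    case False
    then have "\<not> (x < y) \<longleftrightarrow> y < x" by auto
    with False show ?thesis
      by (auto simp: app_mult app_creator app_annihilator app_diff app_0 app_uminus fsign_insert fsign_remove
          insert_Diff_swap mult.left_commute)
  qed
qed

lemma creator_anticommute: "creator x * creator y = - (creator y * creator x)"
proof (rule fock_op_eqI)
  fix u :: "nat set \<Rightarrow> 'a" and A
  have "A - {x} - {y} = A - {y} - {x}" by auto
  then show "app (creator x * creator y) u A = app (- (creator y * creator x)) u A"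
    by (cases x y rule: linorder_cases)
      (auto simp: app_mult app_creator app_uminus fsign_remove)
qed

lemma annihilator_anticommute: "annihilator x * annihilator y = - (annihilator y * annihilator x)"
proof (rule fock_op_eqI)
  fix u :: "nat set \<Rightarrow> 'a" and A
  have "insert x (insert y A) = insert y (insert x A)" by auto
  then show "app (annihilator x * annihilator y) u A = app (- (annihilator y * annihilator x)) u A"
    by (cases x y rule: linorder_cases)
      (auto simp: app_mult app_annihilator app_uminus fsign_insert)
qed

text \<open>Normal ordering leaves a quartic term that is symmetric: exchanging the two creators and
  the two annihilators gives two signs that cancel.\<close>

lemma bilinear_commutator:
  fixes a b c d :: nat
  defines "X \<equiv> \<lambda>a b. creator a * annihilator b :: 'k::comm_ring_1 fock_op"
  shows "X a b * X c d - X c d * X a b = (if c = b then X a d else 0) - (if a = d then X c b else 0)"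
proof -
  have e: "X a b * X c d = (if b = c then X a d else 0) - creator a * creator c * (annihilator b * annihilator d)" for a b c d
  proof -
    have "X a b * X c d = creator a * (annihilator b * creator c) * annihilator d"
      by (simp add: X_def mult.assoc)
    then show ?thesis unfolding creator_annihilator by (simp add: X_def algebra_simps)
  qed
  have "creator c * creator a * (annihilator d * annihilator b) = creator a * creator c * (annihilator b * annihilator d :: 'k fock_op)"
    unfolding creator_anticommute[of c a] annihilator_anticommute[of d b] by simp
  then show ?thesis unfolding e by auto
qed

text \<open>Each dressing step \<open>\<alpha>\<close> uses its own copy of the exterior algebra of the vector representation.\<close>

definition mode :: "nat \<Rightarrow> int \<Rightarrow> nat" where
  "mode \<alpha> i = to_nat (\<alpha>, i)"

lemma mode_eq_iff [simp]: "mode \<alpha> i = mode \<beta> j \<longleftrightarrow> \<alpha> = \<beta> \<and> i = j"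
  by (simp add: mode_def)

definition glop :: "nat \<Rightarrow> int \<Rightarrow> int \<Rightarrow> 'k::comm_ring_1 fock_op" where
  "glop \<alpha> i j = creator (mode \<alpha> i) * annihilator (mode \<alpha> j)"

lemma gl_rel_glop: "gl_rel (glop \<alpha>)"
  unfolding gl_rel_def glop_def using bilinear_commutator by (auto simp: bilinear_commutator)

lemma glop_commute: "\<alpha> \<noteq> \<beta> \<Longrightarrow> glop \<alpha> i j * glop \<beta> k l = glop \<beta> k l * glop \<alpha> i j"
  using bilinear_commutator[of "mode \<alpha> i" "mode \<alpha> j" "mode \<beta> k" "mode \<beta> l"] by (simp add: glop_def)

text \<open>In copy \<open>\<alpha>\<close> all modes \<open>i \<le> \<kappa> \<alpha>\<close> are occupied, including the infinitely many outside the index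
  set, which no generator ever moves: this makes \<open>E\<^sub>i\<^sub>j\<close> with \<open>i < j\<close> kill the vacuum for all integers.\<close>

definition sea :: "(nat \<Rightarrow> int) \<Rightarrow> nat set" where
  "sea \<kappa> = {mode \<alpha> i | \<alpha> i. i \<le> \<kappa> \<alpha>}"

definition vac :: "(nat \<Rightarrow> int) \<Rightarrow> nat set \<Rightarrow> 'k::comm_ring_1" where
  "vac \<kappa> A = (if A = sea \<kappa> then 1 else 0)"

lemma mode_in_sea: "mode \<alpha> i \<in> sea \<kappa> \<longleftrightarrow> i \<le> \<kappa> \<alpha>"
  by (auto simp: sea_def)

lemma app_glop:
  "app (glop \<alpha> i j) u A = (if mode \<alpha> i \<in> A \<and> mode \<alpha> j \<notin> A - {mode \<alpha> i} then
     fsign (mode \<alpha> i) A * fsign (mode \<alpha> j) (A - {mode \<alpha> i}) * u (insert (mode \<alpha> j) (A - {mode \<alpha> i})) else 0)"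
  by (auto simp: glop_def app_mult app_creator app_annihilator)

text \<open>A nonzero coefficient would require the sea to contain mode \<open>j\<close> but not
  mode \<open>i\<close>, although it is closed downwards within each copy.\<close>

lemma glop_vac_lt:
  assumes "i < j"
  shows "app (glop \<alpha> i j) (vac \<kappa>) = (\<lambda>A. 0)"
proof
  fix A
  have "insert (mode \<alpha> j) (A - {mode \<alpha> i}) \<noteq> sea \<kappa>"
  proof
    assume eq: "insert (mode \<alpha> j) (A - {mode \<alpha> i}) = sea \<kappa>"
    then have "mode \<alpha> j \<in> sea \<kappa>" by blast
    then have "mode \<alpha> i \<in> sea \<kappa>" using assms by (simp add: mode_in_sea)
    with eq have "mode \<alpha> i \<in> insert (mode \<alpha> j) (A - {mode \<alpha> i})" by simp
    then show False using assms by simp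
  qed
  then show "app (glop \<alpha> i j) (vac \<kappa>) A = 0" by (simp add: app_glop vac_def)
qed

lemma glop_vac_eq:
  "app (glop \<alpha> i i - fock_scal (if i \<le> \<kappa> \<alpha> then 1 else 0)) (vac \<kappa>) = (\<lambda>A. 0)"
proof
  fix A
  show "app (glop \<alpha> i i - fock_scal (if i \<le> \<kappa> \<alpha> then 1 else 0)) (vac \<kappa>) A = 0"
  proof (cases "mode \<alpha> i \<in> A")
    case True
    then show ?thesis
      by (cases "A = sea \<kappa>") (auto simp: app_diff app_glop app_scal app_1 vac_def insert_absorb fsign_remove mode_in_sea)
  next
    case False
    then show ?thesis
      by (cases "A = sea \<kappa>") (auto simp: app_diff app_glop app_scal vac_def mode_in_sea)
  qed
qed


section \<open>The dressed matrix\<close>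

text \<open>Serves two closure arguments: for the free algebra on the chosen letters and for the
  operators preserving a subspace. Both pass to power series coefficientwise.\<close>

definition subring_set :: "'r::ring_1 set \<Rightarrow> bool" where
  "subring_set C \<longleftrightarrow> 1 \<in> C \<and> (\<forall>a\<in>C. \<forall>b\<in>C. a - b \<in> C \<and> a * b \<in> C)"

definition fps_over :: "'r::ring_1 set \<Rightarrow> 'r fps set" where
  "fps_over C = {f. \<forall>r. f $ r \<in> C}"

context
  fixes C :: "'r::ring_1 set"
  assumes C: "subring_set C"
begin

lemma subring_set_1: "1 \<in> C" using C by (simp add: subring_set_def)
lemma subring_set_diff: "a \<in> C \<Longrightarrow> b \<in> C \<Longrightarrow> a - b \<in> C" using C by (simp add: subring_set_def)
lemma subring_set_mult: "a \<in> C \<Longrightarrow> b \<in> C \<Longrightarrow> a * b \<in> C" using C by (simp add: subring_set_def)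
lemma subring_set_0: "0 \<in> C" using subring_set_diff[OF subring_set_1 subring_set_1] by simp
lemma subring_set_uminus: "a \<in> C \<Longrightarrow> - a \<in> C" using subring_set_diff[OF subring_set_0] by simp
lemma subring_set_add: "a \<in> C \<Longrightarrow> b \<in> C \<Longrightarrow> a + b \<in> C"
  using subring_set_diff[of a "- b"] subring_set_uminus by simp
lemma subring_set_sum: "(\<And>i. i \<in> I \<Longrightarrow> f i \<in> C) \<Longrightarrow> sum f I \<in> C"
  by (induction I rule: infinite_finite_induct) (auto simp: subring_set_0 subring_set_add)
lemma subring_set_power: "a \<in> C \<Longrightarrow> a ^ k \<in> C"
  by (induction k) (auto simp: subring_set_1 subring_set_mult)

lemma fps_over_const: "a \<in> C \<Longrightarrow> fps_const a \<in> fps_over C"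
  by (simp add: fps_over_def subring_set_0)

lemma subring_set_fps_over: "subring_set (fps_over C)"
  unfolding subring_set_def
  by (auto simp: fps_over_def fps_mult_nth subring_set_1 subring_set_0 subring_set_diff
      intro!: subring_set_sum subring_set_mult)

lemma fps_over_X: "fps_X \<in> fps_over C"
  by (simp add: fps_over_def fps_X_def subring_set_0 subring_set_1)

lemma fps_over_at_neg: "f \<in> fps_over C \<Longrightarrow> at_neg f \<in> fps_over C"
  by (auto simp: fps_over_def intro!: subring_set_mult subring_set_power subring_set_uminus subring_set_1)

end

lemma in_u_over: "subring_set C \<Longrightarrow> f \<in> fps_over C \<Longrightarrow> in_u f \<in> fps_over (fps_over C)"
  by (simp add: in_u_def fps_over_const subring_set_fps_over)

lemma in_v_over: "subring_set C \<Longrightarrow> f \<in> fps_over C \<Longrightarrow> in_v f \<in> fps_over (fps_over C)"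
  by (auto simp: in_v_def fps_over_def subring_set_0)

text \<open>The two embeddings of series, u -> -u, constant terms and the evaluation of generators
  are all such maps, and dressing commutes with each of them.\<close>

locale ring_1_hom =
  fixes \<phi> :: "'r::ring_1 \<Rightarrow> 's::ring_1"
  assumes hom_add: "\<phi> (a + b) = \<phi> a + \<phi> b" and hom_mult: "\<phi> (a * b) = \<phi> a * \<phi> b" and hom_1: "\<phi> 1 = 1"
begin

lemma hom_0: "\<phi> 0 = 0" using hom_add[of 0 0] by simp
lemma hom_uminus: "\<phi> (- a) = - \<phi> a" using hom_add[of a "- a"] by (simp add: hom_0 eq_neg_iff_add_eq_0 add.commute)
lemma hom_diff: "\<phi> (a - b) = \<phi> a - \<phi> b" using hom_add[of a "- b"] by (simp add: hom_uminus)
lemma hom_sum: "\<phi> (\<Sum>i\<in>I. f i) = (\<Sum>i\<in>I. \<phi> (f i))"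
  by (induction I rule: infinite_finite_induct) (simp_all add: hom_add hom_0)
lemma hom_if: "\<phi> (if b then a else c) = (if b then \<phi> a else \<phi> c)" by simp

lemmas homs = hom_add hom_mult hom_1 hom_0 hom_uminus hom_diff hom_sum hom_if

lemma hom_ev: "\<phi> (ev a E z i j) = ev (\<phi> a) (\<lambda>i j. \<phi> (E i j)) (\<phi> z) i j"
  by (simp add: ev_def homs)

lemma hom_dress: "\<phi> (dress n a E z A i j) = dress n (\<phi> a) (\<lambda>i j. \<phi> (E i j)) (\<phi> z) (\<lambda>i j. \<phi> (A i j)) i j"
  by (simp add: dress_def imul_def prime_mat_def homs hom_ev)

lemma hom_mmul: "\<phi> (mmul n A B a c) = mmul n (\<lambda>a b. \<phi> (A a b)) (\<lambda>a b. \<phi> (B a b)) a c"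
  by (simp add: mmul_def homs)

lemma hom_supp: "\<phi> (supp_mat n A a b) = supp_mat n (\<lambda>a b. \<phi> (A a b)) a b"
  by (simp add: supp_mat_def homs)

lemma hom_Rxy: "\<phi> (Rxy x y a b) = Rxy (\<phi> x) (\<phi> y) a b"
  by (cases a; cases b) (simp only: Rxy_def prod.case homs)

lemma hom_Rxy': "\<phi> (Rxy' x y a b) = Rxy' (\<phi> x) (\<phi> y) a b"
  by (cases a; cases b) (simp only: Rxy'_def prod.case homs)

lemma hom_leg1: "\<phi> (leg1 n A a b) = leg1 n (\<lambda>i j. \<phi> (A i j)) a b"
  by (simp add: leg1_def supp_mat_def tens_def id_mat_def homs)

lemma hom_leg2: "\<phi> (leg2 n A a b) = leg2 n (\<lambda>i j. \<phi> (A i j)) a b"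
  by (simp add: leg2_def supp_mat_def tens_def id_mat_def homs)

lemmas hom_mats = hom_mmul hom_supp hom_Rxy hom_Rxy' hom_leg1 hom_leg2

end

lemma ring_1_hom_in_u: "ring_1_hom (in_u :: 'r::ring_1 fps \<Rightarrow> _)"
  by standard (simp_all add: in_u_add in_u_mult in_u_1)
lemma ring_1_hom_in_v: "ring_1_hom (in_v :: 'r::ring_1 fps \<Rightarrow> _)"
  by standard (simp_all add: in_v_add in_v_mult in_v_1)
lemma ring_1_hom_at_neg: "ring_1_hom (at_neg :: 'r::ring_1 fps \<Rightarrow> _)"
  by standard (simp_all add: at_neg_add at_neg_mult)
lemma ring_1_hom_nth_0: "ring_1_hom (\<lambda>f :: 'r::ring_1 fps. f $ 0)"
  by standard (simp_all add: fps_mult_nth_0)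

lemma dress_over:
  assumes C: "subring_set C" and "a \<in> C" "x \<in> C" "\<And>i j. i \<in> idx n \<Longrightarrow> j \<in> idx n \<Longrightarrow> E i j \<in> C"
     "\<And>i j. i \<in> idx n \<Longrightarrow> j \<in> idx n \<Longrightarrow> A i j \<in> C" "i \<in> idx n" "j \<in> idx n"
  shows "dress n a E x A i j \<in> C"
proof -
  have "ev a E z i j \<in> C" if "i \<in> idx n" "j \<in> idx n" "z \<in> C" for i j z
    unfolding ev_def using that assms
    by (auto intro!: subring_set_add[OF C] subring_set_diff[OF C] subring_set_mult[OF C] subring_set_0[OF C] subring_set_1[OF C])
  then have "ev a E x i j \<in> C" "ev a E (- x) (- j) (- i) \<in> C" if "i \<in> idx n" "j \<in> idx n" for i j
    using that assms(3) subring_set_uminus[OF C] by simp_all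
  then show ?thesis using assms(5-7)
    by (auto simp: dress_def imul_def prime_mat_def intro!: subring_set_sum[OF C] subring_set_mult[OF C])
qed

section \<open>Iterated dressing of the identity matrix\<close>

primrec dressed :: "nat \<Rightarrow> (nat \<Rightarrow> 'k::comm_ring_1) \<Rightarrow> nat \<Rightarrow> 'k fock_op fps imat" where
  "dressed n a 0 = id_mat"
| "dressed n a (Suc m) = dress n (fps_const (fock_scal (a m))) (\<lambda>i j. fps_const (glop m i j)) fps_X (dressed n a m)"

lemma gl_rel_hom:
  assumes "ring_1_hom \<phi>" "gl_rel E"
  shows "gl_rel (\<lambda>i j. \<phi> (E i j))"
proof -
  interpret ring_1_hom \<phi> by fact
  show ?thesis unfolding gl_rel_def
  proof (intro allI)
    fix i j k l
    have "\<phi> (E i j * E k l - E k l * E i j) = \<phi> ((if k = j then E i l else 0) - (if i = l then E k j else 0))"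
      using assms(2) unfolding gl_rel_def by metis
    then show "\<phi> (E i j) * \<phi> (E k l) - \<phi> (E k l) * \<phi> (E i j) =
        (if k = j then \<phi> (E i l) else 0) - (if i = l then \<phi> (E k j) else 0)"
      by (simp add: homs del: hom_if split: if_splits)
  qed
qed

lemma ring_1_hom_fps_const: "ring_1_hom (fps_const :: 'r::ring_1 \<Rightarrow> _)"
  by standard simp_all

lemma gl_rel_glop_fps: "gl_rel (\<lambda>i j. fps_const (glop m i j))"
  by (rule gl_rel_hom[OF ring_1_hom_fps_const gl_rel_glop])

text \<open>The first \<open>m\<close> steps use only the copies below \<open>m\<close>, and
  distinct copies share no modes.\<close>

lemma dressed_commute:
  "m \<le> \<alpha> \<Longrightarrow> dressed n a m i j * fps_const (glop \<alpha> k l) = fps_const (glop \<alpha> k l) * dressed n a m i j"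
proof (induction m arbitrary: i j)
  case 0
  then show ?case by (simp add: id_mat_def)
next
  case (Suc m)
  define g :: "'a fock_op fps" where "g = fps_const (glop \<alpha> k l)"
  define e where "e = ev (fps_const (fock_scal (a m))) (\<lambda>i j. fps_const (glop m i j :: 'a fock_op))"
  have 1: "e z i j * g = g * e z i j" if "central z" for z i j
    unfolding e_def
  proof (rule ev_commute[symmetric, OF that])
    show "g * fps_const (glop m k' l') = fps_const (glop m k' l') * g" for k' l'
      unfolding g_def using glop_commute[of \<alpha> m] Suc.prems by simp
  qed (simp add: central_fps_const central_fock_scal)
  have 2: "dressed n a m i j * g = g * dressed n a m i j" for i j
    using Suc by (simp add: g_def)
  have 3: "u * v * w * g = g * (u * v * w)"
    if "u * g = g * u" "v * g = g * v" "w * g = g * w" for u v w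
  proof -
    have "u * v * w * g = u * (v * g) * w" by (simp add: mult.assoc that(3))
    also have "\<dots> = u * g * (v * w)" by (simp add: mult.assoc that(2))
    finally show ?thesis by (simp add: that(1) mult.assoc)
  qed
  show ?case
    unfolding dressed.simps dress_def imul_def prime_mat_def sum_distrib_right sum_distrib_left
    unfolding g_def[symmetric] e_def[symmetric]
    by (intro sum.cong refl 3 1 2 central_fps_X central_uminus)
qed

text \<open>For S = 1 the equation says that R and R' commute. This holds because the swap fixes the
  vector spanning the image of P', so P P' = P' P = P'.\<close>

lemma refl_eq_id:
  assumes "central x" "central y"
  shows "refl_eq n x y id_mat id_mat"
proof -
  have i: "mmul n (leg1 n id_mat) (supp_mat n X) = supp_mat n X" "mmul n (leg2 n id_mat) (supp_mat n X) = supp_mat n X"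
    "mmul n (supp_mat n X) (leg1 n id_mat) = supp_mat n X" "mmul n (supp_mat n X) (leg2 n id_mat) = supp_mat n X"
    for X :: "'a imat2"
    unfolding leg1_mmul leg2_mmul mmul_leg1 mmul_leg2
    by (rule supp_mat_ext; simp add: id_mat_def if_distrib[of "\<lambda>x. x * _"] if_distrib[of "\<lambda>x. _ * x"] cong: if_cong)+
  have "mmul n (supp_mat n (Rxy x y)) (supp_mat n (Rxy' x y)) = mmul n (supp_mat n (Rxy' x y)) (supp_mat n (Rxy x y))"
    unfolding Rxy_mmul mmul_Rxy[OF assms]
    by (rule supp_mat_ext) (auto simp: Rxy'_def)
  then show ?thesis by (simp add: refl_eq_def i flip: supp_mmul)
qed

lemma refl_eq_dressed:
  "refl_eq n (in_u fps_X) (in_v fps_X) (\<lambda>i j. in_u (dressed n a m i j)) (\<lambda>i j. in_v (dressed n a m i j))"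
proof (induction m)
  case 0
  have "(\<lambda>i j. in_u (id_mat i j)) = (id_mat :: 'a fock_op fps fps imat)"
    "(\<lambda>i j. in_v (id_mat i j)) = (id_mat :: 'a fock_op fps fps imat)"
    by (auto simp: fun_eq_iff id_mat_def in_u_1 in_v_1 in_u_0 in_v_0)
  then show ?case by (simp add: refl_eq_id central_in_u central_fps_X central_in_v_X)
next
  case (Suc m)
  interpret u: ring_1_hom "in_u :: 'a fock_op fps \<Rightarrow> _" by (rule ring_1_hom_in_u)
  interpret v: ring_1_hom "in_v :: 'a fock_op fps \<Rightarrow> _" by (rule ring_1_hom_in_v)
  \<comment> \<open>Constants look the same in both variables, so the dressings at u and at v share
    one \<open>E\<close>.\<close>
  have c: "in_v (fps_const z) = in_u (fps_const z)" for z :: "'a fock_op"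
    by (auto simp: in_u_def in_v_def fps_eq_iff)
  show ?case
    unfolding dressed.simps u.hom_dress v.hom_dress c
  proof (rule refl_eq_dress[OF _ _ _ _ Suc.IH])
    show "gl_rel (\<lambda>i j. in_u (fps_const (glop m i j)))"
      by (rule gl_rel_hom[OF ring_1_hom_in_u gl_rel_glop_fps])
    show "in_u (dressed n a m i j) * in_u (fps_const (glop m k l)) = in_u (fps_const (glop m k l)) * in_u (dressed n a m i j)" for i j k l
      unfolding in_u_mult[symmetric] by (simp add: dressed_commute)
    show "in_v (dressed n a m i j) * in_u (fps_const (glop m k l)) = in_u (fps_const (glop m k l)) * in_v (dressed n a m i j)" for i j k l
      unfolding c[symmetric] in_v_mult[symmetric] by (simp add: dressed_commute)
  qed (simp_all add: central_in_u central_fps_X central_in_v_X central_fps_const central_fock_scal)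
qed

text \<open>The mirrored relation is carried along because each dressing step consumes both.\<close>

lemma symm_rel_dressed:
  assumes two: "h + h = (1 :: 'k::comm_ring_1)"
  defines "\<alpha> \<equiv> fps_const (fock_scal h) * fps_X"
  shows "symm_rel n \<alpha> (dressed n a m) (\<lambda>i j. at_neg (dressed n a m i j)) \<and>
    symm_rel n (- \<alpha>) (\<lambda>i j. at_neg (dressed n a m i j)) (dressed n a m)"
proof (induction m)
  case 0
  show ?case by (auto simp: symm_rel_def id_mat_def)
next
  case (Suc m)
  interpret at_neg: ring_1_hom "at_neg :: 'k fock_op fps \<Rightarrow> _" by (rule ring_1_hom_at_neg)
  have X: "fps_X = \<alpha> + \<alpha>"
    unfolding \<alpha>_def distrib_right[symmetric] fps_const_add by (simp add: two flip: fock_scal_add)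
  have c\<alpha>: "central \<alpha>" unfolding \<alpha>_def
    by (intro central_mult central_fps_const central_fock_scal central_fps_X)
  have cs: "central (fps_const (fock_scal (a m)))" by (intro central_fps_const central_fock_scal)
  have A: "dressed n a m i j * fps_const (glop m k l) = fps_const (glop m k l) * dressed n a m i j" for i j k l
    by (simp add: dressed_commute)
  have B: "at_neg (dressed n a m i j) * fps_const (glop m k l) = fps_const (glop m k l) * at_neg (dressed n a m i j)" for i j k l
    using arg_cong[OF A, of at_neg] by (simp add: at_neg_mult)
  have D: "(\<lambda>i j. at_neg (dressed n a (Suc m) i j)) =
     dress n (fps_const (fock_scal (a m))) (\<lambda>i j. fps_const (glop m i j)) (- fps_X) (\<lambda>i j. at_neg (dressed n a m i j))"
    by (intro ext) (simp add: at_neg.hom_dress)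
  have X': "- fps_X = - \<alpha> + - \<alpha>" using X by (metis minus_add_distrib)
  show ?case
    unfolding D unfolding dressed.simps
    using symm_rel_dress[OF c\<alpha> cs gl_rel_glop_fps X A B] 
      symm_rel_dress[OF central_uminus[OF c\<alpha>] cs gl_rel_glop_fps X' B A] Suc.IH
    by simp
qed

text \<open>At u^-1 = 0 every \<open>ev\<close> is the identity. The zeroth coefficient has to be
  checked because it is prescribed in \<open>s_ser\<close> and is not a generator.\<close>

lemma dressed_nth_0: "i \<in> idx n \<Longrightarrow> j \<in> idx n \<Longrightarrow> dressed n a m i j $ 0 = (if i = j then 1 else 0)"
proof (induction m arbitrary: i j)
  case 0
  then show ?case by (simp add: id_mat_def)
next
  case (Suc m)
  interpret z: ring_1_hom "\<lambda>f :: 'a fock_op fps. f $ 0" by (rule ring_1_hom_nth_0)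
  have e: "ev b E (0 :: 'a fock_op) k l = (if k = l then 1 else 0)" for b E k l by (simp add: ev_def)
  have "(\<Sum>k\<in>idx n. (if i = k then 1 else 0) * (dressed n a m k l $ 0)) = (if i = l then 1 else 0)" if "l \<in> idx n" for l
    using that Suc by (simp add: if_distrib[of "\<lambda>x. x * _"] cong: if_cong)
  then show ?case
    using Suc.prems unfolding dressed.simps z.hom_dress
    by (simp add: dress_def imul_def prime_mat_def e sum_delta_mult_left if_distrib[of "\<lambda>x. _ * x"] cong: if_cong)
qed

section \<open>The highest weight of the vacuum\<close>

definition fps_ann :: "(nat set \<Rightarrow> 'k::comm_ring_1) \<Rightarrow> 'k fock_op fps set" where
  "fps_ann u = {F. \<forall>r. app (F $ r) u = (\<lambda>A. 0)}"

lemma left_ideal_fps_ann: "left_ideal (fps_ann u)"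
  unfolding left_ideal_def fps_ann_def
  by (auto simp: app_0 app_add fps_mult_nth app_sum app_mult app_zero)

text \<open>The eigenvalues produced by \<open>hw_mod_dress\<close>, one pair of factors for each
  step.\<close>

primrec hwt :: "(nat \<Rightarrow> 'k::comm_ring_1) \<Rightarrow> (nat \<Rightarrow> int) \<Rightarrow> nat \<Rightarrow> int \<Rightarrow> 'k fps" where
  "hwt a \<kappa> 0 i = 1"
| "hwt a \<kappa> (Suc m) i = (1 - fps_const (a m) * fps_X + fps_X * fps_const (if i \<le> \<kappa> m then 1 else 0)) *
     (1 + fps_const (a m) * fps_X - fps_X * fps_const (if - i \<le> \<kappa> m then 1 else 0)) * hwt a \<kappa> m i"

definition fps_map :: "('a \<Rightarrow> 'b) \<Rightarrow> 'a fps \<Rightarrow> 'b fps" where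
  "fps_map \<phi> f = Abs_fps (\<lambda>r. \<phi> (f $ r))"

lemma fps_map_nth [simp]: "fps_map \<phi> f $ r = \<phi> (f $ r)"
  by (simp add: fps_map_def)

lemma ring_1_hom_fps_map:
  assumes "ring_1_hom \<phi>"
  shows "ring_1_hom (fps_map \<phi>)"
proof -
  interpret ring_1_hom \<phi> by fact
  show ?thesis by standard (auto simp: fps_eq_iff fps_mult_nth homs)
qed

lemma ring_1_hom_fock_scal: "ring_1_hom fock_scal"
  by standard (simp_all add: fock_scal_add fock_scal_mult)

lemma central_fps_map_scal: "central (fps_map fock_scal f)"
  unfolding central_def
proof (intro allI fps_ext)
  fix z :: "'a fock_op fps" and k
  have "(z * fps_map fock_scal f) $ k = (\<Sum>i=0..k. z $ (k - i) * fock_scal (f $ i))"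
    unfolding fps_mult_nth by (rule sum.reindex_bij_witness[of _ "\<lambda>i. k - i" "\<lambda>i. k - i"]) auto
  also have "\<dots> = (fps_map fock_scal f * z) $ k"
    by (simp add: fps_mult_nth centralD[OF central_fock_scal])
  finally show "(z * fps_map fock_scal f) $ k = (fps_map fock_scal f * z) $ k" .
qed

lemma hw_mod_dressed:
  "hw_mod n (fps_ann (vac \<kappa>)) (dressed n a m) (\<lambda>i. fps_map fock_scal (hwt a \<kappa> m i))"
proof (induction m)
  case 0
  have "fps_map fock_scal 1 = (1 :: 'a fock_op fps)"
    using ring_1_hom.hom_1[OF ring_1_hom_fps_map[OF ring_1_hom_fock_scal]] .
  then show ?case by (auto simp: hw_mod_def id_mat_def fps_ann_def app_0)
next
  case (Suc m)
  interpret s: ring_1_hom "fps_map fock_scal :: 'a fps \<Rightarrow> _"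
    by (rule ring_1_hom_fps_map[OF ring_1_hom_fock_scal])
  have X: "fps_map fock_scal fps_X = (fps_X :: 'a fock_op fps)" by (auto simp: fps_eq_iff fps_X_def)
  have c: "fps_map fock_scal (fps_const z) = fps_const (fock_scal z)" for z :: 'a by (auto simp: fps_eq_iff)
  show ?case
    unfolding dressed.simps hwt.simps s.hom_mult s.hom_add s.hom_diff s.hom_1 X c
  proof (rule hw_mod_dress[OF left_ideal_fps_ann _ _ _ _ Suc.IH])
    show "dressed n a m i j * fps_const (glop m k l) = fps_const (glop m k l) * dressed n a m i j" for i j k l
      by (simp add: dressed_commute)
    show "fps_const (glop m i j) \<in> fps_ann (vac \<kappa>)" if "i < j" for i j
      using that by (simp add: fps_ann_def glop_vac_lt app_0)
    show "fps_const (glop m i i) - fps_const (fock_scal (if i \<le> \<kappa> m then 1 else 0)) \<in> fps_ann (vac \<kappa>)" for i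
      using glop_vac_eq[of m i \<kappa>] by (cases "i \<le> \<kappa> m") (auto simp: fps_ann_def app_0)
  qed (auto intro: central_0 central_1 central_fps_X central_fps_const central_fock_scal gl_rel_glop_fps central_fps_map_scal)
qed

text \<open>Vectors supported on configurations that agree with \<open>\<Omega>\<close> outside
  \<open>M\<close>. For finite \<open>M\<close> there are only 2^|M| such configurations, which is
  the source of finite dimension.\<close>

definition finite_support :: "nat set \<Rightarrow> nat set \<Rightarrow> (nat set \<Rightarrow> 'k::comm_ring_1) set" where
  "finite_support M \<Omega> = {u. \<forall>A. A - M \<noteq> \<Omega> - M \<longrightarrow> u A = 0}"

text \<open>Generators with genuine indices move particles only among the modes of the first
  \<open>m\<close> copies; operators preserving the subspace form a subring, so the claim follows
  from the individual \<open>glop\<close>.\<close>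

lemma dressed_support:
  fixes a :: "nat \<Rightarrow> 'k::comm_ring_1"
  assumes "i \<in> idx n" "j \<in> idx n" and u: "u \<in> finite_support {mode \<alpha> i | \<alpha> i. \<alpha> < m \<and> i \<in> idx n} \<Omega>"
  shows "app (dressed n a m i j $ r) u \<in> finite_support {mode \<alpha> i | \<alpha> i. \<alpha> < m \<and> i \<in> idx n} \<Omega>"
proof -
  define M where "M = {mode \<alpha> i | \<alpha> i. \<alpha> < m \<and> i \<in> idx n}"
  define C where "C = {F :: 'k fock_op. \<forall>u\<in>finite_support M \<Omega>. app F u \<in> finite_support M \<Omega>}"
  have C: "subring_set C"
    by (auto simp: subring_set_def C_def app_1 app_diff app_mult) (auto simp: finite_support_def)
  have g: "glop \<alpha> i j \<in> C" if "\<alpha> < m" "i \<in> idx n" "j \<in> idx n" for \<alpha> i j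
  proof -
    have M: "mode \<alpha> i \<in> M" "mode \<alpha> j \<in> M" using that by (auto simp: M_def)
    then have "insert (mode \<alpha> j) (A - {mode \<alpha> i}) - M = A - M" for A by auto
    then show ?thesis by (auto simp: C_def finite_support_def app_glop)
  qed
  have s: "fock_scal c \<in> C" for c
    by (auto simp: C_def finite_support_def app_scal)
  have "m' \<le> m \<Longrightarrow> i \<in> idx n \<Longrightarrow> j \<in> idx n \<Longrightarrow> dressed n a m' i j \<in> fps_over C" for m' i j
  proof (induction m' arbitrary: i j)
    case 0
    then show ?case using subring_set_fps_over[OF C] by (simp add: id_mat_def subring_set_1 subring_set_0)
  next
    case (Suc m')
    show ?case unfolding dressed.simps
      by (rule dress_over[OF subring_set_fps_over[OF C]])
         (use Suc in \<open>auto intro!: fps_over_const[OF C] fps_over_X[OF C] g s\<close>)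
  qed
  then have "dressed n a m i j $ r \<in> C" using assms(1,2) by (simp add: fps_over_def)
  then show ?thesis using u by (simp add: C_def M_def)
qed


section \<open>Evaluating the free algebra\<close>

definition word_value :: "('g \<Rightarrow> 'r::ring_1) \<Rightarrow> 'g word \<Rightarrow> 'r" where
  "word_value \<gamma> w = prod_list (map \<gamma> (letters w))"

definition free_eval :: "('k::ring_1 \<Rightarrow> 'r::ring_1) \<Rightarrow> ('g \<Rightarrow> 'r) \<Rightarrow> ('k, 'g) free_alg \<Rightarrow> 'r" where
  "free_eval \<iota> \<gamma> f = (\<Sum>w\<in>Poly_Mapping.keys f. \<iota> (Poly_Mapping.lookup f w) * word_value \<gamma> w)"

lemma word_value_0: "word_value \<gamma> 0 = 1"
  by (simp add: word_value_def zero_word_def)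

lemma word_value_add: "word_value \<gamma> (v + w) = word_value \<gamma> v * word_value \<gamma> w"
  by (simp add: word_value_def plus_word_def)

lemma sum_singles: "f = (\<Sum>w\<in>Poly_Mapping.keys f. Poly_Mapping.single w (Poly_Mapping.lookup f w))"
proof (rule poly_mapping_eqI)
  fix k
  show "Poly_Mapping.lookup f k = Poly_Mapping.lookup (\<Sum>w\<in>Poly_Mapping.keys f. Poly_Mapping.single w (Poly_Mapping.lookup f w)) k"
    by (simp add: lookup_sum lookup_single when_def not_in_keys_iff_lookup_eq_zero)
qed

text \<open>The universal property of the free algebra; scalars commute with letters, so their
  images must be central.\<close>

locale free_algebra_eval = iota: ring_1_hom \<iota> for \<iota> :: "'k::ring_1 \<Rightarrow> 'r::ring_1" +
  fixes \<gamma> :: "'g \<Rightarrow> 'r"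
  assumes central_iota: "central (\<iota> c)"
begin

lemma free_eval_superset:
  assumes "finite K" "Poly_Mapping.keys f \<subseteq> K"
  shows "free_eval \<iota> \<gamma> f = (\<Sum>w\<in>K. \<iota> (Poly_Mapping.lookup f w) * word_value \<gamma> w)"
  unfolding free_eval_def using assms
  by (intro sum.mono_neutral_left) (auto simp: not_in_keys_iff_lookup_eq_zero iota.hom_0)

lemma free_eval_add: "free_eval \<iota> \<gamma> (f + g) = free_eval \<iota> \<gamma> f + free_eval \<iota> \<gamma> g"
proof -
  let ?K = "Poly_Mapping.keys f \<union> Poly_Mapping.keys g"
  have "free_eval \<iota> \<gamma> (f + g) = (\<Sum>w\<in>?K. \<iota> (Poly_Mapping.lookup (f + g) w) * word_value \<gamma> w)"
    by (rule free_eval_superset) (use keys_add[of f g] in auto)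
  also have "\<dots> = (\<Sum>w\<in>?K. \<iota> (Poly_Mapping.lookup f w) * word_value \<gamma> w) + (\<Sum>w\<in>?K. \<iota> (Poly_Mapping.lookup g w) * word_value \<gamma> w)"
    by (simp add: lookup_add iota.hom_add distrib_right sum.distrib)
  also have "\<dots> = free_eval \<iota> \<gamma> f + free_eval \<iota> \<gamma> g"
    by (simp add: free_eval_superset[of ?K])
  finally show ?thesis .
qed

lemma free_eval_single: "free_eval \<iota> \<gamma> (Poly_Mapping.single w c) = \<iota> c * word_value \<gamma> w"
  by (subst free_eval_superset[of "{w}"]) auto

lemma free_eval_sum: "free_eval \<iota> \<gamma> (\<Sum>i\<in>I. f i) = (\<Sum>i\<in>I. free_eval \<iota> \<gamma> (f i))"
  by (induction I rule: infinite_finite_induct) (simp_all add: free_eval_add, simp_all add: free_eval_def)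

lemma free_eval_mult: "free_eval \<iota> \<gamma> (f * g) = free_eval \<iota> \<gamma> f * free_eval \<iota> \<gamma> g"
proof -
  define s where "s f w = Poly_Mapping.single w (Poly_Mapping.lookup f w)" for f :: "('k, 'g) free_alg" and w
  have e: "\<iota> c * word_value \<gamma> v * (\<iota> d * word_value \<gamma> w) = \<iota> (c * d) * word_value \<gamma> (v + w)" for c d v w
    using centralD[OF central_iota[of d], of "word_value \<gamma> v"]
    by (simp add: iota.hom_mult word_value_add) (metis mult.assoc)
  have "f * g = (\<Sum>v\<in>Poly_Mapping.keys f. s f v) * (\<Sum>w\<in>Poly_Mapping.keys g. s g w)"
    using sum_singles[of f] sum_singles[of g] unfolding s_def by simp
  also have "\<dots> = (\<Sum>v\<in>Poly_Mapping.keys f. \<Sum>w\<in>Poly_Mapping.keys g.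
      Poly_Mapping.single (v + w) (Poly_Mapping.lookup f v * Poly_Mapping.lookup g w))"
    by (simp add: sum_product s_def mult_single)
  finally have fg: "f * g = (\<Sum>v\<in>Poly_Mapping.keys f. \<Sum>w\<in>Poly_Mapping.keys g.
      Poly_Mapping.single (v + w) (Poly_Mapping.lookup f v * Poly_Mapping.lookup g w))" .
  show ?thesis
    unfolding fg free_eval_sum free_eval_single e[symmetric]
    by (simp add: free_eval_def sum_product)
qed

lemma free_eval_1: "free_eval \<iota> \<gamma> 1 = 1"
  using free_eval_single[of 0 1] by (simp add: word_value_0 iota.hom_1)

lemma free_eval_scal: "free_eval \<iota> \<gamma> (scal c) = \<iota> c"
  by (simp add: scal_def free_eval_single word_value_0)

lemma free_eval_letter: "free_eval \<iota> \<gamma> (letter g) = \<gamma> g"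
  by (simp add: letter_def free_eval_single word_value_def iota.hom_1)

lemma ring_1_hom_free_eval: "ring_1_hom (free_eval \<iota> \<gamma>)"
  by standard (fact free_eval_add free_eval_mult free_eval_1)+

lemma free_eval_closed:
  assumes C: "subring_set C" "\<And>c. \<iota> c \<in> C" "\<And>g. g \<in> G \<Longrightarrow> \<gamma> g \<in> C"
    and f: "f \<in> carrier (free_alg_ring G)"
  shows "free_eval \<iota> \<gamma> f \<in> C"
proof -
  have "word_value \<gamma> w \<in> C" if "set (letters w) \<subseteq> G" for w
  proof -
    have "set gs \<subseteq> G \<Longrightarrow> prod_list (map \<gamma> gs) \<in> C" for gs
      by (induction gs) (auto simp: subring_set_1[OF C(1)] subring_set_mult[OF C(1)] C(3))
    then show ?thesis using that by (simp add: word_value_def)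
  qed
  then show ?thesis using f
    unfolding free_eval_def free_alg_ring_def
    by (auto intro!: subring_set_sum[OF C(1)] subring_set_mult[OF C(1)] C(2))
qed

end

lemma subring_set_free_alg: "subring_set (carrier (free_alg_ring G))"
proof -
  let ?C = "carrier (free_alg_ring G)"
  have 1: "1 \<in> ?C" by (auto simp: free_alg_ring_def zero_word_def split: if_splits)
  have 2: "f - g \<in> ?C" if "f \<in> ?C" "g \<in> ?C" for f g
    using that keys_diff[of f g] by (fastforce simp: free_alg_ring_def)
  have 3: "f * g \<in> ?C" if "f \<in> ?C" "g \<in> ?C" for f g
  proof -
    have "set (letters w) \<subseteq> G" if wfg: "w \<in> Poly_Mapping.keys (f * g)" for w
    proof -
      obtain u v where w: "w = u + v" and uv: "u \<in> Poly_Mapping.keys f" "v \<in> Poly_Mapping.keys g"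
        using wfg keys_mult[of f g] by blast
      then have "set (letters u) \<subseteq> G" "set (letters v) \<subseteq> G"
        using \<open>f \<in> ?C\<close> \<open>g \<in> ?C\<close> by (auto simp: free_alg_ring_def)
      then show ?thesis by (simp add: w plus_word_def)
    qed
    then show ?thesis by (simp add: free_alg_ring_def)
  qed
  show ?thesis unfolding subring_set_def using 1 2 3 by blast
qed

lemma scal_in_free_alg: "scal c \<in> carrier (free_alg_ring G)"
  by (auto simp: scal_def free_alg_ring_def zero_word_def split: if_splits)

lemma letter_in_free_alg: "g \<in> G \<Longrightarrow> letter g \<in> carrier (free_alg_ring G)"
  by (auto simp: letter_def free_alg_ring_def split: if_splits)

lemma s_ser_over: "i \<in> idx n \<Longrightarrow> j \<in> idx n \<Longrightarrow> s_ser i j \<in> fps_over (carrier (free_alg_ring (gens n)))"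
  unfolding fps_over_def
proof (intro CollectI allI)
  fix r assume "i \<in> idx n" "j \<in> idx n"
  then have "letter (r, i, j) \<in> carrier (free_alg_ring (gens n))" if "r \<noteq> 0"
    using that by (intro letter_in_free_alg) (simp add: gens_def)
  then show "s_ser i j $ r \<in> carrier (free_alg_ring (gens n))"
    by (cases "r = 0") (auto simp: s_ser_def subring_set_0[OF subring_set_free_alg] subring_set_1[OF subring_set_free_alg])
qed

section \<open>The relations in matrix form\<close>

lemma P_mat_nth:
  assumes "i \<in> idx n" "j \<in> idx n"
  shows "P_mat n (i, k) (j, l) = (if i = l \<and> k = j then 1 else 0 :: 'r::ring_1)"
proof -
  have "P_mat n (i, k) (j, l) = (\<Sum>m\<in>idx n. \<Sum>r\<in>idx n. if m = i then if r = j then if i = l \<and> k = j then 1 else 0 else 0 else 0 :: 'r)"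
    unfolding P_mat_def by (intro sum.cong refl) (auto simp: tens_def E_mat_def)
  then show ?thesis using assms by (simp only: sum_delta2)
qed

lemma P'_mat_nth:
  assumes "i \<in> idx n" "j \<in> idx n"
  shows "P'_mat n (i, k) (j, l) = (if k = - i \<and> l = - j then 1 else 0 :: 'r::ring_1)"
proof -
  have "P'_mat n (i, k) (j, l) = (\<Sum>m\<in>idx n. \<Sum>r\<in>idx n. if m = - j then if r = - i then if k = - i \<and> l = - j then 1 else 0 else 0 else 0 :: 'r)"
    unfolding P'_mat_def by (intro sum.cong refl) (auto simp: tens_def E_mat_def prime_mat_def)
  then show ?thesis using assms by (simp only: sum_delta2 idx_uminus)
qed

lemma supp_R_cleared: "supp_mat n (R_cleared n) = supp_mat n (Rxy (in_u fps_X) (in_v (fps_X :: 'r::ring_1 fps)))"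
  by (rule supp_mat_ext) (simp add: R_cleared_def Rxy_def P_mat_nth tens_def id_mat_def)

lemma supp_R'_cleared: "supp_mat n (R'_cleared n) = supp_mat n (Rxy' (in_u fps_X) (in_v (fps_X :: 'r::ring_1 fps)))"
  by (rule supp_mat_ext) (simp add: R'_cleared_def Rxy'_def P'_mat_nth tens_def id_mat_def)

text \<open>At genuine indices truncation changes nothing, so the defining relation can be read in
  the truncated, right-nested form used for dressing.\<close>

lemma reflection_rel_eq:
  assumes "a \<in> idx n \<times> idx n" "b \<in> idx n \<times> idx n"
  defines "A \<equiv> \<lambda>i j. in_u (s_ser i j :: ('k::ring_1, gen) free_alg fps)" and "B \<equiv> \<lambda>i j. in_v (s_ser i j)"
    and "R \<equiv> Rxy (in_u fps_X) (in_v fps_X)" and "R' \<equiv> Rxy' (in_u fps_X) (in_v fps_X)"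
  shows "reflection_rel n a b =
     mmul n (supp_mat n R) (mmul n (leg1 n A) (mmul n (supp_mat n R') (leg2 n B))) a b -
     mmul n (leg2 n B) (mmul n (supp_mat n R') (mmul n (leg1 n A) (supp_mat n R))) a b"
proof -
  have "reflection_rel n a b = supp_mat n (reflection_rel n) a b"
    using assms(1,2) by (simp add: supp_mat_def)
  also have "\<dots> = supp_mat n (mmul n (mmul n (mmul n (R_cleared n) S1) (R'_cleared n)) S2) a b
     - supp_mat n (mmul n (mmul n (mmul n S2 (R'_cleared n)) S1) (R_cleared n)) a b"
    by (simp add: supp_mat_def reflection_rel_def)
  finally show ?thesis
    unfolding supp_mmul supp_R_cleared supp_R'_cleared mmul_assoc
    unfolding A_def B_def R_def R'_def leg1_def leg2_def S1_def S2_def .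
qed

lemma mmul_over:
  assumes C: "subring_set C" and "\<And>b. b \<in> idx n \<times> idx n \<Longrightarrow> A a b \<in> C" "\<And>b. b \<in> idx n \<times> idx n \<Longrightarrow> B b c \<in> C"
  shows "mmul n A B a c \<in> C"
  unfolding mmul_def using assms by (intro subring_set_sum[OF C] subring_set_mult[OF C]) auto

lemma reflection_rel_over:
  assumes "a \<in> idx n \<times> idx n" "b \<in> idx n \<times> idx n"
  shows "(reflection_rel n a b :: ('k::ring_1, gen) free_alg fps fps) \<in> fps_over (fps_over (carrier (free_alg_ring (gens n))))"
proof -
  define C :: "('k, gen) free_alg set" where "C = carrier (free_alg_ring (gens n))"
  define D where "D = fps_over (fps_over C)"
  have C: "subring_set C" unfolding C_def by (rule subring_set_free_alg)
  have D: "subring_set D" unfolding D_def by (intro subring_set_fps_over C)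
  note cl = subring_set_0[OF D] subring_set_1[OF D] subring_set_diff[OF D] subring_set_add[OF D]
    subring_set_mult[OF D] subring_set_sum[OF D]
  have X: "in_u fps_X \<in> D" "in_v fps_X \<in> D"
    unfolding D_def by (intro in_u_over in_v_over C fps_over_X)+
  have s: "in_u (s_ser i j) \<in> D" "in_v (s_ser i j) \<in> D" if "i \<in> idx n" "j \<in> idx n" for i j
    unfolding D_def using that s_ser_over by (auto intro!: in_u_over in_v_over C simp: C_def subring_set_free_alg)
  have R: "supp_mat n (Rxy (in_u fps_X) (in_v fps_X)) a b \<in> D" "supp_mat n (Rxy' (in_u fps_X) (in_v fps_X)) a b \<in> D" for a b
    unfolding supp_mat_def Rxy_def Rxy'_def
    by (auto simp: cl X split: prod.splits intro!: cl(3-5))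
  have L: "leg1 n (\<lambda>i j. in_u (s_ser i j)) a b \<in> D" "leg2 n (\<lambda>i j. in_v (s_ser i j)) a b \<in> D" for a b
    by (auto simp: leg1_def leg2_def supp_mat_def tens_def id_mat_def cl s)
  have M: "mmul n A B a b \<in> D" if "\<And>a b. A a b \<in> D" "\<And>a b. B a b \<in> D" for A B a b
    using that by (intro mmul_over[OF D])
  have "reflection_rel n a b \<in> D"
    by (subst reflection_rel_eq[OF assms], rule cl(3), (rule M R L)+)
  then show ?thesis unfolding D_def C_def .
qed

lemma symmetry_rel_over:
  assumes "i \<in> idx n" "j \<in> idx n"
  shows "symmetry_rel i j \<in> fps_over (carrier (free_alg_ring (gens n)))"
proof -
  note C = subring_set_free_alg[of "gens n"]
  note D = subring_set_fps_over[OF C]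
  show ?thesis unfolding symmetry_rel_def prime_mat_def
    using assms
    by (intro subring_set_diff[OF D] subring_set_mult[OF D] fps_over_at_neg[OF C] fps_over_const[OF C]
       fps_over_X[OF C] s_ser_over scal_in_free_alg) auto
qed

text \<open>Ideal generation is meaningful only for subsets of the carrier, and the relators are
  built from operations of the surrounding type.\<close>

lemma relators_in_free_alg: "relators n \<subseteq> carrier (free_alg_ring (gens n))"
proof
  fix f :: "('a::field, gen) free_alg" assume "f \<in> relators n"
  then show "f \<in> carrier (free_alg_ring (gens n))" unfolding relators_def
  proof (elim UnE CollectE exE conjE)
    fix a b t r assume "f = reflection_rel n a b $ t $ r" "a \<in> idx n \<times> idx n" "b \<in> idx n \<times> idx n"
    then show ?thesis using reflection_rel_over[of a n b, where ?'k = 'a] unfolding fps_over_def by blast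
  next
    fix i j r assume "f = symmetry_rel i j $ r" "i \<in> idx n" "j \<in> idx n"
    then show ?thesis using symmetry_rel_over[of i n j, where ?'a = 'a] unfolding fps_over_def by blast
  qed
qed

lemma (in ring_1_hom) hom_power: "\<phi> (a ^ k) = \<phi> a ^ k"
  by (induction k) (simp_all add: homs)

lemma (in ring_1_hom) fps_map_at_neg: "fps_map \<phi> (at_neg f) = at_neg (fps_map \<phi> f)"
  by (rule fps_ext) (simp add: hom_mult hom_power hom_uminus hom_1)

text \<open>Applying \<open>\<phi>\<close> to all coefficients of a series in two variables is again
  a ring homomorphism, so it carries the relations for the generating matrix to the relations for
  \<open>S\<close>.\<close>

theorem relators_vanish:
  fixes \<phi> :: "('k::field, gen) free_alg \<Rightarrow> 'r::ring_1"
  assumes hom: "ring_1_hom \<phi>"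
    and S: "\<And>i j. i \<in> idx n \<Longrightarrow> j \<in> idx n \<Longrightarrow> fps_map \<phi> (s_ser i j) = S i j"
    and RE: "refl_eq n (in_u fps_X) (in_v fps_X) (\<lambda>i j. in_u (S i j)) (\<lambda>i j. in_v (S i j))"
    and sym: "symm_rel n (fps_const (\<phi> (scal (1 / 2))) * fps_X) S (\<lambda>i j. at_neg (S i j))"
    and f: "f \<in> relators n"
  shows "\<phi> f = 0"
proof -
  interpret f0: ring_1_hom \<phi> by fact
  interpret f1: ring_1_hom "fps_map \<phi>" by (rule ring_1_hom_fps_map[OF hom])
  interpret f2: ring_1_hom "fps_map (fps_map \<phi>)" by (rule ring_1_hom_fps_map[OF f1.ring_1_hom_axioms])
  have X: "fps_map \<phi> fps_X = fps_X" by (rule fps_ext) (simp add: fps_X_def f0.homs)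
  have uv: "fps_map (fps_map \<phi>) (in_u z) = in_u (fps_map \<phi> z)" "fps_map (fps_map \<phi>) (in_v z) = in_v (fps_map \<phi> z)" for z
    by (rule fps_ext, simp add: in_u_def in_v_def f0.homs f1.homs fps_eq_iff)+
  have L: "leg1 n (\<lambda>i j. in_u (fps_map \<phi> (s_ser i j))) = leg1 n (\<lambda>i j. in_u (S i j))"
     "leg2 n (\<lambda>i j. in_v (fps_map \<phi> (s_ser i j))) = leg2 n (\<lambda>i j. in_v (S i j))"
    unfolding leg1_def leg2_def by (rule supp_mat_ext; simp add: tens_def S)+
  have r: "fps_map (fps_map \<phi>) (reflection_rel n a b) = 0" if "a \<in> idx n \<times> idx n" "b \<in> idx n \<times> idx n" for a b
    using RE unfolding reflection_rel_eq[OF that] f2.hom_diff f2.hom_mats uv X L refl_eq_def by simp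
  have s: "fps_map \<phi> (symmetry_rel i j) = 0" if "i \<in> idx n" "j \<in> idx n" for i j
  proof -
    have c: "fps_map \<phi> (fps_const (scal (1 / 2))) = fps_const (\<phi> (scal (1 / 2)))"
      by (rule fps_ext) (simp add: f0.homs)
    show ?thesis using sym that
      unfolding symm_rel_def symmetry_rel_def prime_mat_def f1.homs f0.fps_map_at_neg X c by (simp add: S)
  qed
  show ?thesis using f unfolding relators_def
  proof (elim UnE CollectE exE conjE)
    fix a b t r' assume "f = reflection_rel n a b $ t $ r'" "a \<in> idx n \<times> idx n" "b \<in> idx n \<times> idx n"
    then show "\<phi> f = 0" using arg_cong[OF r[of a b], of "\<lambda>z. z $ t $ r'"] by simp
  next
    fix i j r' assume "f = symmetry_rel i j $ r'" "i \<in> idx n" "j \<in> idx n"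
    then show "\<phi> f = 0" using arg_cong[OF s[of i j], of "\<lambda>z. z $ r'"] by simp
  qed
qed


section \<open>Quotients of left modules\<close>

lemma left_module_regular:
  assumes "ring R"
  shows "left_module R (regular_module R)"
proof -
  interpret ring R by fact
  have "abelian_group (regular_module R)"
    by (rule abelian_groupI) (auto simp: regular_module_def add.m_ac intro: bexI[of _ "\<ominus>\<^bsub>R\<^esub> _"] l_neg)
  then show ?thesis
    by (intro left_module.intro left_module_axioms.intro \<open>ring R\<close>)
       (simp_all add: regular_module_def l_distr r_distr m_assoc)
qed

locale submodule_of_left_module = left_module R M for R :: "'r ring" (structure) and M :: "('r, 'm) module" (structure) and N +
  assumes sub: "submodule N R M"
begin

sublocale abelian_subgroup N M
  by (intro abelian_subgroupI3 additive_subgroup.intro submodule.axioms(1)[OF sub] M.abelian_group_axioms)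

definition proj where "proj x = N +>\<^bsub>M\<^esub> x"

abbreviation Q where "Q \<equiv> quot_module M N"

lemma carrier_Q: "carrier Q = proj ` carrier M"
  by (auto simp: quot_module_def A_RCOSETS_def' proj_def)

lemma zero_Q: "\<zero>\<^bsub>Q\<^esub> = N"
  by (simp add: quot_module_def)

lemma proj_eq_iff: "x \<in> carrier M \<Longrightarrow> y \<in> carrier M \<Longrightarrow> proj x = proj y \<longleftrightarrow> x \<ominus>\<^bsub>M\<^esub> y \<in> N"
  unfolding proj_def M.minus_eq
  by (metis a_rcos_module a_repr_independence' a_rcos_self)

lemma proj_zero_iff: "x \<in> carrier M \<Longrightarrow> proj x = \<zero>\<^bsub>Q\<^esub> \<longleftrightarrow> x \<in> N"
  unfolding proj_def zero_Q by (metis a_rcos_const a_rcos_self)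

lemma proj_0: "proj \<zero>\<^bsub>M\<^esub> = \<zero>\<^bsub>Q\<^esub>"
  by (simp add: proj_zero_iff)

lemma proj_add: "x \<in> carrier M \<Longrightarrow> y \<in> carrier M \<Longrightarrow> proj x \<oplus>\<^bsub>Q\<^esub> proj y = proj (x \<oplus>\<^bsub>M\<^esub> y)"
  unfolding proj_def quot_module_def by (simp add: a_rcos_sum)

lemma proj_smult:
  assumes "a \<in> carrier R" "x \<in> carrier M"
  shows "a \<odot>\<^bsub>Q\<^esub> proj x = proj (a \<odot>\<^bsub>M\<^esub> x)"
proof -
  \<comment> \<open>The action on a coset is a union over its representatives; it is a single coset
    because \<open>N\<close> absorbs the action on the difference of two representatives.\<close>
  have const: "N +>\<^bsub>M\<^esub> (a \<odot>\<^bsub>M\<^esub> z) = N +>\<^bsub>M\<^esub> (a \<odot>\<^bsub>M\<^esub> x)" if z: "z \<in> N +>\<^bsub>M\<^esub> x" for z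
  proof -
    obtain h where h: "h \<in> N" "z = h \<oplus>\<^bsub>M\<^esub> x" using z by (auto simp: a_r_coset_def')
    have ah: "a \<odot>\<^bsub>M\<^esub> h \<in> N" using submodule.smult_closed[OF sub] assms h by blast
    have "a \<odot>\<^bsub>M\<^esub> z = a \<odot>\<^bsub>M\<^esub> h \<oplus>\<^bsub>M\<^esub> a \<odot>\<^bsub>M\<^esub> x"
      using h assms by (simp add: smult_r_distr)
    then have "a \<odot>\<^bsub>M\<^esub> z \<in> N +>\<^bsub>M\<^esub> (a \<odot>\<^bsub>M\<^esub> x)" using ah by (auto simp: a_r_coset_def')
    then show ?thesis using a_repr_independence' assms smult_closed by metis
  qed
  have ne: "N +>\<^bsub>M\<^esub> x \<noteq> {}" using a_rcos_self assms by blast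
  have "a \<odot>\<^bsub>Q\<^esub> proj x = (\<Union>z\<in>N +>\<^bsub>M\<^esub> x. N +>\<^bsub>M\<^esub> (a \<odot>\<^bsub>M\<^esub> z))"
    by (simp add: quot_module_def proj_def)
  also have "\<dots> = (\<Union>z\<in>N +>\<^bsub>M\<^esub> x. N +>\<^bsub>M\<^esub> (a \<odot>\<^bsub>M\<^esub> x))"
    by (rule SUP_cong[OF refl const])
  also have "\<dots> = proj (a \<odot>\<^bsub>M\<^esub> x)"
    unfolding proj_def UN_constant using ne by (rule if_not_P)
  finally show ?thesis .
qed

lemma left_module_Q: "left_module R Q"
proof -
  have neg: "\<exists>y\<in>carrier Q. y \<oplus>\<^bsub>Q\<^esub> proj x = \<zero>\<^bsub>Q\<^esub>" if "x \<in> carrier M" for x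
    using that by (intro bexI[of _ "proj (\<ominus>\<^bsub>M\<^esub> x)"]) (simp_all add: carrier_Q proj_add M.l_neg flip: proj_0)
  have "abelian_group Q"
    by (rule abelian_groupI)
       (use neg in \<open>auto simp: carrier_Q proj_add M.add.m_ac simp flip: proj_0\<close>)
  then show ?thesis
    by (intro left_module.intro left_module_axioms.intro R.ring_axioms)
       (auto simp: carrier_Q proj_add proj_smult smult_closed smult_l_distr smult_r_distr smult_assoc smult_one)
qed

end

section \<open>Submodules and simple quotients of cyclic modules\<close>

lemma (in left_module) submodule_left_moduleI:
  assumes "H \<subseteq> carrier M" "\<zero>\<^bsub>M\<^esub> \<in> H" "\<And>x y. x \<in> H \<Longrightarrow> y \<in> H \<Longrightarrow> x \<oplus>\<^bsub>M\<^esub> y \<in> H"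
    and "\<And>a x. a \<in> carrier R \<Longrightarrow> x \<in> H \<Longrightarrow> a \<odot>\<^bsub>M\<^esub> x \<in> H"
  shows "submodule H R M"
proof -
  \<comment> \<open>Negation is the action of -1, so it needs no hypothesis of its own.\<close>
  have "\<ominus>\<^bsub>M\<^esub> x \<in> H" if "x \<in> H" for x
  proof -
    have x: "x \<in> carrier M" using that assms(1) by blast
    have z: "\<zero> \<odot>\<^bsub>M\<^esub> x = \<zero>\<^bsub>M\<^esub>"
      using smult_l_distr[of \<zero> \<zero> x] x smult_closed[of \<zero> x] by (simp add: M.add.l_cancel_one')
    have "(\<ominus> \<one>) \<odot>\<^bsub>M\<^esub> x \<oplus>\<^bsub>M\<^esub> x = (\<ominus> \<one> \<oplus> \<one>) \<odot>\<^bsub>M\<^esub> x"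
      using x by (subst smult_l_distr) (simp_all add: smult_one)
    also have "\<dots> = \<zero>\<^bsub>M\<^esub>" by (simp add: R.l_neg z)
    finally have "\<ominus>\<^bsub>M\<^esub> x = (\<ominus> \<one>) \<odot>\<^bsub>M\<^esub> x"
      using x smult_closed[of "\<ominus> \<one>" x] by (simp add: M.minus_equality)
    then show ?thesis using assms(4) that by simp
  qed
  then show ?thesis using assms
    by (intro submodule.intro submodule_axioms.intro M.add.subgroupI) (auto simp: a_inv_def)
qed

lemma submodule_zero: "submodule H R M \<Longrightarrow> \<zero>\<^bsub>M\<^esub> \<in> H"
  using subgroup.one_closed[OF submodule.axioms(1)] by fastforce

lemma submodule_add: "submodule H R M \<Longrightarrow> x \<in> H \<Longrightarrow> y \<in> H \<Longrightarrow> x \<oplus>\<^bsub>M\<^esub> y \<in> H"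
  using subgroup.m_closed[OF submodule.axioms(1)] by fastforce

lemma submodule_subset: "submodule H R M \<Longrightarrow> H \<subseteq> carrier M"
  using subgroup.subset[OF submodule.axioms(1)] by fastforce

lemma submodule_gen_submodule:
  fixes R :: "'r ring" and M :: "('r, 'm) module"
  assumes "left_module R M" "X \<subseteq> carrier M"
  shows "submodule (gen_submodule R M X) R M"
proof -
  interpret left_module R M by fact
  show ?thesis
proof (rule submodule_left_moduleI)
  have top: "submodule (carrier M) R M"
    by (rule submodule_left_moduleI) (simp_all add: smult_closed)
  show "gen_submodule R M X \<subseteq> carrier M"
    unfolding gen_submodule_def using top assms(2) by blast
qed (auto simp: gen_submodule_def submodule.smult_closed
    dest: submodule_zero submodule_add)
qed

lemma gen_submodule_least: "submodule H R M \<Longrightarrow> X \<subseteq> H \<Longrightarrow> gen_submodule R M X \<subseteq> H"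
  unfolding gen_submodule_def by blast

text \<open>Since \<open>e\<close> generates, a submodule is proper exactly when it omits
  \<open>e\<close>, a property that survives unions of chains. Zorn's lemma above \<open>N0\<close>
  gives a maximal proper submodule that still contains everything to be killed.\<close>

lemma exists_simple_quotient:
  fixes R :: "'r ring" and M :: "('r, 'm) module"
  assumes M: "left_module R M" and e: "e \<in> carrier M"
    and gen: "\<And>x. x \<in> carrier M \<Longrightarrow> \<exists>a\<in>carrier R. x = a \<odot>\<^bsub>M\<^esub> e"
    and N0: "submodule N0 R M" "e \<notin> N0"
  shows "\<exists>N. submodule N R M \<and> N0 \<subseteq> N \<and> e \<notin> N \<and> irreducible_module R (quot_module M N)"
proof -
  interpret left_module R M by fact
  define \<A> where "\<A> = {N. submodule N R M \<and> N0 \<subseteq> N \<and> e \<notin> N}"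
  have "\<exists>N\<in>\<A>. \<forall>X\<in>\<A>. N \<subseteq> X \<longrightarrow> X = N"
  proof (rule subset_Zorn_nonempty)
    show "\<A> \<noteq> {}" using N0 by (auto simp: \<A>_def)
    fix \<C> assume ne: "\<C> \<noteq> {}" and chain: "subset.chain \<A> \<C>"
    have sub: "submodule N R M" "N0 \<subseteq> N" "e \<notin> N" if "N \<in> \<C>" for N
      using chain that by (auto simp: subset.chain_def \<A>_def)
    have add: "\<exists>N\<in>\<C>. x \<oplus>\<^bsub>M\<^esub> y \<in> N" if xy: "x \<in> N" "N \<in> \<C>" "y \<in> N'" "N' \<in> \<C>" for x y N N'
    proof -
      have "N \<subseteq> N' \<or> N' \<subseteq> N" using chain that by (auto simp: subset.chain_def)
      then show ?thesis using xy submodule_add[OF sub(1)] by blast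
    qed
    have "submodule (\<Union>\<C>) R M"
    proof (rule submodule_left_moduleI)
      show "\<Union>\<C> \<subseteq> carrier M" using submodule_subset[OF sub(1)] by blast
      show "\<zero>\<^bsub>M\<^esub> \<in> \<Union>\<C>" using ne submodule_zero[OF sub(1)] by blast
      show "x \<oplus>\<^bsub>M\<^esub> y \<in> \<Union>\<C>" if "x \<in> \<Union>\<C>" "y \<in> \<Union>\<C>" for x y
        using that add by blast
      show "a \<odot>\<^bsub>M\<^esub> x \<in> \<Union>\<C>" if "a \<in> carrier R" "x \<in> \<Union>\<C>" for a x
        using that submodule.smult_closed[OF sub(1)] by blast
    qed
    then show "\<Union>\<C> \<in> \<A>" using ne sub unfolding \<A>_def by blast
  qed
  then obtain N where NA: "N \<in> \<A>" and NX: "\<forall>X\<in>\<A>. N \<subseteq> X \<longrightarrow> X = N" by (rule bexE)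
  have N: "submodule N R M" "N0 \<subseteq> N" "e \<notin> N" using NA by (auto simp: \<A>_def)
  have max: "X = N" if "submodule X R M" "N \<subseteq> X" "e \<notin> X" for X
    using NX that N(2) by (auto simp: \<A>_def)
  interpret N: submodule_of_left_module R M N
    by (intro submodule_of_left_module.intro submodule_of_left_module_axioms.intro M N(1))
  have "irreducible_module R N.Q"
    unfolding irreducible_module_def
  proof (intro conjI allI impI)
    show "carrier N.Q \<noteq> {\<zero>\<^bsub>N.Q\<^esub>}" 
      using N.proj_zero_iff[OF e] N(3) e by (auto simp: N.carrier_Q)
    fix H assume H: "submodule H R N.Q"
    \<comment> \<open>The preimage of \<open>H\<close> lies above \<open>N\<close>, so by maximality
      it contains \<open>e\<close> or equals \<open>N\<close>.\<close>
    define X where "X = {x \<in> carrier M. N.proj x \<in> H}"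
    have X: "submodule X R M"
    proof (rule submodule_left_moduleI)
      show "\<zero>\<^bsub>M\<^esub> \<in> X" using submodule_zero[OF H] by (simp add: X_def N.proj_0)
      show "x \<oplus>\<^bsub>M\<^esub> y \<in> X" if "x \<in> X" "y \<in> X" for x y
        using that submodule_add[OF H] by (simp add: X_def flip: N.proj_add)
      show "a \<odot>\<^bsub>M\<^esub> x \<in> X" if "a \<in> carrier R" "x \<in> X" for a x
        using that submodule.smult_closed[OF H] by (simp add: X_def smult_closed flip: N.proj_smult)
    qed (auto simp: X_def)
    have NX: "N \<subseteq> X"
    proof
      fix x assume x: "x \<in> N"
      then have "x \<in> carrier M" using submodule_subset[OF N(1)] by blast
      moreover from this have "N.proj x = \<zero>\<^bsub>N.Q\<^esub>" using x by (simp only: N.proj_zero_iff)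
      ultimately show "x \<in> X" using submodule_zero[OF H] by (simp only: X_def mem_Collect_eq)
    qed
    have HX: "H = N.proj ` X"
      using submodule_subset[OF H] by (auto simp: X_def N.carrier_Q)
    show "H = {\<zero>\<^bsub>N.Q\<^esub>} \<or> H = carrier N.Q"
    proof (cases "e \<in> X")
      case True
      have "carrier M \<subseteq> X"
      proof
        fix x assume "x \<in> carrier M"
        then obtain a where "a \<in> carrier R" "x = a \<odot>\<^bsub>M\<^esub> e" using gen by blast
        then show "x \<in> X" using submodule.smult_closed[OF X] True by blast
      qed
      then show ?thesis using HX submodule_subset[OF X] by (auto simp: N.carrier_Q)
    next
      case False
      then have "X = N" using max X NX by blast
      then have "H \<subseteq> {\<zero>\<^bsub>N.Q\<^esub>}" using HX N.proj_zero_iff submodule_subset[OF N(1)] by (metis image_subsetI insertI1 subsetD)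
      then show ?thesis using submodule_zero[OF H] by blast
    qed
  qed
  with N show ?thesis by blast
qed

section \<open>The twisted Yangian as a quotient of the free algebra\<close>

lemma ring_free_alg: "ring (free_alg_ring G :: ('k::ring_1, 'g) free_alg ring)"
proof -
  note C = subring_set_free_alg[of G]
  have s: "mult (free_alg_ring G) = (*)" "one (free_alg_ring G) = 1" "zero (free_alg_ring G) = 0" "add (free_alg_ring G) = (+)"
    by (simp_all add: free_alg_ring_def)
  have "\<exists>y\<in>carrier (free_alg_ring G). y + x = 0" if "x \<in> carrier (free_alg_ring G)" for x :: "('k, 'g) free_alg"
    using subring_set_uminus[OF C that] by (intro bexI[of _ "- x"]) simp_all
  then show ?thesis
    by (intro ringI abelian_groupI monoidI)
       (simp_all add: s subring_set_0[OF C] subring_set_1[OF C] subring_set_add[OF C] subring_set_mult[OF C] algebra_simps)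
qed

lemma free_alg_ring_simps:
  "mult (free_alg_ring G) = (*)" "one (free_alg_ring G) = 1" "zero (free_alg_ring G) = 0"
  "add (free_alg_ring G) = (+)"
  by (simp_all add: free_alg_ring_def)

lemma a_inv_free_alg: "f \<in> carrier (free_alg_ring G) \<Longrightarrow> \<ominus>\<^bsub>free_alg_ring G\<^esub> f = - (f :: ('k::ring_1, 'g) free_alg)"
proof -
  assume f: "f \<in> carrier (free_alg_ring G)"
  interpret ring "free_alg_ring G :: ('k, 'g) free_alg ring" by (rule ring_free_alg)
  show ?thesis
    using f subring_set_uminus[OF subring_set_free_alg f]
    by (intro minus_equality) (simp_all add: free_alg_ring_simps)
qed

lemma ideal_rel_ideal: "ideal (rel_ideal n) (free_alg_ring (gens n))"
  unfolding rel_ideal_def by (rule ring.genideal_ideal[OF ring_free_alg relators_in_free_alg])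

text \<open>Inside the carrier the kernel of a homomorphism is a two-sided ideal, and this one
  contains the relators.\<close>

lemma rel_ideal_vanish:
  assumes hom: "ring_1_hom \<phi>" and rel: "\<And>f. f \<in> relators n \<Longrightarrow> \<phi> f = 0" and f: "f \<in> rel_ideal n"
  shows "\<phi> f = 0"
proof -
  interpret \<phi>: ring_1_hom \<phi> by fact
  let ?F = "free_alg_ring (gens n) :: ('a, gen) free_alg ring"
  interpret ring ?F by (rule ring_free_alg)
  define K where "K = {f \<in> carrier ?F. \<phi> f = 0}"
  note C = subring_set_free_alg[of "gens n"]
  have "ideal K ?F"
  proof (rule idealI[OF ring_free_alg])
    show "subgroup K (add_monoid ?F)"
    proof (rule add.subgroupI)
      show "K \<noteq> {}" using \<phi>.hom_0 subring_set_0[OF C] by (auto simp: K_def)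
      fix a assume "a \<in> K"
      then show "\<ominus>\<^bsub>?F\<^esub> a \<in> K"
        using a_inv_free_alg[of a "gens n"] subring_set_uminus[OF C]
        by (auto simp: K_def \<phi>.homs)
    qed (auto simp: K_def free_alg_ring_simps \<phi>.homs subring_set_add[OF C])
  qed (auto simp: K_def free_alg_ring_simps \<phi>.homs subring_set_mult[OF C])
  then have "rel_ideal n \<subseteq> K"
    unfolding rel_ideal_def using relators_in_free_alg rel
    by (intro genideal_minimal) (auto simp: K_def)
  then show ?thesis using f by (auto simp: K_def)
qed

abbreviation FA :: "nat \<Rightarrow> ('k::field, gen) free_alg set" where
  "FA n \<equiv> carrier (free_alg_ring (gens n))"

lemma ring_twisted_Yangian: "ring (twisted_Yangian n)"
  unfolding twisted_Yangian_def by (rule ideal.quotient_is_ring[OF ideal_rel_ideal])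

lemma carrier_twisted_Yangian: "carrier (twisted_Yangian n) = yclass n ` FA n"
  by (auto simp: twisted_Yangian_def FactRing_def A_RCOSETS_def' yclass_def)

lemma yclass_closed: "f \<in> FA n \<Longrightarrow> yclass n f \<in> carrier (twisted_Yangian n)"
  by (simp add: carrier_twisted_Yangian)

lemma yclass_add: "f \<in> FA n \<Longrightarrow> g \<in> FA n \<Longrightarrow> yclass n f \<oplus>\<^bsub>twisted_Yangian n\<^esub> yclass n g = yclass n (f + g)"
  using ring_hom_add[OF ideal.rcos_ring_hom[OF ideal_rel_ideal], of f n g]
  by (simp add: twisted_Yangian_def yclass_def free_alg_ring_simps)

lemma yclass_mult: "f \<in> FA n \<Longrightarrow> g \<in> FA n \<Longrightarrow> yclass n f \<otimes>\<^bsub>twisted_Yangian n\<^esub> yclass n g = yclass n (f * g)"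
  using ring_hom_mult[OF ideal.rcos_ring_hom[OF ideal_rel_ideal], of f n g]
  by (simp add: twisted_Yangian_def yclass_def free_alg_ring_simps)

lemma yclass_1: "yclass n 1 = \<one>\<^bsub>twisted_Yangian n\<^esub>"
  using ring_hom_one[OF ideal.rcos_ring_hom[OF ideal_rel_ideal], of n]
  by (simp add: twisted_Yangian_def yclass_def free_alg_ring_simps)

lemma yclass_0: "yclass n 0 = \<zero>\<^bsub>twisted_Yangian n\<^esub>"
proof -
  interpret ideal "rel_ideal n" "free_alg_ring (gens n)" by (rule ideal_rel_ideal)
  have "rel_ideal n +>\<^bsub>free_alg_ring (gens n)\<^esub> \<zero>\<^bsub>free_alg_ring (gens n)\<^esub> = rel_ideal n"
    by (rule a_rcos_const) simp
  then show ?thesis by (simp add: yclass_def twisted_Yangian_def FactRing_def free_alg_ring_simps)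
qed

lemma yclass_eqD:
  assumes "f \<in> FA n" "g \<in> FA n" "yclass n f = yclass n g"
  shows "f - g \<in> rel_ideal n"
proof -
  interpret ideal "rel_ideal n" "free_alg_ring (gens n)" by (rule ideal_rel_ideal)
  have "f \<in> rel_ideal n +>\<^bsub>free_alg_ring (gens n)\<^esub> g"
    using assms a_rcos_self[of f] by (simp add: yclass_def)
  then have "f \<oplus>\<^bsub>free_alg_ring (gens n)\<^esub> \<ominus>\<^bsub>free_alg_ring (gens n)\<^esub> g \<in> rel_ideal n"
    using assms by (intro a_rcos_module_imp)
  then show ?thesis using assms by (simp add: a_inv_free_alg free_alg_ring_simps)
qed


lemma s_ser_in_FA: "i \<in> idx n \<Longrightarrow> j \<in> idx n \<Longrightarrow> s_ser i j $ r \<in> FA n"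
  by (rule s_ser_over[unfolded fps_over_def, THEN CollectD, rule_format])

lemma FA_closed:
  "0 \<in> FA n" "1 \<in> FA n" "scal c \<in> FA n"
  "f \<in> FA n \<Longrightarrow> g \<in> FA n \<Longrightarrow> f + g \<in> FA n"
  "f \<in> FA n \<Longrightarrow> g \<in> FA n \<Longrightarrow> f - g \<in> FA n"
  "f \<in> FA n \<Longrightarrow> g \<in> FA n \<Longrightarrow> f * g \<in> FA n"
  by (simp_all add: subring_set_free_alg subring_set_0 subring_set_1 subring_set_add subring_set_diff
      subring_set_mult scal_in_free_alg)

lemma scal_add: "scal (c + d) = scal c + scal d"
  by (simp add: scal_def single_add)

lemma scal_0: "scal 0 = 0"
  by (simp add: scal_def)

lemma idx_pos: "i \<in> {1..n} \<Longrightarrow> int i \<in> idx n"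
  by (auto simp: idx_def)

section \<open>From operators to finite-dimensional highest weight modules\<close>

lemma (in left_module) smult_0_left: "x \<in> carrier M \<Longrightarrow> \<zero> \<odot>\<^bsub>M\<^esub> x = \<zero>\<^bsub>M\<^esub>"
  using smult_l_distr[of \<zero> \<zero> x] smult_closed[of \<zero> x] by (simp add: M.add.l_cancel_one')

text \<open>\<open>finite_dimensional\<close> attaches coefficients to vectors, whereas
  \<open>I\<close> consists of algebra elements, some of which \<open>q\<close> may identify. The
  coefficients of coinciding images have to be added, hence the induction over subsets of
  \<open>I\<close>.\<close>

lemma finite_dimensionalI:
  fixes q :: "('k::field, gen) free_alg \<Rightarrow> 'm" and V :: "('k yelt, 'm) module"
  assumes V: "left_module (twisted_Yangian n) V"
    and surj: "carrier V = q ` FA n"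
    and q_add: "\<And>f g. f \<in> FA n \<Longrightarrow> g \<in> FA n \<Longrightarrow> q f \<oplus>\<^bsub>V\<^esub> q g = q (f + g)"
    and q_mult: "\<And>f g. f \<in> FA n \<Longrightarrow> g \<in> FA n \<Longrightarrow> yclass n f \<odot>\<^bsub>V\<^esub> q g = q (f * g)"
    and I: "finite I" "I \<subseteq> FA n"
    and span: "\<And>f. f \<in> FA n \<Longrightarrow> \<exists>c. q f = q (\<Sum>g\<in>I. scal (c g) * g)"
  shows "finite_dimensional n V"
proof -
  interpret left_module "twisted_Yangian n" V by fact
  define B where "B = q ` I"
  have B: "finite B" "B \<subseteq> carrier V" using I surj by (auto simp: B_def)
  define comb where "comb c = (\<Oplus>\<^bsub>V\<^esub>b\<in>B. yscal n (c b) \<odot>\<^bsub>V\<^esub> b)" for c :: "'m \<Rightarrow> 'k"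
  have ys: "yscal n c \<in> carrier (twisted_Yangian n)" for c
    by (simp add: yscal_def yclass_closed FA_closed)
  have sm: "yscal n c \<odot>\<^bsub>V\<^esub> b \<in> carrier V" if "b \<in> B" for b c
    using that B ys smult_closed by blast
  have comb_add: "comb (\<lambda>b. c b + d b) = comb c \<oplus>\<^bsub>V\<^esub> comb d" for c d
  proof -
    have "yscal n (x + y) \<odot>\<^bsub>V\<^esub> b = yscal n x \<odot>\<^bsub>V\<^esub> b \<oplus>\<^bsub>V\<^esub> yscal n y \<odot>\<^bsub>V\<^esub> b" if "b \<in> B" for x y b
    proof -
      have "yscal n (x + y) = yscal n x \<oplus>\<^bsub>twisted_Yangian n\<^esub> yscal n y"
        by (simp add: yscal_def scal_add yclass_add FA_closed)
      then show ?thesis using smult_l_distr[OF ys ys] that B by auto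
    qed
    then have "comb (\<lambda>b. c b + d b) = (\<Oplus>\<^bsub>V\<^esub>b\<in>B. yscal n (c b) \<odot>\<^bsub>V\<^esub> b \<oplus>\<^bsub>V\<^esub> yscal n (d b) \<odot>\<^bsub>V\<^esub> b)"
      unfolding comb_def by (intro M.finsum_cong') (auto simp: sm)
    then show ?thesis unfolding comb_def using sm by (simp add: M.finsum_addf Pi_def)
  qed
  have y0: "yscal n 0 \<odot>\<^bsub>V\<^esub> b = \<zero>\<^bsub>V\<^esub>" if "b \<in> B" for b
    using that B smult_0_left[of b] by (auto simp: yscal_def scal_0 yclass_0)
  have comb_0: "comb (\<lambda>_. 0) = \<zero>\<^bsub>V\<^esub>"
    unfolding comb_def using M.finsum_cong'[of B B "\<lambda>_. \<zero>\<^bsub>V\<^esub>" "\<lambda>b. yscal n 0 \<odot>\<^bsub>V\<^esub> b"] y0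
    by (simp add: M.finsum_zero)
  have comb_single: "comb (\<lambda>b'. if b = b' then c else 0) = yscal n c \<odot>\<^bsub>V\<^esub> b" if "b \<in> B" for b c
  proof -
    have "comb (\<lambda>b'. if b = b' then c else 0) = (\<Oplus>\<^bsub>V\<^esub>b'\<in>B. if b = b' then yscal n c \<odot>\<^bsub>V\<^esub> b' else \<zero>\<^bsub>V\<^esub>)"
      unfolding comb_def by (intro M.finsum_cong') (auto simp: sm y0)
    also have "\<dots> = yscal n c \<odot>\<^bsub>V\<^esub> b"
      using that B sm by (intro M.finsum_singleton) auto
    finally show ?thesis .
  qed
  have q0: "q 0 = \<zero>\<^bsub>V\<^esub>"
    using q_add[of 0 0] surj FA_closed(1) by (metis M.add.r_cancel_one' add_0 image_eqI)
  have "\<exists>c'. q (\<Sum>g\<in>I'. scal (c g) * g) = comb c'" if "I' \<subseteq> I" for I' c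
    using finite_subset[OF that I(1)] that
  proof (induction I' rule: finite_induct)
    case empty
    show ?case by (rule exI[of _ "\<lambda>_. 0"]) (simp only: sum.empty q0 comb_0)
  next
    case (insert g I')
    then obtain c' where c': "q (\<Sum>g\<in>I'. scal (c g) * g) = comb c'" by auto
    have g: "g \<in> FA n" "q g \<in> B" using insert.prems I by (auto simp: B_def)
    have "(\<Sum>g\<in>I'. scal (c g) * g) \<in> FA n"
      using insert.prems I by (intro subring_set_sum[OF subring_set_free_alg] FA_closed) auto
    then have "q (\<Sum>g\<in>insert g I'. scal (c g) * g) = q (scal (c g) * g) \<oplus>\<^bsub>V\<^esub> comb c'"
      using insert.hyps g by (simp add: FA_closed c' flip: q_add)
    also have "q (scal (c g) * g) = comb (\<lambda>b'. if q g = b' then c g else 0)"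
      using g by (simp add: comb_single yscal_def q_mult FA_closed)
    finally show ?case unfolding comb_add[symmetric] by blast
  qed
  then have "\<exists>c'. v = comb c'" if "v \<in> carrier V" for v
    proof -
    obtain f c where "f \<in> FA n" "v = q f" "q f = q (\<Sum>g\<in>I. scal (c g) * g)"
      using \<open>v \<in> carrier V\<close> span unfolding surj by blast
    then show ?thesis using \<open>\<And>I' c. I' \<subseteq> I \<Longrightarrow> \<exists>c'. q (\<Sum>g\<in>I'. scal (c g) * g) = comb c'\<close>[of I c] by simp
  qed
  then show ?thesis
    unfolding finite_dimensional_def using B unfolding comb_def by blast
qed

text \<open>\<open>J\<close> is to be the annihilator of a highest vector. The module that this
  vector generates is never built: its kernel \<open>JY\<close> in the regular module contains the
  Verma relators, and any quotient of the Verma module by a submodule above the image of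
  \<open>JY\<close> inherits the finite spanning set.\<close>

theorem highest_weight_module:
  fixes \<phi> :: "('k::field, gen) free_alg \<Rightarrow> 'r::ring_1" and \<mu> :: "nat \<Rightarrow> 'k fps"
  assumes hom: "ring_1_hom \<phi>" and rel: "\<And>f. f \<in> relators n \<Longrightarrow> \<phi> f = 0"
    and J: "left_ideal J" "1 \<notin> J"
    and hw: "\<And>i j r. i \<in> idx n \<Longrightarrow> j \<in> idx n \<Longrightarrow> i < j \<Longrightarrow> \<phi> (s_ser i j $ r) \<in> J"
      "\<And>i r. i \<in> {1..n} \<Longrightarrow> \<phi> (s_ser (int i) (int i) $ r - scal (\<mu> i $ r)) \<in> J"
    and I: "finite I" "I \<subseteq> FA n"
    and fd: "\<And>f. f \<in> FA n \<Longrightarrow> \<exists>c. \<phi> (f - (\<Sum>g\<in>I. scal (c g) * g)) \<in> J"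
  shows "\<exists>V. simple_verma_quotient n \<mu> V \<and> highest_weight_rep n \<mu> V \<and> finite_dimensional n V"
proof -
  interpret \<phi>: ring_1_hom \<phi> by fact
  let ?Y = "twisted_Yangian n :: 'k yelt ring"
  let ?M = "regular_module ?Y"
  let ?X = "verma_relators n \<mu>"
  let ?L = "gen_submodule ?Y ?M ?X"
  interpret Reg: left_module ?Y ?M by (rule left_module_regular[OF ring_twisted_Yangian])
  have cM: "carrier ?M = carrier ?Y" by (simp add: regular_module_def)
  have X: "?X \<subseteq> carrier ?M"
    unfolding cM verma_relators_def ygen_def
    by (auto intro!: yclass_closed s_ser_in_FA FA_closed idx_pos)
  interpret L: submodule_of_left_module ?Y ?M ?L
    by (intro submodule_of_left_module.intro submodule_of_left_module_axioms.intro
        Reg.left_module_axioms submodule_gen_submodule X)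
  have verma: "L.Q = verma n \<mu>" by (simp add: verma_def)
  interpret Verma: left_module ?Y L.Q by (rule L.left_module_Q)
  define JY where "JY = {yclass n f | f. f \<in> FA n \<and> \<phi> f \<in> J}"
  have Jadd: "a + b \<in> J" if "a \<in> J" "b \<in> J" for a b using J that by (simp add: left_ideal_def)
  have Jmult: "r * a \<in> J" if "a \<in> J" for a r using J that by (simp add: left_ideal_def)
  have JY_sub: "submodule JY ?Y ?M"
  proof (rule Reg.submodule_left_moduleI)
    show "JY \<subseteq> carrier ?M" by (auto simp: JY_def cM yclass_closed)
    show "\<zero>\<^bsub>?M\<^esub> \<in> JY"
      using J FA_closed(1) yclass_0[of n, symmetric] \<phi>.hom_0
      by (auto simp: JY_def regular_module_def left_ideal_def intro!: exI[of _ 0])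
    show "x \<oplus>\<^bsub>?M\<^esub> y \<in> JY" if "x \<in> JY" "y \<in> JY" for x y
      using that by (force simp: JY_def regular_module_def yclass_add FA_closed \<phi>.homs Jadd)
    show "a \<odot>\<^bsub>?M\<^esub> x \<in> JY" if "a \<in> carrier ?Y" "x \<in> JY" for a x
      using that by (force simp: JY_def regular_module_def carrier_twisted_Yangian yclass_mult FA_closed \<phi>.homs Jmult)
  qed
  have JYI: "yclass n f \<in> JY" if "f \<in> FA n" "\<phi> f \<in> J" for f using that by (auto simp: JY_def)
  have "?X \<subseteq> JY"
    unfolding verma_relators_def ygen_def
    by (auto intro!: JYI s_ser_in_FA FA_closed(3,5) idx_pos hw)
  then have LJ: "?L \<subseteq> JY" by (rule gen_submodule_least[OF JY_sub])
  \<comment> \<open>Membership in \<open>JY\<close> does not depend on the representative, because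
    \<open>\<phi>\<close> kills the relation ideal.\<close>
  have JYD: "\<phi> f \<in> J" if f: "f \<in> FA n" and y: "yclass n f \<in> JY" for f
  proof -
    obtain g where g: "g \<in> FA n" "\<phi> g \<in> J" "yclass n f = yclass n g" using y by (auto simp: JY_def)
    have "\<phi> (f - g) = 0" by (rule rel_ideal_vanish[OF hom rel yclass_eqD[OF f g(1,3)]])
    then show ?thesis using g by (simp add: \<phi>.hom_diff)
  qed
  define e where "e = L.proj \<one>\<^bsub>?Y\<^esub>"
  have one: "\<one>\<^bsub>?Y\<^esub> \<in> carrier ?M" using yclass_closed[OF FA_closed(2), of n] by (simp add: cM yclass_1)
  have e: "e \<in> carrier L.Q" using one by (simp add: e_def L.carrier_Q)
  have gen: "\<exists>a\<in>carrier ?Y. x = a \<odot>\<^bsub>L.Q\<^esub> e" if xQ: "x \<in> carrier L.Q" for x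
  proof -
    obtain y where y: "y \<in> carrier ?Y" "x = L.proj y" using xQ by (auto simp: L.carrier_Q cM)
    have "y \<odot>\<^bsub>?M\<^esub> \<one>\<^bsub>?Y\<^esub> = y" using y Reg.R.r_one by (simp add: regular_module_def)
    then have "x = y \<odot>\<^bsub>L.Q\<^esub> e" using y one by (simp add: e_def L.proj_smult)
    then show ?thesis using y by blast
  qed
  have N0: "submodule (L.proj ` JY) ?Y L.Q"
  proof (rule Verma.submodule_left_moduleI)
    note sub = submodule_subset[OF JY_sub]
    show "L.proj ` JY \<subseteq> carrier L.Q" using sub by (auto simp: L.carrier_Q)
    show "\<zero>\<^bsub>L.Q\<^esub> \<in> L.proj ` JY" using submodule_zero[OF JY_sub] L.proj_0 by (metis imageI)
    show "x \<oplus>\<^bsub>L.Q\<^esub> y \<in> L.proj ` JY" if xy: "x \<in> L.proj ` JY" "y \<in> L.proj ` JY" for x y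
    proof -
      obtain x' y' where *: "x' \<in> JY" "y' \<in> JY" "x = L.proj x'" "y = L.proj y'" using xy by blast
      then have "x \<oplus>\<^bsub>L.Q\<^esub> y = L.proj (x' \<oplus>\<^bsub>?M\<^esub> y')" using sub by (simp add: L.proj_add subsetD)
      moreover have "x' \<oplus>\<^bsub>?M\<^esub> y' \<in> JY" by (rule submodule_add[OF JY_sub *(1,2)])
      ultimately show ?thesis by (simp only: imageI)
    qed
    show "a \<odot>\<^bsub>L.Q\<^esub> x \<in> L.proj ` JY" if ax: "a \<in> carrier ?Y" "x \<in> L.proj ` JY" for a x
    proof -
      obtain x' where *: "x' \<in> JY" "x = L.proj x'" using ax by blast
      then have "a \<odot>\<^bsub>L.Q\<^esub> x = L.proj (a \<odot>\<^bsub>?M\<^esub> x')" using sub ax(1) by (simp add: L.proj_smult subsetD)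
      moreover have "a \<odot>\<^bsub>?M\<^esub> x' \<in> JY" by (rule submodule.smult_closed[OF JY_sub ax(1) *(1)])
      ultimately show ?thesis by (simp only: imageI)
    qed
  qed
  \<comment> \<open>Since \<open>JY\<close> contains the submodule defining the Verma module,
    \<open>e\<close> in the image would put 1 into \<open>JY\<close> and hence into
    \<open>J\<close>.\<close>
  have eN0: "e \<notin> L.proj ` JY"
  proof
    assume "e \<in> L.proj ` JY"
    then obtain y where y: "y \<in> JY" "L.proj \<one>\<^bsub>?Y\<^esub> = L.proj y" by (auto simp: e_def)
    have yc: "y \<in> carrier ?M" using y submodule_subset[OF JY_sub] by blast
    have "\<one>\<^bsub>?Y\<^esub> \<ominus>\<^bsub>?M\<^esub> y \<in> JY" using y L.proj_eq_iff[OF one yc] LJ by blast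
    then have "(\<one>\<^bsub>?Y\<^esub> \<ominus>\<^bsub>?M\<^esub> y) \<oplus>\<^bsub>?M\<^esub> y \<in> JY" using y submodule_add[OF JY_sub] by blast
    moreover have "(\<one>\<^bsub>?Y\<^esub> \<ominus>\<^bsub>?M\<^esub> y) \<oplus>\<^bsub>?M\<^esub> y = yclass n 1"
      using one yc by (simp add: Reg.M.minus_eq Reg.M.a_assoc Reg.M.l_neg yclass_1)
    ultimately show False using JYD[OF FA_closed(2)] J(2) by (simp add: \<phi>.hom_1)
  qed
  obtain N where N: "submodule N ?Y L.Q" "L.proj ` JY \<subseteq> N" "e \<notin> N" "irreducible_module ?Y (quot_module L.Q N)"
    using exists_simple_quotient[OF L.left_module_Q e gen N0 eN0] by blast
  interpret N: submodule_of_left_module ?Y L.Q N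
    by (intro submodule_of_left_module.intro submodule_of_left_module_axioms.intro L.left_module_Q N(1))
  interpret V: left_module ?Y N.Q by (rule N.left_module_Q)
  \<comment> \<open>The class of \<open>f\<close> applied to the highest vector \<open>q 1\<close>;
    all remaining claims about the quotient are computed through \<open>q\<close>.\<close>
  define q where "q f = N.proj (L.proj (yclass n f))" for f
  have yM: "yclass n f \<in> carrier ?M" if "f \<in> FA n" for f using that by (simp add: cM yclass_closed)
  have yL: "L.proj (yclass n f) \<in> carrier L.Q" if "f \<in> FA n" for f using yM[OF that] by (simp add: L.carrier_Q)
  have surj: "carrier N.Q = q ` FA n"
    by (auto simp: N.carrier_Q L.carrier_Q cM carrier_twisted_Yangian q_def)
  have q_add: "q f \<oplus>\<^bsub>N.Q\<^esub> q g = q (f + g)" if "f \<in> FA n" "g \<in> FA n" for f g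
    using that by (simp add: q_def N.proj_add L.proj_add yM yL) (simp add: regular_module_def yclass_add)
  have q_mult: "yclass n f \<odot>\<^bsub>N.Q\<^esub> q g = q (f * g)" if "f \<in> FA n" "g \<in> FA n" for f g
    using that by (simp add: q_def N.proj_smult L.proj_smult yM yL yclass_closed) (simp add: regular_module_def yclass_mult)
  have q_J: "q f = \<zero>\<^bsub>N.Q\<^esub>" if "f \<in> FA n" "\<phi> f \<in> J" for f
  proof -
    have "L.proj (yclass n f) \<in> N" using N(2) that by (auto simp: JY_def)
    then show ?thesis unfolding q_def using N.proj_zero_iff[OF yL[OF that(1)]] by simp
  qed
  have q_cong: "q f = q g" if fg: "f \<in> FA n" "g \<in> FA n" "\<phi> (f - g) \<in> J" for f g
  proof -
    have "q f = q (f - g) \<oplus>\<^bsub>N.Q\<^esub> q g" using fg by (simp add: q_add FA_closed)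
    also have "\<dots> = q g" using fg surj by (simp add: q_J FA_closed)
    finally show ?thesis .
  qed
  have q1: "q 1 \<noteq> \<zero>\<^bsub>N.Q\<^esub>"
    using N.proj_zero_iff[OF e] N(3) by (simp add: q_def e_def yclass_1)
  have simple: "simple_verma_quotient n \<mu> N.Q"
    unfolding simple_verma_quotient_def verma[symmetric] using N(1,4) by blast
  have h1: "gen_submodule ?Y N.Q {q 1} = carrier N.Q"
  proof
    have top: "submodule (carrier N.Q) ?Y N.Q"
      by (rule V.submodule_left_moduleI) (auto simp: V.smult_closed)
    show "gen_submodule ?Y N.Q {q 1} \<subseteq> carrier N.Q"
      by (rule gen_submodule_least[OF top]) (auto simp: surj FA_closed)
    show "carrier N.Q \<subseteq> gen_submodule ?Y N.Q {q 1}"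
    proof
      fix v assume "v \<in> carrier N.Q"
      then obtain f where f: "f \<in> FA n" "v = q f" by (auto simp: surj)
      then have "v = yclass n f \<odot>\<^bsub>N.Q\<^esub> q 1" by (simp add: q_mult FA_closed)
      then show "v \<in> gen_submodule ?Y N.Q {q 1}"
        using f submodule.smult_closed[OF _ yclass_closed[OF f(1)]] by (auto simp: gen_submodule_def)
    qed
  qed
  have h2: "ygen n i j r \<odot>\<^bsub>N.Q\<^esub> q 1 = \<zero>\<^bsub>N.Q\<^esub>" if "i \<in> idx n" "j \<in> idx n" "i < j" for i j r
    using that by (simp add: ygen_def q_mult q_J hw s_ser_in_FA FA_closed)
  have h3: "ygen n (int i) (int i) r \<odot>\<^bsub>N.Q\<^esub> q 1 = yscal n (\<mu> i $ r) \<odot>\<^bsub>N.Q\<^esub> q 1" if "i \<in> {1..n}" for i r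
    using idx_pos[OF that] hw(2)[OF that]
    by (simp add: ygen_def yscal_def q_mult s_ser_in_FA FA_closed) (intro q_cong s_ser_in_FA FA_closed)
  have hwr: "highest_weight_rep n \<mu> N.Q"
    unfolding highest_weight_rep_def
    by (intro conjI N.left_module_Q bexI[of _ "q 1"] q1 h1 ballI impI allI h2 h3)
       (simp_all add: surj FA_closed)
  have span: "\<exists>c. q f = q (\<Sum>g\<in>I. scal (c g) * g)" if "f \<in> FA n" for f
  proof -
    obtain c where c: "\<phi> (f - (\<Sum>g\<in>I. scal (c g) * g)) \<in> J" using fd \<open>f \<in> FA n\<close> by blast
    have "(\<Sum>g\<in>I. scal (c g) * g) \<in> FA n"
      using I by (intro subring_set_sum[OF subring_set_free_alg] FA_closed) auto
    then show ?thesis using q_cong c that by blast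
  qed
  have "finite_dimensional n N.Q"
    by (rule finite_dimensionalI[OF N.left_module_Q surj q_add q_mult I span])
  with simple hwr show ?thesis by blast
qed


section \<open>Finite-dimensional modules from the Fock space\<close>

text \<open>The finitely many coordinate vectors only bound the size of \<open>B\<close>. Its
  members are taken from \<open>W\<close> itself because later they must be values of algebra
  elements on the vacuum.\<close>

lemma finite_support_basis:
  fixes W :: "(nat set \<Rightarrow> 'k::field) set"
  assumes M: "finite M" and W: "W \<subseteq> finite_support M \<Omega>"
  shows "\<exists>B. finite B \<and> B \<subseteq> W \<and> (\<forall>w\<in>W. \<exists>c. \<forall>A. w A = (\<Sum>b\<in>B. c b * b A))"
proof -
  interpret vs: vector_space "\<lambda>(c::'k) (u::nat set \<Rightarrow> 'k) A. c * u A"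
    by standard (auto simp: fun_eq_iff algebra_simps)
  have sum_app: "(\<Sum>i\<in>I. f i) A = (\<Sum>i\<in>I. f i A)" for f :: "'b \<Rightarrow> nat set \<Rightarrow> 'k" and I A
    by (induction I rule: infinite_finite_induct) auto
  define S where "S = {A. A - M = \<Omega> - M}"
  define \<delta> :: "nat set \<Rightarrow> nat set \<Rightarrow> 'k" where "\<delta> A = (\<lambda>A'. if A' = A then 1 else 0)" for A
  have "S \<subseteq> (\<lambda>X. X \<union> (\<Omega> - M)) ` Pow M"
  proof
    fix A assume "A \<in> S"
    then have "A = (A \<inter> M) \<union> (\<Omega> - M)" by (auto simp: S_def)
    then show "A \<in> (\<lambda>X. X \<union> (\<Omega> - M)) ` Pow M" by blast
  qed
  then have S: "finite S" by (rule finite_subset) (simp add: M)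
  have "u \<in> vs.span (\<delta> ` S)" if "u \<in> W" for u
  proof -
    have u: "u A = 0" if "A \<notin> S" for A using that W \<open>u \<in> W\<close> by (auto simp: finite_support_def S_def)
    have "u = (\<Sum>A\<in>S. (\<lambda>A'. u A * \<delta> A A'))"
      using S u by (auto simp: fun_eq_iff sum_app \<delta>_def if_distrib[of "\<lambda>x. _ * x"] cong: if_cong)
    also have "\<dots> \<in> vs.span (\<delta> ` S)"
      by (intro vs.span_sum vs.span_scale vs.span_base imageI)
    finally show ?thesis .
  qed
  then have W\<delta>: "W \<subseteq> vs.span (\<delta> ` S)" by blast
  obtain B where B: "B \<subseteq> W" "vs.independent B" "W \<subseteq> vs.span B"
    by (rule vs.maximal_independent_subset)
  have fB: "finite B"
    using vs.independent_span_bound[OF _ B(2), of "\<delta> ` S"] S B(1) W\<delta> by blast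
  have "\<exists>c. \<forall>A. w A = (\<Sum>b\<in>B. c b * b A)" if "w \<in> W" for w
  proof -
    have "w \<in> range (\<lambda>c. \<Sum>b\<in>B. (\<lambda>A. c b * b A))"
      using that B(3) unfolding vs.span_finite[OF fB] by blast
    then show ?thesis by (auto simp: sum_app)
  qed
  with B(1) fB show ?thesis by blast
qed

text \<open>The left ideal is the annihilator of the vacuum, and \<open>I\<close> lifts a finite
  basis of the space of all values on the vacuum to algebra elements.\<close>

theorem fock_highest_weight_module:
  fixes a :: "nat \<Rightarrow> 'k::field" and \<kappa> :: "nat \<Rightarrow> int"
  assumes two: "(2 :: 'k) \<noteq> 0"
  shows "\<exists>V. simple_verma_quotient n (\<lambda>i. hwt a \<kappa> m (int i)) V \<and>
    highest_weight_rep n (\<lambda>i. hwt a \<kappa> m (int i)) V \<and> finite_dimensional n V"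
proof -
  define \<gamma> where "\<gamma> = (\<lambda>(r, i, j). dressed n a m i j $ r)"
  interpret E: free_algebra_eval fock_scal \<gamma>
    by (intro free_algebra_eval.intro free_algebra_eval_axioms.intro ring_1_hom_fock_scal central_fock_scal)
  define \<phi> where "\<phi> = free_eval fock_scal \<gamma>"
  have hom: "ring_1_hom \<phi>" unfolding \<phi>_def by (rule E.ring_1_hom_free_eval)
  interpret \<phi>: ring_1_hom \<phi> by fact
  have scal: "\<phi> (scal c) = fock_scal c" for c by (simp add: \<phi>_def E.free_eval_scal)
  have gen: "\<phi> (s_ser i j $ r) = dressed n a m i j $ r" if "i \<in> idx n" "j \<in> idx n" for i j r
  proof (cases "r = 0")
    case True
    then show ?thesis using dressed_nth_0[OF that, of a m] by (simp add: s_ser_def \<phi>.homs)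
  next
    case False
    then show ?thesis by (simp add: s_ser_def \<phi>_def E.free_eval_letter) (simp add: \<gamma>_def)
  qed
  have half: "1 / 2 + 1 / 2 = (1 :: 'k)" using two by (simp flip: add_divide_distrib)
  have rel: "\<phi> f = 0" if "f \<in> relators n" for f
  proof (rule relators_vanish[OF hom _ refl_eq_dressed _ that])
    show "fps_map \<phi> (s_ser i j) = dressed n a m i j" if "i \<in> idx n" "j \<in> idx n" for i j
      by (rule fps_ext) (simp add: gen that)
    show "symm_rel n (fps_const (\<phi> (scal (1 / 2))) * fps_X) (dressed n a m) (\<lambda>i j. at_neg (dressed n a m i j))"
      using symm_rel_dressed[OF half] by (simp only: scal)
  qed
  define J :: "'k fock_op set" where "J = {F. app F (vac \<kappa>) = (\<lambda>A. 0)}"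
  have J: "left_ideal J"
    by (auto simp: left_ideal_def J_def app_0 app_add app_mult app_zero)
  have "(vac \<kappa> :: nat set \<Rightarrow> 'k) (sea \<kappa>) \<noteq> 0" by (simp add: vac_def)
  then have J1: "1 \<notin> J" by (auto simp: J_def app_1)
  \<comment> \<open>The modes that can ever move: \<open>m\<close> copies of the index set, 2n in
    each.\<close>
  define M where "M = {mode \<alpha> i | \<alpha> i. \<alpha> < m \<and> i \<in> idx n}"
  have "M = (\<lambda>(\<alpha>, i). mode \<alpha> i) ` ({..<m} \<times> idx n)" by (auto simp: M_def)
  then have M: "finite M" by simp
  define C where "C = {F :: 'k fock_op. \<forall>u\<in>finite_support M (sea \<kappa>). app F u \<in> finite_support M (sea \<kappa>)}"
  have C: "subring_set C"
    by (auto simp: subring_set_def C_def app_1 app_diff app_mult) (auto simp: finite_support_def)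
  define w where "w f = app (\<phi> f) (vac \<kappa>)" for f
  have "w f \<in> finite_support M (sea \<kappa>)" if "f \<in> FA n" for f
  proof -
    have "\<phi> f \<in> C" unfolding \<phi>_def
    proof (rule E.free_eval_closed[OF C _ _ that])
      show "fock_scal c \<in> C" for c by (auto simp: C_def finite_support_def app_scal)
      show "\<gamma> g \<in> C" if g: "g \<in> gens n" for g
      proof -
        obtain r i j where "g = (r, i, j)" "i \<in> idx n" "j \<in> idx n" using g by (auto simp: gens_def)
        then show ?thesis using dressed_support[of i n j _ m] by (auto simp: \<gamma>_def C_def M_def)
      qed
    qed
    moreover have "vac \<kappa> \<in> finite_support M (sea \<kappa>)" by (auto simp: finite_support_def vac_def)
    ultimately show ?thesis by (auto simp: C_def w_def)
  qed
  then have "w ` FA n \<subseteq> finite_support M (sea \<kappa>)" by blast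
  from finite_support_basis[OF M this] obtain B where B: "finite B" "B \<subseteq> w ` FA n"
    and span: "\<And>f. f \<in> FA n \<Longrightarrow> \<exists>c. \<forall>A. w f A = (\<Sum>b\<in>B. c b * b A)" by (auto simp: image_subset_iff)
  \<comment> \<open>One algebra element for each basis vector; \<open>w\<close> inverts the choice,
    so coefficients on \<open>B\<close> become coefficients on the chosen elements.\<close>
  define g where "g = inv_into (FA n) w"
  have g: "g b \<in> FA n" "w (g b) = b" if "b \<in> B" for b
    unfolding g_def using that B by (auto intro: inv_into_into f_inv_into_f)
  have inj: "inj_on g B" using g by (metis inj_onI)
  show ?thesis
  proof (rule highest_weight_module[OF hom rel J J1, where I = "g ` B"])
    note hw = hw_mod_dressed[of n \<kappa> a m]
    show "\<phi> (s_ser i j $ r) \<in> J" if "i \<in> idx n" "j \<in> idx n" "i < j" for i j r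
      using hw that by (auto simp: hw_mod_def fps_ann_def J_def gen)
    show "\<phi> (s_ser (int i) (int i) $ r - scal (hwt a \<kappa> m (int i) $ r)) \<in> J" if "i \<in> {1..n}" for i r
    proof -
      have "dressed n a m (int i) (int i) - fps_map fock_scal (hwt a \<kappa> m (int i)) \<in> fps_ann (vac \<kappa>)"
        using hw that unfolding hw_mod_def by auto
      then show ?thesis
        unfolding \<phi>.hom_diff gen[OF idx_pos[OF that] idx_pos[OF that]] scal
        by (auto simp: fps_ann_def J_def)
    qed
    show "finite (g ` B)" "g ` B \<subseteq> FA n" using B g by auto
    show "\<exists>c. \<phi> (f - (\<Sum>x\<in>g ` B. scal (c x) * x)) \<in> J" if f: "f \<in> FA n" for f
    proof -
      obtain c where c: "\<And>A. w f A = (\<Sum>b\<in>B. c b * b A)" using span[OF f] by blast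
      have "\<phi> (f - (\<Sum>x\<in>g ` B. scal (c (w x)) * x)) = \<phi> f - (\<Sum>b\<in>B. fock_scal (c b) * \<phi> (g b))"
        using g by (simp add: \<phi>.hom_diff \<phi>.hom_sum \<phi>.hom_mult scal sum.reindex[OF inj])
      moreover have "app (\<Sum>b\<in>B. fock_scal (c b) * \<phi> (g b)) (vac \<kappa>) A = w f A" for A
        unfolding c using g by (simp add: app_sum app_mult app_scal w_def)
      ultimately have "\<phi> (f - (\<Sum>x\<in>g ` B. scal (c (w x)) * x)) \<in> J"
        by (simp add: J_def app_diff w_def)
      then show ?thesis by (rule exI[of _ "\<lambda>x. c (w x)"])
    qed
  qed
qed


section \<open>Drinfeld polynomials\<close>

text \<open>A root \<open>a\<close> of \<open>P\<^sub>i\<close> with \<open>i \<ge> 2\<close> is realised by a dressing with \<open>\<kappa> = i - 1\<close>, a pair of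
  roots \<open>a\<close>, \<open>1 - a\<close> of \<open>P\<^sub>1\<close> by one with \<open>\<kappa> = 0\<close>.\<close>

definition hw_factor :: "'k::comm_ring_1 \<Rightarrow> int \<Rightarrow> int \<Rightarrow> 'k fps" where
  "hw_factor a \<kappa> i = (1 - fps_const a * fps_X + fps_X * fps_const (if i \<le> \<kappa> then 1 else 0)) *
     (1 + fps_const a * fps_X - fps_X * fps_const (if - i \<le> \<kappa> then 1 else 0))"

definition hw_list :: "('k::comm_ring_1 \<times> int) list \<Rightarrow> int \<Rightarrow> 'k fps" where
  "hw_list ps i = (\<Prod>(a, \<kappa>)\<leftarrow>ps. hw_factor a \<kappa> i)"

text \<open>Lists make the weight multiplicative under concatenation, while the Fock space
  construction numbers its dressing steps.\<close>

lemma hw_list_eq_hwt: "hw_list ps i = hwt (\<lambda>t. fst (ps ! t)) (\<lambda>t. snd (ps ! t)) (length ps) i"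
proof -
  have "hwt a \<kappa> m i = (\<Prod>t<m. hw_factor (a t) (\<kappa> t) i)" for a :: "nat \<Rightarrow> 'a" and \<kappa> m
    by (induction m) (simp_all add: hw_factor_def mult.commute)
  then show ?thesis
    by (simp add: hw_list_def prod.list_conv_set_nth atLeast0LessThan case_prod_beta)
qed

lemma hw_factor_nth_0: "hw_factor a \<kappa> i $ 0 = 1"
  by (simp add: hw_factor_def)

lemma hw_list_simps [simp]:
  "hw_list [] i = 1" "hw_list ((a, \<kappa>) # ps) i = hw_factor a \<kappa> i * hw_list ps i"
  "hw_list (ps @ qs) i = hw_list ps i * hw_list qs i"
  by (simp_all add: hw_list_def)

lemma hw_list_nth_0: "hw_list ps i $ 0 = 1"
  by (induction ps) (auto simp: hw_factor_nth_0 fps_mult_nth_0)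

section \<open>Weight quotients and shift quotients of polynomials\<close>

lemma poly_in_u_0 [simp]: "poly_in_u 0 = 0"
  by (simp add: poly_in_u_def)

lemma poly_in_u_pCons [simp]: "poly_in_u (pCons c q) = fls_const c + fls_X_inv * poly_in_u q"
  by (simp add: poly_in_u_def map_poly_pCons)

lemma poly_in_u_add: "poly_in_u (p + q) = poly_in_u p + poly_in_u q"
proof (induction p arbitrary: q)
  case (pCons a p)
  show ?case by (cases q) (simp add: pCons.IH distrib_left fls_plus_const[symmetric])
qed simp

lemma poly_in_u_smult: "poly_in_u (Polynomial.smult c p) = fls_const c * poly_in_u p"
  by (induction p) (simp_all add: algebra_simps)

lemma poly_in_u_mult: "poly_in_u (p * q) = poly_in_u p * poly_in_u q"
  by (induction p) (simp_all add: poly_in_u_add poly_in_u_smult algebra_simps)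

lemma poly_in_u_1 [simp]: "poly_in_u 1 = 1"
  by (simp add: one_pCons)

definition shift_quot :: "'k::field poly \<Rightarrow> 'k fls" where
  "shift_quot q = poly_in_u (pcompose q [:1, 1:]) / poly_in_u q"

lemma shift_quot_mult: "shift_quot (p * q) = shift_quot p * shift_quot q"
  by (simp add: shift_quot_def pcompose_mult poly_in_u_mult)

lemma shift_quot_1: "shift_quot 1 = 1"
  by (simp add: shift_quot_def pcompose_1)

text \<open>This is (u - a)/u; the powers of u cancel in all quotients that follow.\<close>

definition lin_fls :: "'k::field \<Rightarrow> 'k fls" where
  "lin_fls a = 1 - fls_const a * fls_X"

lemma poly_in_u_linear: "poly_in_u [:- a, 1:] = fls_X_inv * lin_fls a"
proof -
  have "fls_X_inv * fls_X = (1 :: 'a fls)"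
    by (simp add: fls_X_inv_times_conv_shift)
  then have "fls_X_inv * (fls_const a * fls_X) = fls_const a"
    by (metis mult.commute mult.left_commute mult_1)
  then show ?thesis by (simp add: lin_fls_def right_diff_distrib)
qed

lemma lin_fls_nonzero: "lin_fls a \<noteq> 0"
proof
  assume "lin_fls a = 0"
  then have "fls_nth (lin_fls a) 0 = 0" by simp
  then show False by (simp add: lin_fls_def)
qed

lemma shift_quot_linear: "shift_quot [:- a, 1:] = lin_fls (a - 1) / lin_fls a"
proof -
  have e: "pcompose [:- a, 1:] [:1, 1:] = [:- (a - 1), 1:]"
    by (simp add: pcompose_pCons)
  show ?thesis unfolding shift_quot_def e poly_in_u_linear by simp
qed

text \<open>For \<open>i \<ge> 1\<close> and \<open>\<kappa> \<ge> 0\<close> the index -i is always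
  occupied, so the second factor depends on neither \<open>i\<close> nor
  \<open>\<kappa>\<close>.\<close>

lemma hw_factor_fls:
  assumes "i \<ge> 1" "\<kappa> \<ge> 0"
  shows "fps_to_fls (hw_factor a \<kappa> i) = lin_fls (if i \<le> \<kappa> then a - 1 else a) * lin_fls (1 - a)"
proof -
  have "hw_factor a \<kappa> i = (1 - fps_const (if i \<le> \<kappa> then a - 1 else a) * fps_X) * (1 - fps_const (1 - a) * fps_X)"
    using assms by (simp add: hw_factor_def fps_eq_iff algebra_simps flip: fps_const_sub)
  then show ?thesis by (simp add: lin_fls_def fls_times_fps_to_fls)
qed

lemma at_neg_hw_factor_fls:
  assumes "i \<ge> 1" "\<kappa> \<ge> 0"
  shows "fps_to_fls (at_neg (hw_factor a \<kappa> i)) = lin_fls (if i \<le> \<kappa> then 1 - a else - a) * lin_fls (a - 1)"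
proof -
  have "at_neg (hw_factor a \<kappa> i) = (1 - fps_const (if i \<le> \<kappa> then 1 - a else - a) * fps_X) * (1 - fps_const (a - 1) * fps_X)"
    using assms by (simp add: hw_factor_def at_neg_mult at_neg_add at_neg_diff fps_eq_iff algebra_simps flip: fps_const_sub)
  then show ?thesis by (simp add: lin_fls_def fls_times_fps_to_fls)
qed

definition weight_quot :: "('k::field \<times> int) list \<Rightarrow> int \<Rightarrow> 'k fls" where
  "weight_quot ps i = fps_to_fls (hw_list ps i) / fps_to_fls (hw_list ps (i + 1))"

definition sign_quot :: "('k::field \<times> int) list \<Rightarrow> 'k fls" where
  "sign_quot ps = fps_to_fls (at_neg (hw_list ps 1)) / fps_to_fls (hw_list ps 1)"

lemma weight_quot_append: "weight_quot (ps @ qs) i = weight_quot ps i * weight_quot qs i"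
  by (simp add: weight_quot_def fls_times_fps_to_fls)

lemma sign_quot_append: "sign_quot (ps @ qs) = sign_quot ps * sign_quot qs"
  by (simp add: sign_quot_def fls_times_fps_to_fls at_neg_mult)

lemma quot_Nil [simp]: "weight_quot [] i = 1" "sign_quot [] = 1"
  by (simp_all add: weight_quot_def sign_quot_def)

text \<open>An occupied index contributes the parameter a - 1 and an empty one a, so neighbouring
  weights differ only across \<open>\<kappa>\<close>.\<close>

lemma weight_quot_single:
  assumes "i \<ge> 1" "\<kappa> \<ge> 0"
  shows "weight_quot [(a, \<kappa>)] i = (if i = \<kappa> then shift_quot [:- a, 1:] else 1)"
  using assms by (simp add: weight_quot_def hw_factor_fls shift_quot_linear lin_fls_nonzero)

text \<open>The substitution u -> -u negates the parameters. For \<open>\<kappa> \<ge> 1\<close> the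
  pair a - 1, 1 - a is preserved; for \<open>\<kappa> = 0\<close> the pair a, 1 - a becomes -a, a -
  1, which are the two roots lowered by 1.\<close>

lemma sign_quot_single:
  assumes "\<kappa> \<ge> 0"
  shows "sign_quot [(a, \<kappa>)] = (if \<kappa> = 0 then shift_quot ([:- a, 1:] * [:- (1 - a), 1:]) else 1)"
  using assms unfolding shift_quot_mult shift_quot_linear
  by (simp add: sign_quot_def hw_factor_fls at_neg_hw_factor_fls lin_fls_nonzero)

section \<open>Realising polynomials root by root\<close>

lemma monic_split:
  fixes q :: "'k::field poly"
  assumes "lead_coeff q = 1" "poly q a = 0"
  obtains r where "q = [:- a, 1:] * r" "lead_coeff r = 1" "degree q = Suc (degree r)"
proof -
  from assms(2) obtain r where r: "q = [:- a, 1:] * r" by (metis dvdE poly_eq_0_iff_dvd)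
  have "r \<noteq> 0" using r assms(1) by auto
  then have "degree q = Suc (degree r)" unfolding r by (subst degree_mult_eq) auto
  moreover have "lead_coeff r = 1" using assms(1) unfolding r by (simp only: lead_coeff_mult) simp
  ultimately show thesis using r that by blast
qed

lemma monic_root:
  fixes q :: "'k::alg_closed_field poly"
  assumes "lead_coeff q = 1" "q \<noteq> 1"
  obtains a where "poly q a = 0"
proof -
  have "degree q > 0"
  proof (rule ccontr)
    assume "\<not> degree q > 0"
    then obtain c where "q = [:c:]" using degree_0_id by (metis gr0I)
    then show False using assms by (simp add: one_pCons)
  qed
  then show thesis using alg_closed_imp_poly_has_root that by blast
qed

lemma weight_for_monic:
  fixes q :: "'k::alg_closed_field poly"
  assumes "lead_coeff q = 1" "\<kappa> \<ge> 1"
  shows "\<exists>ps. (\<forall>i\<ge>1. weight_quot ps i = (if i = \<kappa> then shift_quot q else 1)) \<and> sign_quot ps = 1"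
  using assms(1)
proof (induction "degree q" arbitrary: q rule: less_induct)
  case less
  show ?case
  proof (cases "q = 1")
    case True
    then show ?thesis by (intro exI[of _ "[]"]) (simp add: shift_quot_1)
  next
    case False
    then obtain a where "poly q a = 0" using monic_root less.prems by blast
    then obtain r where r: "q = [:- a, 1:] * r" "lead_coeff r = 1" "degree q = Suc (degree r)"
      using monic_split less.prems by metis
    then obtain ps where ps: "\<And>i. i \<ge> 1 \<Longrightarrow> weight_quot ps i = (if i = \<kappa> then shift_quot r else 1)" "sign_quot ps = 1"
      using less.hyps[of r] by auto
    have "weight_quot ([(a, \<kappa>)] @ ps) i = (if i = \<kappa> then shift_quot q else 1)" if "i \<ge> 1" for i
      using that assms(2) unfolding weight_quot_append r(1) shift_quot_mult
      by (simp add: weight_quot_single ps)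
    moreover have "sign_quot ([(a, \<kappa>)] @ ps) = 1"
      using assms(2) unfolding sign_quot_append by (simp add: sign_quot_single ps)
    ultimately show ?thesis by blast
  qed
qed

text \<open>Induction on the degree, removing a root together with its mirror image under u -> 1 -
  u; the cofactor is again symmetric.\<close>

lemma weight_for_symmetric:
  fixes q :: "'k::alg_closed_field poly"
  assumes two: "(2 :: 'k) \<noteq> 0" and "lead_coeff q = 1" "q = pcompose q [:1, -1:]"
  shows "\<exists>ps. (\<forall>i\<ge>1. weight_quot ps i = 1) \<and> sign_quot ps = shift_quot q"
  using assms(2,3)
proof (induction "degree q" arbitrary: q rule: less_induct)
  case less
  show ?case
  proof (cases "q = 1")
    case True
    then show ?thesis by (intro exI[of _ "[]"]) (simp add: shift_quot_1)
  next
    case False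
    have refl: "poly q (1 - x) = poly q x" for x
      using arg_cong[OF less.prems(2), of "\<lambda>p. poly p x"] by (simp add: poly_pcompose)
    obtain a where a: "poly q a = 0" using monic_root less.prems False by blast
    obtain r where r: "q = [:- a, 1:] * r" "lead_coeff r = 1" "degree q = Suc (degree r)"
      using monic_split[OF less.prems(1) a] .
    have c1: "pcompose [:- b, 1:] [:1, -1:] = - [:- (1 - b), 1:]" for b :: 'k
      by (simp add: pcompose_pCons)
    have "poly r (1 - a) = 0"
    proof (cases "1 - a = a")
      case False
      then show ?thesis using refl[of a] a r(1) by auto
    next
      \<comment> \<open>Here a = 1/2. Reflection negates u - a, so \<open>r\<close> is antisymmetric
        and vanishes at the fixed point because 2 is nonzero.\<close>
      case True
      have "[:- a, 1:] * r = - [:- a, 1:] * pcompose r [:1, -1:]"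
        using less.prems(2) unfolding r(1) pcompose_mult c1 True by (simp del: minus_mult_left)
      then have "[:- a, 1:] * r = [:- a, 1:] * (- pcompose r [:1, -1:])" by simp
      then have "r = - pcompose r [:1, -1:]" by (subst (asm) mult_cancel_left) auto
      from arg_cong[OF this, of "\<lambda>p. poly p a"] have "poly r a = - poly r (1 - a)"
        by (simp add: poly_pcompose)
      then have "2 * poly r a = 0" using True by simp
      then show ?thesis unfolding True using two by simp
    qed
    then obtain s where s: "r = [:- (1 - a), 1:] * s" "lead_coeff s = 1" "degree r = Suc (degree s)"
      using monic_split[OF r(2)] by metis
    \<comment> \<open>Reflection exchanges the two linear factors with one sign each, so
      \<open>t\<close> is invariant and cancelling it passes the symmetry on to
      \<open>s\<close>.\<close>
    define t where "t = [:- a, 1:] * [:- (1 - a), 1:]"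
    have q: "q = t * s" by (simp only: r(1) s(1) t_def mult.assoc)
    have t: "pcompose t [:1, -1:] = t"
      unfolding t_def pcompose_mult c1 by (simp add: algebra_simps)
    have "t * s = t * pcompose s [:1, -1:]"
      using less.prems(2) unfolding q pcompose_mult t .
    moreover have "t \<noteq> 0" by (simp add: t_def)
    ultimately have "s = pcompose s [:1, -1:]" by (metis mult_cancel_left)
    then obtain ps where ps: "\<And>i. i \<ge> 1 \<Longrightarrow> weight_quot ps i = 1" "sign_quot ps = shift_quot s"
      using less.hyps[of s] r(3) s(2,3) by auto
    have "weight_quot ([(a, 0)] @ ps) i = 1" if "i \<ge> 1" for i
      using that unfolding weight_quot_append by (simp add: weight_quot_single ps)
    moreover have "sign_quot ([(a, 0)] @ ps) = shift_quot q"
      unfolding sign_quot_append q shift_quot_mult t_def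
      by (simp only: sign_quot_single order_refl ps shift_quot_mult) simp
    ultimately show ?thesis by blast
  qed
qed

text \<open>\<open>P 1\<close> is realised first. The dressings added for the other polynomials have
  \<open>\<kappa> \<ge> 1\<close>, so they leave \<open>sign_quot\<close> alone, and each of them
  affects only the weight quotient with its own index.\<close>

lemma weight_for_tuple:
  fixes P :: "nat \<Rightarrow> 'k::alg_closed_field poly"
  assumes two: "(2 :: 'k) \<noteq> 0" and n: "n \<ge> 1" and monic: "\<forall>i\<in>{1..n}. lead_coeff (P i) = 1"
    and sym: "P 1 = pcompose (P 1) [:1, -1:]"
  shows "\<exists>ps. (\<forall>i\<in>{1..<n}. weight_quot ps (int i) = shift_quot (P (i + 1))) \<and> sign_quot ps = shift_quot (P 1)"
proof -
  have "k < n \<Longrightarrow> \<exists>ps. (\<forall>i\<ge>1. weight_quot ps (int i) = (if i \<le> k then shift_quot (P (i + 1)) else 1)) \<and>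
      sign_quot ps = shift_quot (P 1)" for k
  proof (induction k)
    case 0
    obtain ps where "\<And>i. i \<ge> 1 \<Longrightarrow> weight_quot ps i = 1" "sign_quot ps = shift_quot (P 1)"
      using weight_for_symmetric[OF two _ sym] monic n by auto
    then show ?case by (intro exI[of _ ps]) auto
  next
    case (Suc k)
    obtain ps where ps: "\<And>i. i \<ge> 1 \<Longrightarrow> weight_quot ps (int i) = (if i \<le> k then shift_quot (P (i + 1)) else 1)"
      "sign_quot ps = shift_quot (P 1)" using Suc by auto
    obtain qs where qs: "\<And>i. i \<ge> 1 \<Longrightarrow> weight_quot qs i = (if i = int (Suc k) then shift_quot (P (Suc k + 1)) else 1)"
      "sign_quot qs = 1"
      using weight_for_monic[of "P (Suc k + 1)" "int (Suc k)"] monic Suc.prems by auto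
    have "weight_quot (ps @ qs) (int i) = (if i \<le> Suc k then shift_quot (P (i + 1)) else 1)" if "i \<ge> 1" for i
    proof -
      consider "i \<le> k" | "i = Suc k" | "i > Suc k" by linarith
      then show ?thesis using that ps(1)[OF that] qs(1)[of "int i"] unfolding weight_quot_append
        by cases auto
    qed
    moreover have "sign_quot (ps @ qs) = shift_quot (P 1)" by (simp add: sign_quot_append ps qs)
    ultimately show ?case by blast
  qed
  from this[of "n - 1"] n obtain ps where
    "\<forall>i\<ge>1. weight_quot ps (int i) = (if i \<le> n - 1 then shift_quot (P (i + 1)) else 1)" "sign_quot ps = shift_quot (P 1)" by auto
  then show ?thesis by (intro exI[of _ ps]) auto
qed

theorem theorem3p32:
  fixes P :: "nat \<Rightarrow> 'k::alg_closed_field poly" and n p :: nat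
  assumes "CHAR('k) = p" and "p > 2" and "n \<ge> 1"
    and "\<forall>i\<in>{1..n}. lead_coeff (P i) = 1"
    and "P 1 = pcompose (P 1) [:1, -1:]"
  shows "\<exists>(\<mu> :: nat \<Rightarrow> 'k fps) V.
    (\<forall>i\<in>{1..n}. \<mu> i $ 0 = 1) \<and>
    simple_verma_quotient n \<mu> V \<and>
    highest_weight_rep n \<mu> V \<and>
    finite_dimensional n V \<and>
    (\<forall>i\<in>{1..<n}. fps_to_fls (\<mu> i) / fps_to_fls (\<mu> (i + 1)) =
       poly_in_u (pcompose (P (i + 1)) [:1, 1:]) / poly_in_u (P (i + 1))) \<and>
    fps_to_fls (at_neg (\<mu> 1)) / fps_to_fls (\<mu> 1) =
       poly_in_u (pcompose (P 1) [:1, 1:]) / poly_in_u (P 1)"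
proof -
  \<comment> \<open>A divisor of 2 is at most 2, so p > 2 makes 2 invertible.\<close>
  have "\<not> CHAR('k) dvd 2" using assms(1,2) dvd_imp_le by fastforce
  then have two: "(2 :: 'k) \<noteq> 0"
    using of_nat_eq_0_iff_char_dvd[where ?'a = 'k, of 2] by simp
  obtain ps where ps: "\<And>i. i \<in> {1..<n} \<Longrightarrow> weight_quot ps (int i) = shift_quot (P (i + 1))"
    "sign_quot ps = shift_quot (P 1)"
    using weight_for_tuple[OF two assms(3-5)] by blast
  define \<mu> where "\<mu> i = hw_list ps (int i)" for i
  have "\<mu> = (\<lambda>i. hwt (\<lambda>t. fst (ps ! t)) (\<lambda>t. snd (ps ! t)) (length ps) (int i))"
    by (simp add: \<mu>_def hw_list_eq_hwt fun_eq_iff)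
  then obtain V where V: "simple_verma_quotient n \<mu> V" "highest_weight_rep n \<mu> V" "finite_dimensional n V"
    using fock_highest_weight_module[OF two, of n "\<lambda>t. fst (ps ! t)" "\<lambda>t. snd (ps ! t)" "length ps"] by auto
  have "fps_to_fls (\<mu> i) / fps_to_fls (\<mu> (i + 1)) =
      poly_in_u (pcompose (P (i + 1)) [:1, 1:]) / poly_in_u (P (i + 1))" if "i \<in> {1..<n}" for i
    using ps(1)[OF that] by (simp add: weight_quot_def shift_quot_def \<mu>_def add.commute)
  moreover have "fps_to_fls (at_neg (\<mu> 1)) / fps_to_fls (\<mu> 1) =
      poly_in_u (pcompose (P 1) [:1, 1:]) / poly_in_u (P 1)"
    using ps(2) by (simp add: sign_quot_def shift_quot_def \<mu>_def)
  ultimately show ?thesis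
    using V by (intro exI[of _ \<mu>] exI[of _ V] conjI ballI) (auto simp: \<mu>_def hw_list_nth_0)
qed

end
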